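(* Let $M\in\mathcal{O}$. Then the Dirac cohomology $H_D^{\mathfrak{g},\mathfrak{h}}(M)$ is a finitely generated $U(\mathfrak{h})$-module, so that it belongs to the BGG category $\mathcal{O}(\mathfrak{h})$ of $\mathfrak{h}$.
   Context: Let $\mathfrak{g}$ be a finite-dimensional complex semisimple Lie algebra with Killing form $\langle\cdot,\cdot\rangle$, $\theta$ a Cartan involution of $\mathfrak{g}$, and $\mathfrak{h}\subseteq\mathfrak{g}$ a Lie subalgebra which is reductive, $\theta$-stable, such that $\langle\cdot,\cdot\rangle|_{\mathfrak{h}\times\mathfrak{h}}$ is nondegenerate, and which contains a Cartan subalgebra $\mathfrak{t}$ of $\mathfrak{g}$. Put $\mathfrak{q}=\mathfrak{h}^\perp$, so $\mathfrak{g}=\mathfrak{h}\oplus\mathfrak{q}$. The root system $\Delta=\Delta(\mathfrak{g},\mathfrak{t})$ is the disjoint union of $\Delta_\mathfrak{h}=\Delta(\mathfrak{h},\mathfrak{t})$ and $\Delta_\mathfrak{q}$ (the roots whose root spaces lie in $\mathfrak{q}$). Fix a positive system $\Delta^+$, and put $\Delta_\mathfrak{h}^+=\Delta^+\cap\Delta_\mathfrak{h}$, $\Delta_\mathfrak{q}^+=\Delta^+\cap\Delta_\mathfrak{q}$, $\mathfrak{n}=\bigoplus_{\alpha\in\Delta^+}\mathfrak{g}_\alpha$, $\mathfrak{n}_\mathfrak{h}=\bigoplus_{\alpha\in\Delta^+_\mathfrak{h}}\mathfrak{g}_\alpha$, $\mathfrak{n}_\mathfrak{q}^\pm=\bigoplus_{\beta\in\Delta_\mathfrak{q}^+}\mathfrak{g}_{\pm\beta}$.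 Category $\mathcal{O}$: finitely generated $U(\mathfrak{g})$-modules which are weight modules for $\mathfrak{t}$ (i.e. $\mathfrak{t}$ acts semisimply) and locally $\mathfrak{n}$-finite. $\mathcal{O}(\mathfrak{h})$ is the analogous category for $\mathfrak{h}$ (finitely generated $U(\mathfrak{h})$-modules, weight modules for $\mathfrak{t}$, locally $\mathfrak{n}_\mathfrak{h}$-finite). Clifford algebra and spin module: $\mathbf{C}(\mathfrak{q})$ is the quotient of the tensor algebra $T(\mathfrak{q})$ by the relations $X\otimes Y+Y\otimes X=\langle X,Y\rangle$. The spin module is $S=\bigwedge\mathfrak{n}_\mathfrak{q}^-$, with Clifford action $\gamma$ in which $\mathfrak{n}_\mathfrak{q}^-$ acts by exterior multiplication and $\mathfrak{n}_\mathfrak{q}^+$ by contraction via $\langle\cdot,\cdot\rangle$. For $a,b\in\mathfrak{q}$ let $R_{a,b}\in\mathfrak{so}(\mathfrak{q})$, $R_{a,b}(v)=\langle b,v\rangle a-\langle a,v\rangle b$; these span $\mathfrak{so}(\mathfrak{q})$ and $\varphi(R_{a,b})=\frac12[\gamma(a),\gamma(b)]$ defines an injective Lie algebra map $\varphi:\mathfrak{so}(\mathfrak{q})\to\mathbf{C}(\mathfrak{q})$. $\mathfrak{h}$ acts on $S$ via $\mathfrak{h}\xrightarrow{\mathrm{ad}}\mathfrak{so}(\mathfrak{q})\xrightarrow{\varphi}\mathbf{C}(\mathfrak{q})\to\mathrm{End}(S)$, and on $M\otimes S$ diagonally. Dirac operator: for a $\mathfrak{g}$-module $(M,\pi)$ and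 an orthonormal basis $\{Z_j\}$ of $\mathfrak{q}$, $D_{\mathfrak{g},\mathfrak{h}}(M)=\sum_j\pi(Z_j)\otimes\gamma(Z_j)-1\otimes\gamma(c)$ acting on $M\otimes S$, where $\gamma(c)=\frac16\sum_{i,j,k}\langle Z_i,[Z_j,Z_k]\rangle\gamma(Z_i)\gamma(Z_j)\gamma(Z_k)$. It is independent of the basis and $\mathfrak{h}$-equivariant. The Dirac cohomology is the $\mathfrak{h}$-module $H_D^{\mathfrak{g},\mathfrak{h}}(M)=\ker D_{\mathfrak{g},\mathfrak{h}}(M)/(\mathrm{im}\,D_{\mathfrak{g},\mathfrak{h}}(M)\cap\ker D_{\mathfrak{g},\mathfrak{h}}(M))$. *)

theory Defs
  imports Complex_Main "HOL-Library.Poly_Mapping" "HOL-Algebra.Module"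
begin

section \<open>Complex vector spaces\<close>

class complex_vec = ab_group_add +
  fixes scaleC :: "complex \<Rightarrow> 'a \<Rightarrow> 'a"  (infixr "*\<^sub>C" 75)
  assumes scaleC_add_right: "c *\<^sub>C (x + y) = c *\<^sub>C x + c *\<^sub>C y"
    and scaleC_add_left: "(c + d) *\<^sub>C x = c *\<^sub>C x + d *\<^sub>C x"
    and scaleC_scaleC: "c *\<^sub>C d *\<^sub>C x = (c * d) *\<^sub>C x"
    and scaleC_one: "1 *\<^sub>C x = x"

global_interpretation cvec: vector_space "scaleC :: complex \<Rightarrow> 'a \<Rightarrow> 'a::complex_vec"
  by unfold_locales (simp_all add: scaleC_add_right scaleC_add_left scaleC_scaleC scaleC_one)

abbreviation clinear :: "('a::complex_vec \<Rightarrow> 'b::complex_vec) \<Rightarrow> bool"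
  where "clinear \<equiv> Vector_Spaces.linear scaleC scaleC"

lemma clinear_iff:
  "clinear f \<longleftrightarrow> (\<forall>x y. f (x + y) = f x + f y) \<and> (\<forall>c x. f (c *\<^sub>C x) = c *\<^sub>C f x)"
  unfolding Vector_Spaces.linear_def module_hom_def module_hom_axioms_def
  using cvec.vector_space_axioms[where 'a='a] cvec.module_axioms[where 'a='a]
    cvec.vector_space_axioms[where 'a='b] cvec.module_axioms[where 'a='b] by simp

definition finite_dim_type :: "'a::complex_vec itself \<Rightarrow> bool"
  where "finite_dim_type _ \<longleftrightarrow> (\<exists>B :: 'a set. finite B \<and> cvec.span B = UNIV)"

text \<open>The scalar field is explicit in the following definition because it is applied to a
  complex Lie algebra and to the underlying real one.\<close>

definition lin_trace :: "('k::field \<Rightarrow> 'v::ab_group_add \<Rightarrow> 'v) \<Rightarrow> ('v \<Rightarrow> 'v) \<Rightarrow> 'k" where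
  "lin_trace s f =
    (let B = (SOME B. \<not> Modules.module.dependent s B \<and> Modules.module.span s B = UNIV)
     in \<Sum>b\<in>B. Modules.module.representation s B (f b) b)"


section \<open>Lie algebras\<close>

locale lie_algebra =
  fixes br :: "'g::complex_vec \<Rightarrow> 'g \<Rightarrow> 'g"
  assumes br_linear_right: "clinear (br x)"
    and br_linear_left: "clinear (\<lambda>x. br x y)"
    and br_self: "br x x = 0"
    and jacobi: "br x (br y z) + br y (br z x) + br z (br x y) = 0"

context
  fixes br :: "'g::complex_vec \<Rightarrow> 'g \<Rightarrow> 'g"
begin

definition lie_subalgebra :: "'g set \<Rightarrow> bool" where
  "lie_subalgebra k \<longleftrightarrow> cvec.subspace k \<and> (\<forall>x\<in>k. \<forall>y\<in>k. br x y \<in> k)"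

definition lie_ideal :: "'g set \<Rightarrow> 'g set \<Rightarrow> bool" where
  "lie_ideal k a \<longleftrightarrow> cvec.subspace a \<and> a \<subseteq> k \<and> (\<forall>x\<in>k. \<forall>y\<in>a. br x y \<in> a)"

primrec derived_series :: "'g set \<Rightarrow> nat \<Rightarrow> 'g set" where
  "derived_series a 0 = a"
| "derived_series a (Suc n) =
     cvec.span {br x y | x y. x \<in> derived_series a n \<and> y \<in> derived_series a n}"

definition solvable :: "'g set \<Rightarrow> bool" where
  "solvable a \<longleftrightarrow> (\<exists>n. derived_series a n = {0})"

definition semisimple :: bool where
  "semisimple \<longleftrightarrow> (\<forall>a. lie_ideal UNIV a \<and> solvable a \<longrightarrow> a = {0})"

definition reductive :: "'g set \<Rightarrow> bool" where
  "reductive k \<longleftrightarrow>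
    (\<forall>a. lie_ideal k a \<longrightarrow>
      (\<exists>b. lie_ideal k b \<and> a \<inter> b = {0} \<and> {x + y | x y. x \<in> a \<and> y \<in> b} = k))"

definition killing :: "'g \<Rightarrow> 'g \<Rightarrow> complex" where
  "killing x y = lin_trace scaleC (\<lambda>z. br x (br y z))"

definition nondegenerate_on :: "'g set \<Rightarrow> bool" where
  "nondegenerate_on k \<longleftrightarrow> (\<forall>x\<in>k. (\<forall>y\<in>k. killing x y = 0) \<longrightarrow> x = 0)"

text \<open>A Cartan involution of a complex semisimple Lie algebra is one of the underlying real Lie
  algebra, whose Killing form \<open>B\<close> is the trace form over the reals; the condition is that
  \<open>(x, y) \<mapsto> - B x (\<theta> y)\<close> is positive definite.  (Symmetry of this form is automatic.)\<close>

definition scale_real :: "real \<Rightarrow> 'g \<Rightarrow> 'g" where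
  "scale_real r x = complex_of_real r *\<^sub>C x"

definition killing_real :: "'g \<Rightarrow> 'g \<Rightarrow> real" where
  "killing_real x y = lin_trace scale_real (\<lambda>z. br x (br y z))"

definition cartan_involution :: "('g \<Rightarrow> 'g) \<Rightarrow> bool" where
  "cartan_involution \<theta> \<longleftrightarrow>
     Vector_Spaces.linear scale_real scale_real \<theta> \<and>
     (\<forall>x y. \<theta> (br x y) = br (\<theta> x) (\<theta> y)) \<and>
     (\<forall>x. \<theta> (\<theta> x) = x) \<and>
     (\<forall>x. x \<noteq> 0 \<longrightarrow> - killing_real x (\<theta> x) > 0)"

text \<open>Cartan subalgebras of a semisimple Lie algebra: commutative, self-centralizing, and
  consisting of ad-diagonalizable elements (the textbook definition in the semisimple case).\<close>

definition cartan_subalgebra :: "'g set \<Rightarrow> bool" where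
  "cartan_subalgebra t \<longleftrightarrow>
     cvec.subspace t \<and>
     (\<forall>x\<in>t. \<forall>y\<in>t. br x y = 0) \<and>
     (\<forall>x. (\<forall>y\<in>t. br y x = 0) \<longrightarrow> x \<in> t) \<and>
     (\<forall>y\<in>t. cvec.span {x. \<exists>c. br y x = c *\<^sub>C x} = UNIV)"

end


section \<open>Roots\<close>

text \<open>Linear functionals on a subspace \<open>t\<close> are functions on the whole type that vanish
  outside \<open>t\<close>, so that equality of functionals is equality of functions and the set is closed
  under pointwise sums and negation.\<close>

definition dual_space :: "'g::complex_vec set \<Rightarrow> ('g \<Rightarrow> complex) set" where
  "dual_space t = {\<mu>. (\<forall>x\<in>t. \<forall>y\<in>t. \<mu> (x + y) = \<mu> x + \<mu> y) \<and>
                      (\<forall>c. \<forall>x\<in>t. \<mu> (c *\<^sub>C x) = c * \<mu> x) \<and>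
                      (\<forall>x. x \<notin> t \<longrightarrow> \<mu> x = 0)}"

context
  fixes br :: "'g::complex_vec \<Rightarrow> 'g \<Rightarrow> 'g" and t :: "'g set"
begin

definition root_space :: "'g set \<Rightarrow> ('g \<Rightarrow> complex) \<Rightarrow> 'g set" where
  "root_space k \<alpha> = {x \<in> k. \<forall>y\<in>t. br y x = \<alpha> y *\<^sub>C x}"

definition roots :: "'g set \<Rightarrow> ('g \<Rightarrow> complex) set" where
  "roots k = {\<alpha> \<in> dual_space t. \<alpha> \<noteq> (\<lambda>_. 0) \<and> root_space k \<alpha> \<noteq> {0}}"

definition real_root_span :: "('g \<Rightarrow> complex) set" where
  "real_root_span =
     {\<lambda>x. \<Sum>\<alpha>\<in>roots UNIV. complex_of_real (c \<alpha>) * \<alpha> x | c. True}"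

text \<open>A positive system consists of the roots that are positive for some notion of positivity
  (equivalently, some vector space ordering) on the real span of the roots.\<close>

definition positive_system :: "('g \<Rightarrow> complex) set \<Rightarrow> bool" where
  "positive_system Dp \<longleftrightarrow>
     (\<exists>P. P \<subseteq> real_root_span \<and>
          (\<forall>\<phi>\<in>real_root_span. \<phi> \<noteq> (\<lambda>_. 0) \<longrightarrow> (\<phi> \<in> P) \<noteq> ((\<lambda>x. - \<phi> x) \<in> P)) \<and>
          (\<lambda>_. 0) \<notin> P \<and>
          (\<forall>\<phi>\<in>P. \<forall>\<psi>\<in>P. (\<lambda>x. \<phi> x + \<psi> x) \<in> P) \<and>
          (\<forall>\<phi>\<in>P. \<forall>r::real. r > 0 \<longrightarrow> (\<lambda>x. complex_of_real r * \<phi> x) \<in> P) \<and>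
          Dp = roots UNIV \<inter> P)"

definition root_sum :: "('g \<Rightarrow> complex) set \<Rightarrow> 'g set" where
  "root_sum A = cvec.span (\<Union>\<alpha>\<in>A. root_space UNIV \<alpha>)"

end

context
  fixes br :: "'g::complex_vec \<Rightarrow> 'g \<Rightarrow> 'g" and h t :: "'g set" and Dp :: "('g \<Rightarrow> complex) set"
begin

definition q_space :: "'g set" where
  "q_space = {x. \<forall>y\<in>h. killing br x y = 0}"

definition roots_q :: "('g \<Rightarrow> complex) set" where
  "roots_q = {\<alpha> \<in> roots br t UNIV. root_space br t UNIV \<alpha> \<subseteq> q_space}"

definition n_plus :: "'g set" where
  "n_plus = root_sum br t Dp"

definition n_h :: "'g set" where
  "n_h = root_sum br t (Dp \<inter> roots br t h)"

definition n_q_plus :: "'g set" where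
  "n_q_plus = root_sum br t (Dp \<inter> roots_q)"

definition n_q_minus :: "'g set" where
  "n_q_minus = root_sum br t ((\<lambda>\<beta> x. - \<beta> x) ` (Dp \<inter> roots_q))"

end


section \<open>Modules and category O\<close>

definition complex_ring :: "complex ring" where
  "complex_ring = \<lparr>carrier = UNIV, mult = (*), one = 1, zero = 0, add = (+)\<rparr>"

record ('g, 'v) lie_module = "(complex, 'v) module" +
  lact :: "'g \<Rightarrow> 'v \<Rightarrow> 'v"

text \<open>In the next definition \<open>k\<close> is a subalgebra, and only the action of its elements matters.\<close>

definition is_lie_module ::
  "('g::complex_vec \<Rightarrow> 'g \<Rightarrow> 'g) \<Rightarrow> 'g set \<Rightarrow> ('g, 'v) lie_module \<Rightarrow> bool" where
  "is_lie_module br k V \<longleftrightarrow>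
     Module.module complex_ring V \<and>
     (\<forall>x\<in>k. \<forall>v\<in>carrier V. lact V x v \<in> carrier V) \<and>
     (\<forall>x\<in>k. \<forall>v\<in>carrier V. \<forall>w\<in>carrier V.
        lact V x (v \<oplus>\<^bsub>V\<^esub> w) = lact V x v \<oplus>\<^bsub>V\<^esub> lact V x w) \<and>
     (\<forall>x\<in>k. \<forall>c. \<forall>v\<in>carrier V. lact V x (c \<odot>\<^bsub>V\<^esub> v) = c \<odot>\<^bsub>V\<^esub> lact V x v) \<and>
     (\<forall>x\<in>k. \<forall>y\<in>k. \<forall>v\<in>carrier V. lact V (x + y) v = lact V x v \<oplus>\<^bsub>V\<^esub> lact V y v) \<and>
     (\<forall>c. \<forall>x\<in>k. \<forall>v\<in>carrier V. lact V (c *\<^sub>C x) v = c \<odot>\<^bsub>V\<^esub> lact V x v) \<and>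
     (\<forall>x\<in>k. \<forall>y\<in>k. \<forall>v\<in>carrier V.
        lact V (br x y) v = lact V x (lact V y v) \<ominus>\<^bsub>V\<^esub> lact V y (lact V x v))"

text \<open>The \<open>U(k)\<close>-submodule generated by \<open>F\<close>: as \<open>U(k)\<close> is generated by \<open>k\<close>, this is the least
  subspace containing \<open>F\<close> and stable under \<open>k\<close>.  For \<open>k = {}\<close> it is the linear span of \<open>F\<close>.\<close>

inductive_set gen_submodule :: "('g, 'v) lie_module \<Rightarrow> 'g set \<Rightarrow> 'v set \<Rightarrow> 'v set"
  for V :: "('g, 'v) lie_module" and k :: "'g set" and F :: "'v set"
where
  zero: "\<zero>\<^bsub>V\<^esub> \<in> gen_submodule V k F"
| base: "v \<in> F \<Longrightarrow> v \<in> gen_submodule V k F"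
| add: "v \<in> gen_submodule V k F \<Longrightarrow> w \<in> gen_submodule V k F \<Longrightarrow>
        v \<oplus>\<^bsub>V\<^esub> w \<in> gen_submodule V k F"
| smult: "v \<in> gen_submodule V k F \<Longrightarrow> c \<odot>\<^bsub>V\<^esub> v \<in> gen_submodule V k F"
| act: "x \<in> k \<Longrightarrow> v \<in> gen_submodule V k F \<Longrightarrow> lact V x v \<in> gen_submodule V k F"

definition finitely_generated :: "'g set \<Rightarrow> ('g, 'v) lie_module \<Rightarrow> bool" where
  "finitely_generated k V \<longleftrightarrow>
     (\<exists>F. finite F \<and> F \<subseteq> carrier V \<and> gen_submodule V k F = carrier V)"

definition weight_space ::
  "'g set \<Rightarrow> ('g, 'v) lie_module \<Rightarrow> ('g \<Rightarrow> complex) \<Rightarrow> 'v set" where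
  "weight_space t V \<mu> = {v \<in> carrier V. \<forall>x\<in>t. lact V x v = \<mu> x \<odot>\<^bsub>V\<^esub> v}"

definition weight_module :: "'g::complex_vec set \<Rightarrow> ('g, 'v) lie_module \<Rightarrow> bool" where
  "weight_module t V \<longleftrightarrow>
     gen_submodule V {} (\<Union>\<mu>\<in>dual_space t. weight_space t V \<mu>) = carrier V"

definition locally_finite :: "'g set \<Rightarrow> ('g, 'v) lie_module \<Rightarrow> bool" where
  "locally_finite n V \<longleftrightarrow>
     (\<forall>v\<in>carrier V. \<exists>F. finite F \<and> F \<subseteq> carrier V \<and>
        gen_submodule V n {v} \<subseteq> gen_submodule V {} F)"

definition category_O ::
  "('g::complex_vec \<Rightarrow> 'g \<Rightarrow> 'g) \<Rightarrow> 'g set \<Rightarrow> 'g set \<Rightarrow> 'g set \<Rightarrow> ('g, 'v) lie_module \<Rightarrow> bool" where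
  "category_O br k t n V \<longleftrightarrow>
     is_lie_module br k V \<and> finitely_generated k V \<and> weight_module t V \<and> locally_finite n V"

text \<open>The multiplicative fields of the module record are meaningless.\<close>

definition type_module :: "('g \<Rightarrow> 'v \<Rightarrow> 'v) \<Rightarrow> ('g, 'v::complex_vec) lie_module" where
  "type_module \<rho> =
     \<lparr>carrier = UNIV, mult = undefined, one = undefined, zero = 0, add = (+),
      smult = scaleC, lact = \<rho>\<rparr>"

text \<open>The quotient \<open>U/W\<close> of stable subspaces \<open>W \<subseteq> U\<close>, with cosets as elements.  Adding \<open>W\<close> in
  the scalar multiplication and in the action turns the image of a coset into a full coset.\<close>

definition quotient_module ::
  "('g \<Rightarrow> 'v \<Rightarrow> 'v) \<Rightarrow> 'v set \<Rightarrow> 'v set \<Rightarrow> ('g, 'v::complex_vec set) lie_module" where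
  "quotient_module \<rho> U W =
     \<lparr>carrier = {{u + w | w. w \<in> W} | u. u \<in> U}, mult = undefined, one = undefined,
      zero = W,
      add = (\<lambda>A B. {a + b | a b. a \<in> A \<and> b \<in> B}),
      smult = (\<lambda>c A. {c *\<^sub>C a + w | a w. a \<in> A \<and> w \<in> W}),
      lact = (\<lambda>x A. {\<rho> x a + w | a w. a \<in> A \<and> w \<in> W})\<rparr>"


section \<open>Quotients of free vector spaces\<close>

text \<open>The free vector space on \<open>'a\<close> is \<open>'a \<Rightarrow>\<^sub>0 complex\<close>.\<close>

definition fscale :: "complex \<Rightarrow> ('a \<Rightarrow>\<^sub>0 complex) \<Rightarrow> ('a \<Rightarrow>\<^sub>0 complex)" where
  "fscale c = Poly_Mapping.map ((*) c)"

lemma lookup_fscale [simp]: "Poly_Mapping.lookup (fscale c p) x = c * Poly_Mapping.lookup p x"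
  by (cases "Poly_Mapping.lookup p x = 0") (simp_all add: fscale_def Poly_Mapping.map.rep_eq)

global_interpretation fvec: vector_space "fscale :: complex \<Rightarrow> ('a \<Rightarrow>\<^sub>0 complex) \<Rightarrow> _"
  by unfold_locales (rule poly_mapping_eqI; simp add: lookup_add algebra_simps)+

abbreviation gen :: "'a \<Rightarrow> 'a \<Rightarrow>\<^sub>0 complex" where
  "gen x \<equiv> Poly_Mapping.single x 1"

lemma span_equivp: "equivp (\<lambda>p q. p - q \<in> fvec.span R)"
proof (rule equivpI)
  show "reflp (\<lambda>p q. p - q \<in> fvec.span R)"
    by (simp add: reflp_def fvec.span_zero)
  show "symp (\<lambda>p q. p - q \<in> fvec.span R)"
    by (metis (mono_tags, lifting) fvec.span_neg minus_diff_eq sympI)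
  show "transp (\<lambda>p q. p - q \<in> fvec.span R)"
  proof (rule transpI)
    fix x y z assume "x - y \<in> fvec.span R" "y - z \<in> fvec.span R"
    from fvec.span_add[OF this] show "x - z \<in> fvec.span R" by simp
  qed
qed

text \<open>The value at \<open>p\<close> of the linear extension of \<open>f\<close> to the free vector space.\<close>

definition free_ext :: "('a \<Rightarrow> 'b::complex_vec) \<Rightarrow> ('a \<Rightarrow>\<^sub>0 complex) \<Rightarrow> 'b" where
  "free_ext f p = (\<Sum>x\<in>Poly_Mapping.keys p. Poly_Mapping.lookup p x *\<^sub>C f x)"

lemma free_ext_superset:
  assumes "finite A" "Poly_Mapping.keys p \<subseteq> A"
  shows "free_ext f p = (\<Sum>x\<in>A. Poly_Mapping.lookup p x *\<^sub>C f x)"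
  unfolding free_ext_def
  by (rule sum.mono_neutral_left) (use assms in \<open>auto simp: in_keys_iff\<close>)

lemma free_ext_linear: "Vector_Spaces.linear fscale scaleC (free_ext f)"
proof -
  have "free_ext f (p + q) = free_ext f p + free_ext f q" for p q
  proof -
    have "free_ext f r = (\<Sum>x\<in>Poly_Mapping.keys p \<union> Poly_Mapping.keys q. Poly_Mapping.lookup r x *\<^sub>C f x)"
      if "r \<in> {p, q, p + q}" for r
      by (rule free_ext_superset) (use that keys_add[of p q] in auto)
    then show ?thesis
      by (simp add: lookup_add scaleC_add_left sum.distrib)
  qed
  moreover have "free_ext f (fscale c p) = c *\<^sub>C free_ext f p" for c p
  proof -
    have "free_ext f (fscale c p) = (\<Sum>x\<in>Poly_Mapping.keys p. Poly_Mapping.lookup (fscale c p) x *\<^sub>C f x)"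
      by (rule free_ext_superset) (auto simp: in_keys_iff)
    then show ?thesis
      by (simp add: free_ext_def cvec.scale_sum_right scaleC_scaleC)
  qed
  ultimately show ?thesis
    by unfold_locales (auto simp: scaleC_add_right scaleC_add_left scaleC_scaleC scaleC_one)
qed

lemma free_ext_gen [simp]: "free_ext f (gen x) = f x"
  by (simp add: free_ext_def scaleC_one)

lemma free_ext_vanishes:
  assumes "\<And>r. r \<in> R \<Longrightarrow> free_ext f r = 0" and "p \<in> fvec.span R"
  shows "free_ext f p = 0"
proof -
  interpret l: Vector_Spaces.linear fscale scaleC "free_ext f" by (rule free_ext_linear)
  show ?thesis using assms(2)
    by (induction rule: fvec.span_induct_alt) (simp_all add: assms(1) l.add l.scale)
qed

lemma free_decomp: "p = (\<Sum>x\<in>Poly_Mapping.keys p. fscale (Poly_Mapping.lookup p x) (gen x))"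
proof (rule poly_mapping_eqI)
  fix k
  have "Poly_Mapping.lookup (\<Sum>x\<in>Poly_Mapping.keys p. fscale (Poly_Mapping.lookup p x) (gen x)) k =
    (\<Sum>x\<in>Poly_Mapping.keys p. if x = k then Poly_Mapping.lookup p x else 0)"
    unfolding lookup_sum by (rule sum.cong) (simp_all add: lookup_single)
  then show "Poly_Mapping.lookup p k =
    Poly_Mapping.lookup (\<Sum>x\<in>Poly_Mapping.keys p. fscale (Poly_Mapping.lookup p x) (gen x)) k"
    by (simp add: in_keys_iff)
qed


subsection \<open>Tensor products\<close>

definition tensor_rels :: "('a::complex_vec \<times> 'b::complex_vec \<Rightarrow>\<^sub>0 complex) set" where
  "tensor_rels =
     {gen (a + a', b) - gen (a, b) - gen (a', b) | a a' b. True} \<union>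
     {gen (a, b + b') - gen (a, b) - gen (a, b') | a b b'. True} \<union>
     {gen (c *\<^sub>C a, b) - fscale c (gen (a, b)) | c a b. True} \<union>
     {gen (a, c *\<^sub>C b) - fscale c (gen (a, b)) | c a b. True}"

quotient_type (overloaded) ('a, 'b) tensor = "'a::complex_vec \<times> 'b::complex_vec \<Rightarrow>\<^sub>0 complex" /
  "\<lambda>p q. p - q \<in> fvec.span tensor_rels"
  by (rule span_equivp)

instantiation tensor :: (complex_vec, complex_vec) complex_vec
begin

lift_definition zero_tensor :: "('a, 'b) tensor" is 0 .

lift_definition plus_tensor :: "('a, 'b) tensor \<Rightarrow> ('a, 'b) tensor \<Rightarrow> ('a, 'b) tensor" is "(+)"
  using fvec.span_add by (fastforce simp: algebra_simps)

lift_definition minus_tensor :: "('a, 'b) tensor \<Rightarrow> ('a, 'b) tensor \<Rightarrow> ('a, 'b) tensor" is "(-)"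
  using fvec.span_diff by (fastforce simp: algebra_simps)

lift_definition uminus_tensor :: "('a, 'b) tensor \<Rightarrow> ('a, 'b) tensor" is uminus
  using fvec.span_neg by (fastforce simp: algebra_simps)

lift_definition scaleC_tensor :: "complex \<Rightarrow> ('a, 'b) tensor \<Rightarrow> ('a, 'b) tensor" is fscale
  by (metis fvec.scale_right_diff_distrib fvec.span_scale)

instance
  by standard
     (transfer; simp add: fvec.span_zero fvec.scale_right_distrib fvec.scale_left_distrib
        algebra_simps)+

end

lemma tensor_universal:
  assumes rel: "\<And>r. r \<in> tensor_rels \<Longrightarrow> free_ext f r = 0"
  shows "\<exists>!F. clinear F \<and> (\<forall>x. F (abs_tensor (gen x)) = f x)"
proof (rule ex_ex1I)
  interpret l: Vector_Spaces.linear fscale scaleC "free_ext f" by (rule free_ext_linear)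
  define F where "F u = free_ext f (rep_tensor u)" for u
  have F_abs: "F (abs_tensor p) = free_ext f p" for p
  proof -
    have "rep_tensor (abs_tensor p) - p \<in> fvec.span tensor_rels"
      using Quotient_rep_abs[OF Quotient_tensor] fvec.span_zero by fastforce
    then have "free_ext f (rep_tensor (abs_tensor p) - p) = 0"
      using rel free_ext_vanishes by blast
    then show ?thesis by (simp add: F_def l.diff)
  qed
  have "F (u + v) = F u + F v" for u v
    by (induction u rule: tensor.abs_induct, induction v rule: tensor.abs_induct)
       (simp add: F_abs plus_tensor.abs_eq l.add)
  moreover have "F (c *\<^sub>C u) = c *\<^sub>C F u" for c u
    by (induction u rule: tensor.abs_induct) (simp add: F_abs scaleC_tensor.abs_eq l.scale)
  ultimately show "\<exists>F. clinear F \<and> (\<forall>x. F (abs_tensor (gen x)) = f x)"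
    by (intro exI[of _ F]) (simp add: clinear_iff F_abs)
next
  fix F G
  assume F: "clinear F \<and> (\<forall>x. F (abs_tensor (gen x)) = f x)"
    and G: "clinear G \<and> (\<forall>x. G (abs_tensor (gen x)) = f x)"
  interpret F: Vector_Spaces.linear scaleC scaleC F using F by simp
  interpret G: Vector_Spaces.linear scaleC scaleC G using G by simp
  have abs_sum: "abs_tensor (\<Sum>x\<in>A. fscale (c x) (gen x)) = (\<Sum>x\<in>A. c x *\<^sub>C abs_tensor (gen x))"
    if "finite A" for A c
    using that
    by (induction rule: finite_induct)
       (simp_all add: zero_tensor_def scaleC_tensor.abs_eq plus_tensor.abs_eq[symmetric])
  have "F (abs_tensor p) = G (abs_tensor p)" for p
    by (subst (1 2) free_decomp) (simp add: abs_sum F.sum G.sum F.scale G.scale F G)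
  then show "F = G"
    by (intro HOL.ext, rule tensor.abs_induct)
qed

lift_definition tens :: "'a::complex_vec \<Rightarrow> 'b::complex_vec \<Rightarrow> ('a, 'b) tensor"
  is "\<lambda>a b. gen (a, b)" .

definition tensor_map :: "('a::complex_vec \<Rightarrow> 'a) \<Rightarrow> ('b::complex_vec \<Rightarrow> 'b) \<Rightarrow>
    ('a, 'b) tensor \<Rightarrow> ('a, 'b) tensor" where
  "tensor_map f g = (THE F. clinear F \<and> (\<forall>a b. F (tens a b) = tens (f a) (g b)))"

lemma tens_bilinear:
  "tens (a + a') b = tens a b + tens a' b" "tens a (b + b') = tens a b + tens a b'"
  "tens (c *\<^sub>C a) b = c *\<^sub>C tens a b" "tens a (c *\<^sub>C b) = c *\<^sub>C tens a b"
  by (transfer, rule fvec.span_base, force simp: tensor_rels_def diff_diff_eq)+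

lemma tensor_map:
  assumes "clinear f" and "clinear g"
  shows "clinear (tensor_map f g)" and "tensor_map f g (tens a b) = tens (f a) (g b)"
proof -
  interpret f: Vector_Spaces.linear scaleC scaleC f by fact
  interpret g: Vector_Spaces.linear scaleC scaleC g by fact
  let ?f = "\<lambda>(a, b). tens (f a) (g b)"
  interpret l: Vector_Spaces.linear fscale scaleC "free_ext ?f" by (rule free_ext_linear)
  have "\<exists>!F. clinear F \<and> (\<forall>x. F (abs_tensor (gen x)) = ?f x)"
    by (rule tensor_universal)
       (auto simp: tensor_rels_def l.diff l.scale f.add g.add f.scale g.scale tens_bilinear)
  then have "\<exists>!F. clinear F \<and> (\<forall>a b. F (tens a b) = tens (f a) (g b))"
    by (simp add: tens.abs_eq)
  from theI'[OF this] show "clinear (tensor_map f g)" "tensor_map f g (tens a b) = tens (f a) (g b)"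
    unfolding tensor_map_def by blast+
qed


subsection \<open>Exterior algebras\<close>

text \<open>The word \<open>[v\<^sub>1, \<dots>, v\<^sub>k]\<close> stands for \<open>v\<^sub>1 \<and> \<dots> \<and> v\<^sub>k\<close>.  The first two families of relations
  present the tensor algebra, the third one spans the ideal generated by the squares.\<close>

definition ext_rels :: "('a::complex_vec list \<Rightarrow>\<^sub>0 complex) set" where
  "ext_rels =
     {gen (us @ (v + w) # vs) - gen (us @ v # vs) - gen (us @ w # vs) | us v w vs. True} \<union>
     {gen (us @ (c *\<^sub>C v) # vs) - fscale c (gen (us @ v # vs)) | us c v vs. True} \<union>
     {gen (us @ v # v # vs) | us v vs. True}"

quotient_type (overloaded) 'a ext = "'a::complex_vec list \<Rightarrow>\<^sub>0 complex" /
  "\<lambda>p q. p - q \<in> fvec.span ext_rels"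
  by (rule span_equivp)

instantiation ext :: (complex_vec) complex_vec
begin

lift_definition zero_ext :: "'a ext" is 0 .

lift_definition plus_ext :: "'a ext \<Rightarrow> 'a ext \<Rightarrow> 'a ext" is "(+)"
  using fvec.span_add by (fastforce simp: algebra_simps)

lift_definition minus_ext :: "'a ext \<Rightarrow> 'a ext \<Rightarrow> 'a ext" is "(-)"
  using fvec.span_diff by (fastforce simp: algebra_simps)

lift_definition uminus_ext :: "'a ext \<Rightarrow> 'a ext" is uminus
  using fvec.span_neg by (fastforce simp: algebra_simps)

lift_definition scaleC_ext :: "complex \<Rightarrow> 'a ext \<Rightarrow> 'a ext" is fscale
  by (metis fvec.scale_right_diff_distrib fvec.span_scale)

instance
  by standard
     (transfer; simp add: fvec.span_zero fvec.scale_right_distrib fvec.scale_left_distrib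
        algebra_simps)+

end

lemma ext_universal:
  assumes rel: "\<And>r. r \<in> ext_rels \<Longrightarrow> free_ext f r = 0"
  shows "\<exists>!F. clinear F \<and> (\<forall>x. F (abs_ext (gen x)) = f x)"
proof (rule ex_ex1I)
  interpret l: Vector_Spaces.linear fscale scaleC "free_ext f" by (rule free_ext_linear)
  define F where "F u = free_ext f (rep_ext u)" for u
  have F_abs: "F (abs_ext p) = free_ext f p" for p
  proof -
    have "rep_ext (abs_ext p) - p \<in> fvec.span ext_rels"
      using Quotient_rep_abs[OF Quotient_ext] fvec.span_zero by fastforce
    then have "free_ext f (rep_ext (abs_ext p) - p) = 0"
      using rel free_ext_vanishes by blast
    then show ?thesis by (simp add: F_def l.diff)
  qed
  have "F (u + v) = F u + F v" for u v
    by (induction u rule: ext.abs_induct, induction v rule: ext.abs_induct)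
       (simp add: F_abs plus_ext.abs_eq l.add)
  moreover have "F (c *\<^sub>C u) = c *\<^sub>C F u" for c u
    by (induction u rule: ext.abs_induct) (simp add: F_abs scaleC_ext.abs_eq l.scale)
  ultimately show "\<exists>F. clinear F \<and> (\<forall>x. F (abs_ext (gen x)) = f x)"
    by (intro exI[of _ F]) (simp add: clinear_iff F_abs)
next
  fix F G
  assume F: "clinear F \<and> (\<forall>x. F (abs_ext (gen x)) = f x)"
    and G: "clinear G \<and> (\<forall>x. G (abs_ext (gen x)) = f x)"
  interpret F: Vector_Spaces.linear scaleC scaleC F using F by simp
  interpret G: Vector_Spaces.linear scaleC scaleC G using G by simp
  have abs_sum: "abs_ext (\<Sum>x\<in>A. fscale (c x) (gen x)) = (\<Sum>x\<in>A. c x *\<^sub>C abs_ext (gen x))"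
    if "finite A" for A c
    using that
    by (induction rule: finite_induct)
       (simp_all add: zero_ext_def scaleC_ext.abs_eq plus_ext.abs_eq[symmetric])
  have "F (abs_ext p) = G (abs_ext p)" for p
    by (subst (1 2) free_decomp) (simp add: abs_sum F.sum G.sum F.scale G.scale F G)
  then show "F = G"
    by (intro HOL.ext, rule ext.abs_induct)
qed

lift_definition wedge :: "'a::complex_vec list \<Rightarrow> 'a ext" is gen .

definition ext_mult :: "'a::complex_vec \<Rightarrow> 'a ext \<Rightarrow> 'a ext" where
  "ext_mult x = (THE f. clinear f \<and> (\<forall>vs. f (wedge vs) = wedge (x # vs)))"

definition contract :: "('a::complex_vec \<Rightarrow> complex) \<Rightarrow> 'a ext \<Rightarrow> 'a ext" where
  "contract \<xi> = (THE f. clinear f \<and>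
     (\<forall>vs. f (wedge vs) =
        (\<Sum>i<length vs. ((-1) ^ i * \<xi> (vs ! i)) *\<^sub>C wedge (take i vs @ drop (Suc i) vs))))"

lemma wedge_rels:
  "wedge (us @ (v + w) # vs) = wedge (us @ v # vs) + wedge (us @ w # vs)"
  "wedge (us @ (c *\<^sub>C v) # vs) = c *\<^sub>C wedge (us @ v # vs)"
  "wedge (us @ v # v # vs) = 0"
  by (transfer, rule fvec.span_base, force simp: ext_rels_def diff_diff_eq)+

lemma ext_mult:
  shows "clinear (ext_mult x)" and "ext_mult x (wedge vs) = wedge (x # vs)"
proof -
  let ?f = "\<lambda>vs. wedge (x # vs)"
  interpret l: Vector_Spaces.linear fscale scaleC "free_ext ?f" by (rule free_ext_linear)
  have "\<exists>!F. clinear F \<and> (\<forall>vs. F (abs_ext (gen vs)) = ?f vs)"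
    by (rule ext_universal)
       (auto simp: ext_rels_def l.diff l.scale wedge_rels(1,2)[of "x # _", simplified]
         wedge_rels(3)[of "x # _", simplified])
  then have "\<exists>!F. clinear F \<and> (\<forall>vs. F (wedge vs) = ?f vs)"
    by (simp add: wedge.abs_eq)
  from theI'[OF this] show "clinear (ext_mult x)" "ext_mult x (wedge vs) = wedge (x # vs)"
    unfolding ext_mult_def by blast+
qed

fun contract_word :: "('a::complex_vec \<Rightarrow> complex) \<Rightarrow> 'a list \<Rightarrow> 'a ext" where
  "contract_word \<xi> [] = 0"
| "contract_word \<xi> (v # vs) = \<xi> v *\<^sub>C wedge vs - ext_mult v (contract_word \<xi> vs)"

lemma contract_word_eq:
  "contract_word \<xi> vs =
     (\<Sum>i<length vs. ((-1) ^ i * \<xi> (vs ! i)) *\<^sub>C wedge (take i vs @ drop (Suc i) vs))"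
proof (induction vs)
  case (Cons v vs)
  interpret m: Vector_Spaces.linear scaleC scaleC "ext_mult v" by (rule ext_mult)
  show ?case
    by (simp add: Cons.IH sum.lessThan_Suc_shift m.sum m.scale ext_mult(2) sum_negf[symmetric]
        del: sum.lessThan_Suc)
qed simp

lemma ext_mult_linear_left:
  "ext_mult (v + w) u = ext_mult v u + ext_mult w u" "ext_mult (c *\<^sub>C v) u = c *\<^sub>C ext_mult v u"
  "ext_mult v (ext_mult v u) = 0"
proof -
  have eq: "F u = G u" if "clinear F" "clinear G" "\<And>vs. F (wedge vs) = G (wedge vs)" for F G
  proof -
    interpret F: Vector_Spaces.linear scaleC scaleC F by fact
    let ?f = "\<lambda>vs. F (wedge vs)"
    interpret l: Vector_Spaces.linear fscale scaleC "free_ext ?f" by (rule free_ext_linear)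
    have "\<exists>!F. clinear F \<and> (\<forall>x. F (abs_ext (gen x)) = ?f x)"
      by (rule ext_universal) (auto simp: ext_rels_def l.diff l.scale wedge_rels F.add F.scale F.zero)
    then show ?thesis using that by (metis wedge.abs_eq)
  qed
  interpret v: Vector_Spaces.linear scaleC scaleC "ext_mult v" by (rule ext_mult)
  interpret w: Vector_Spaces.linear scaleC scaleC "ext_mult w" by (rule ext_mult)
  show "ext_mult (v + w) u = ext_mult v u + ext_mult w u"
    by (rule eq[of "ext_mult (v + w)" "\<lambda>u. ext_mult v u + ext_mult w u"] )
       (simp_all add: ext_mult wedge_rels(1)[of "[]", simplified],
        simp add: clinear_iff v.add w.add v.scale w.scale scaleC_add_right)
  show "ext_mult (c *\<^sub>C v) u = c *\<^sub>C ext_mult v u"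
    by (rule eq[of "ext_mult (c *\<^sub>C v)" "\<lambda>u. c *\<^sub>C ext_mult v u"])
       (simp_all add: ext_mult wedge_rels(2)[of "[]", simplified],
        simp add: clinear_iff v.add v.scale scaleC_add_right scaleC_scaleC mult.commute)
  show "ext_mult v (ext_mult v u) = 0"
    by (rule eq[of "\<lambda>u. ext_mult v (ext_mult v u)" "\<lambda>u. 0"])
       (simp_all add: clinear_iff v.add v.scale ext_mult(2) wedge_rels(3)[of "[]", simplified])
qed

lemma contract:
  assumes add: "\<And>x y. \<xi> (x + y) = \<xi> x + \<xi> y" and scale: "\<And>c x. \<xi> (c *\<^sub>C x) = c * \<xi> x"
  shows "clinear (contract \<xi>)" and "contract \<xi> (wedge vs) =
    (\<Sum>i<length vs. ((-1) ^ i * \<xi> (vs ! i)) *\<^sub>C wedge (take i vs @ drop (Suc i) vs))"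
proof -
  let ?f = "contract_word \<xi>"
  interpret l: Vector_Spaces.linear fscale scaleC "free_ext ?f" by (rule free_ext_linear)
  have m: "ext_mult x (a + b) = ext_mult x a + ext_mult x b"
    "ext_mult x (c *\<^sub>C a) = c *\<^sub>C ext_mult x a" "ext_mult x (a - b) = ext_mult x a - ext_mult x b"
    "ext_mult x 0 = 0" for x :: 'a and a b c
  proof -
    interpret x: Vector_Spaces.linear scaleC scaleC "ext_mult x" by (rule ext_mult)
    show "ext_mult x (a + b) = ext_mult x a + ext_mult x b"
      "ext_mult x (c *\<^sub>C a) = c *\<^sub>C ext_mult x a" "ext_mult x (a - b) = ext_mult x a - ext_mult x b"
      "ext_mult x 0 = 0"
      by (simp_all add: x.add x.scale x.diff x.zero)
  qed
  have 1: "?f (us @ (v + w) # vs) = ?f (us @ v # vs) + ?f (us @ w # vs)" for us v w vs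
    by (induction us) (simp_all add: m add scaleC_add_left scaleC_add_right wedge_rels
        ext_mult_linear_left cvec.scale_right_diff_distrib algebra_simps)
  have 2: "?f (us @ (c *\<^sub>C v) # vs) = c *\<^sub>C ?f (us @ v # vs)" for us c v vs
    by (induction us) (simp_all add: m scale scaleC_scaleC wedge_rels ext_mult_linear_left
        cvec.scale_right_diff_distrib mult.commute)
  have 3: "?f (us @ v # v # vs) = 0" for us v vs
    by (induction us) (simp_all add: m wedge_rels ext_mult_linear_left ext_mult(2))
  have "\<exists>!F. clinear F \<and> (\<forall>vs. F (abs_ext (gen vs)) = ?f vs)"
    by (rule ext_universal) (auto simp: ext_rels_def l.diff l.scale 1 2 3)
  then have "\<exists>!F. clinear F \<and> (\<forall>vs. F (wedge vs) =
      (\<Sum>i<length vs. ((-1) ^ i * \<xi> (vs ! i)) *\<^sub>C wedge (take i vs @ drop (Suc i) vs)))"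
    by (simp add: wedge.abs_eq contract_word_eq)
  from theI'[OF this] show "clinear (contract \<xi>)" and "contract \<xi> (wedge vs) =
      (\<Sum>i<length vs. ((-1) ^ i * \<xi> (vs ! i)) *\<^sub>C wedge (take i vs @ drop (Suc i) vs))"
    unfolding contract_def by blast+
qed


section \<open>Dirac cohomology\<close>

context
  fixes br :: "'g::complex_vec \<Rightarrow> 'g \<Rightarrow> 'g" and h t :: "'g set" and Dp :: "('g \<Rightarrow> complex) set"
begin

text \<open>The exterior algebra of \<open>n_q_minus\<close>, as a subspace of the one of the whole Lie algebra.\<close>

definition spin_module :: "'g ext set" where
  "spin_module = cvec.span {wedge vs | vs. set vs \<subseteq> n_q_minus br h t Dp}"

definition q_plus_part :: "'g \<Rightarrow> 'g" where
  "q_plus_part a = (THE p. p \<in> n_q_plus br h t Dp \<and> a - p \<in> n_q_minus br h t Dp)"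

definition gamma :: "'g \<Rightarrow> 'g ext \<Rightarrow> 'g ext" where
  "gamma a s = ext_mult (a - q_plus_part a) s + contract (killing br (q_plus_part a)) s"

definition rot :: "'g \<Rightarrow> 'g \<Rightarrow> 'g \<Rightarrow> 'g" where
  "rot a b v = killing br b v *\<^sub>C a - killing br a v *\<^sub>C b"

text \<open>The composite of the map \<open>\<phi>\<close> on \<open>so(q)\<close>, which is the linear extension of
  \<open>rot a b \<mapsto> \<onehalf> [gamma a, gamma b]\<close>, with the Clifford action.  Coefficients of
  linear combinations are absorbed into the first components of the pairs.\<close>

definition spin_lift :: "('g \<Rightarrow> 'g) \<Rightarrow> 'g ext \<Rightarrow> 'g ext" where
  "spin_lift A = (THE F. \<exists>ps. set ps \<subseteq> q_space br h \<times> q_space br h \<and>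
     (\<forall>v\<in>q_space br h. A v = (\<Sum>(a, b)\<leftarrow>ps. rot a b v)) \<and>
     F = (\<lambda>s. \<Sum>(a, b)\<leftarrow>ps. (1/2) *\<^sub>C (gamma a (gamma b s) - gamma b (gamma a s))))"

definition spin_act :: "'g \<Rightarrow> 'g ext \<Rightarrow> 'g ext" where
  "spin_act x = spin_lift (br x)"

definition orthonormal_basis_q :: "'g set \<Rightarrow> bool" where
  "orthonormal_basis_q Z \<longleftrightarrow>
     finite Z \<and> cvec.independent Z \<and> cvec.span Z = q_space br h \<and>
     (\<forall>x\<in>Z. \<forall>y\<in>Z. killing br x y = (if x = y then 1 else 0))"

definition gamma_c :: "'g set \<Rightarrow> 'g ext \<Rightarrow> 'g ext" where
  "gamma_c Z s = (1/6) *\<^sub>C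
     (\<Sum>x\<in>Z. \<Sum>y\<in>Z. \<Sum>z\<in>Z. killing br x (br y z) *\<^sub>C gamma x (gamma y (gamma z s)))"

context
  fixes \<rho> :: "'g \<Rightarrow> 'm::complex_vec \<Rightarrow> 'm"
begin

definition M_tensor_S :: "('m, 'g ext) tensor set" where
  "M_tensor_S = cvec.span {tens m s | m s. s \<in> spin_module}"

definition diag_act :: "'g \<Rightarrow> ('m, 'g ext) tensor \<Rightarrow> ('m, 'g ext) tensor" where
  "diag_act x u = tensor_map (\<rho> x) id u + tensor_map id (spin_act x) u"

definition dirac :: "'g set \<Rightarrow> ('m, 'g ext) tensor \<Rightarrow> ('m, 'g ext) tensor" where
  "dirac Z u = (\<Sum>z\<in>Z. tensor_map (\<rho> z) (gamma z) u) - tensor_map id (gamma_c Z) u"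

definition dirac_ker :: "'g set \<Rightarrow> ('m, 'g ext) tensor set" where
  "dirac_ker Z = {u \<in> M_tensor_S. dirac Z u = 0}"

definition dirac_im :: "'g set \<Rightarrow> ('m, 'g ext) tensor set" where
  "dirac_im Z = dirac Z ` M_tensor_S"

definition dirac_cohomology :: "'g set \<Rightarrow> ('g, ('m, 'g ext) tensor set) lie_module" where
  "dirac_cohomology Z = quotient_module diag_act (dirac_ker Z) (dirac_im Z \<inter> dirac_ker Z)"

end

end

end

theory Submission
  imports Defs "HOL-Computational_Algebra.Fundamental_Theorem_Algebra"
begin

text \<open>A suitable multiple of the square of the Dirac operator \<open>D\<close> is
  \<open>\<Omega>\<^sub>g \<otimes> 1 - \<Omega>\<^sub>h + 1 \<otimes> T\<close>, where \<open>\<Omega>\<^sub>g\<close> and \<open>\<Omega>\<^sub>h\<close> are the Casimir elements, the second one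
  acting diagonally, and \<open>T\<close> is an operator on the spin module \<open>S\<close>.  Hence \<open>\<Omega>\<^sub>h\<close> agrees on \<open>ker D\<close>
  with \<open>R = \<Omega>\<^sub>g \<otimes> 1 + 1 \<otimes> T\<close>.  This operator commutes with \<open>U(g) \<otimes> 1\<close> and preserves a
  finite-dimensional subspace that generates \<open>M \<otimes> S\<close> over \<open>U(g) \<otimes> 1\<close>, so it is a root of a
  polynomial with roots \<open>c\<^sub>1, \<dots>, c\<^sub>n\<close>; the scalar by which \<open>T\<close> acts need not be known.
  If a vector of weight \<open>\<mu>\<close> in \<open>ker D\<close> is sent by \<open>n\<^sub>h\<close> into a submodule \<open>N\<close>, then modulo \<open>N\<close> it is
  an eigenvector of \<open>\<Omega>\<^sub>h\<close> with eigenvalue \<open>(\<mu>, \<mu>) + 2 (\<rho>\<^sub>h, \<mu>)\<close>, so that this number is one of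
  the \<open>c\<^sub>i\<close> or the vector lies in \<open>N\<close>.  The weights of \<open>M \<otimes> S\<close> lie in finitely many cones
  \<open>\<lambda> - Q\<^sup>+\<close> and the form is positive definite on the real span of the roots, so only finitely many
  weights \<open>\<mu>\<close> satisfy the condition.  Their weight spaces are finite-dimensional and generate
  \<open>ker D\<close>, as one sees by descending induction on the weight.\<close>

section \<open>Linear algebra\<close>

text \<open>The equation \<open>D u = 0\<close> itself must therefore confine the weights of the
  generators, and the formula for the square of \<open>D\<close> turns it into a quadratic equation
  for these weights. The multiple in that formula is 2, because with the relation
  \<open>X Y + Y X = \<langle>X, Y\<rangle>\<close> a unit vector has Clifford square 1/2. The
  linear term \<open>2 (\<rho>\<^sub>h, \<mu>)\<close> comes from moving positive root vectors to
  the right: the commutators of dual root vectors of \<open>h\<close> add up to the element of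
  \<open>t\<close> that represents \<open>2 \<rho>\<^sub>h\<close>. On a module in category O the
  Casimir element need not be diagonalizable, so the argument uses products of factors
  \<open>R - c\<^sub>i\<close> instead of eigenvectors of \<open>R\<close>. Generators of
  \<open>ker D\<close> also generate its quotient, and of the subspace divided out only stability
  under \<open>h\<close> is required.\<close>

lemma clinearI:
  assumes "\<And>x y. f (x + y) = f x + f y" "\<And>c x. f (c *\<^sub>C x) = c *\<^sub>C f x"
  shows "clinear f"
  using assms by (simp add: clinear_iff)

lemma clinear_simps:
  assumes "clinear f"
  shows "f (x + y) = f x + f y" "f (c *\<^sub>C x) = c *\<^sub>C f x" "f 0 = 0" "f (- x) = - f x"
    "f (x - y) = f x - f y" "f (\<Sum>i\<in>A. g i) = (\<Sum>i\<in>A. f (g i))"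
proof -
  interpret Vector_Spaces.linear scaleC scaleC f by fact
  show "f (x + y) = f x + f y" "f (c *\<^sub>C x) = c *\<^sub>C f x" "f 0 = 0" "f (- x) = - f x"
    "f (x - y) = f x - f y" "f (\<Sum>i\<in>A. g i) = (\<Sum>i\<in>A. f (g i))"
    by (simp_all add: add scale zero neg diff sum)
qed

lemma clinear_span_subset:
  assumes "clinear f" "cvec.subspace V" "\<And>x. x \<in> S \<Longrightarrow> f x \<in> V" "x \<in> cvec.span S"
  shows "f x \<in> V"
  using assms(4)
  by (induction rule: cvec.span_induct_alt)
     (auto simp: clinear_simps[OF assms(1)] cvec.subspace_0[OF assms(2)]
       intro!: cvec.subspace_add[OF assms(2)] cvec.subspace_scale[OF assms(2)] assms(3))

lemma clinear_eq_on_span: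
  assumes "clinear f" "clinear g" "\<And>x. x \<in> S \<Longrightarrow> f x = g x" "x \<in> cvec.span S"
  shows "f x = g x"
  using assms(4)
  by (induction rule: cvec.span_induct_alt)
     (simp_all add: clinear_simps[OF assms(1)] clinear_simps[OF assms(2)] assms(3))

text \<open>A dimension count: if the image missed \<open>y\<close>, then \<open>y\<close> together
  with the image of \<open>B\<close> would be \<open>card B + 1\<close> independent vectors in the
  span of \<open>B\<close>.\<close>

lemma clinear_bij_span:
  assumes "clinear f" "finite B" "cvec.independent B" "\<And>x. x \<in> B \<Longrightarrow> f x \<in> cvec.span B"
    and inj: "\<And>x. x \<in> cvec.span B \<Longrightarrow> f x = 0 \<Longrightarrow> x = 0" and "y \<in> cvec.span B"
  shows "\<exists>x \<in> cvec.span B. f x = y"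
proof -
  interpret f: Vector_Spaces.linear scaleC scaleC f by fact
  have inj': "inj_on f (cvec.span B)"
  proof (rule inj_onI)
    fix x y assume *: "x \<in> cvec.span B" "y \<in> cvec.span B" "f x = f y"
    have "x - y = 0"
      by (rule inj) (use * in \<open>auto simp: cvec.span_diff f.diff\<close>)
    then show "x = y" by simp
  qed
  have ind: "cvec.independent (f ` B)"
    by (rule f.independent_injective_image[OF assms(3) inj'])
  have card: "card (f ` B) = card B"
    by (rule card_image[OF inj_on_subset[OF inj' cvec.span_superset]])
  have "y \<in> cvec.span (f ` B)"
  proof (rule ccontr)
    assume y: "y \<notin> cvec.span (f ` B)"
    then have "y \<notin> f ` B" using cvec.span_base by metis
    then have "card (insert y (f ` B)) = Suc (card B)" using assms(2) card by simp
    moreover have "cvec.independent (insert y (f ` B))"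
      using ind y by (simp add: cvec.independent_insert)
    moreover have "insert y (f ` B) \<subseteq> cvec.span B" using assms(4,6) by auto
    ultimately show False
      using cvec.independent_span_bound[OF assms(2)] by (metis Suc_n_not_le_n)
  qed
  also have "cvec.span (f ` B) = f ` cvec.span B" by (rule f.span_image)
  finally show ?thesis by blast
qed

text \<open>The point is that the basis consists of elements of \<open>X\<close> itself: later
  \<open>X\<close> is a set of weight vectors or a weight space of \<open>ker D\<close>, and these
  properties have to survive.\<close>

lemma finite_basis_subset:
  assumes "finite T" "X \<subseteq> cvec.span T"
  obtains B where "finite B" "B \<subseteq> X" "cvec.independent B" "cvec.span B = cvec.span X"
proof -
  obtain B where B: "B \<subseteq> X" "cvec.independent B" "X \<subseteq> cvec.span B"
    using cvec.maximal_independent_subset by blast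
  have "finite B" using cvec.independent_span_bound[OF assms(1) B(2)] B(1) assms(2) by blast
  moreover have "cvec.span B = cvec.span X"
    using B by (metis cvec.span_eq cvec.span_superset order_trans)
  ultimately show ?thesis using that B by blast
qed

text \<open>Both sides expand to the same double sum of matrix coefficients. The set
  \<open>B\<close> need not span the whole space, so that traces on sums of weight spaces are
  covered.\<close>

lemma trace_commute:
  assumes "finite B" "cvec.independent B" "clinear e" "clinear f"
    "\<And>b. b \<in> B \<Longrightarrow> e b \<in> cvec.span B" "\<And>b. b \<in> B \<Longrightarrow> f b \<in> cvec.span B"
  shows "(\<Sum>b\<in>B. cvec.representation B (e (f b)) b) = (\<Sum>b\<in>B. cvec.representation B (f (e b)) b)"
proof -
  let ?r = "cvec.representation B"
  have exp: "?r (e (f b)) b = (\<Sum>c\<in>B. ?r (f b) c * ?r (e c) b)"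
    if "clinear e" "\<And>b. b \<in> B \<Longrightarrow> e b \<in> cvec.span B" "\<And>b. b \<in> B \<Longrightarrow> f b \<in> cvec.span B" "b \<in> B" for e f b
  proof -
    have "f b = (\<Sum>c\<in>B. ?r (f b) c *\<^sub>C c)"
      using cvec.sum_representation_eq[OF assms(2) that(3)[OF that(4)] assms(1)] by simp
    then have "e (f b) = (\<Sum>c\<in>B. ?r (f b) c *\<^sub>C e c)"
      by (metis (no_types, lifting) clinear_simps(2,6)[OF that(1)] sum.cong)
    moreover have "?r (\<Sum>c\<in>B. ?r (f b) c *\<^sub>C e c) = (\<lambda>d. \<Sum>c\<in>B. ?r (?r (f b) c *\<^sub>C e c) d)"
      by (rule cvec.representation_sum[OF assms(2)]) (auto intro: cvec.span_scale that)
    ultimately show ?thesis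
      by (simp add: cvec.representation_scale[OF assms(2)] that)
  qed
  have "(\<Sum>b\<in>B. ?r (e (f b)) b) = (\<Sum>b\<in>B. \<Sum>c\<in>B. ?r (f b) c * ?r (e c) b)"
    by (rule sum.cong[OF refl]) (rule exp[OF assms(3,5,6)])
  also have "\<dots> = (\<Sum>c\<in>B. \<Sum>b\<in>B. ?r (e c) b * ?r (f b) c)"
    by (subst sum.swap) (simp add: mult.commute)
  also have "\<dots> = (\<Sum>c\<in>B. ?r (f (e c)) c)"
    by (rule sum.cong[OF refl], rule exp[OF assms(4,6,5), symmetric])
  finally show ?thesis .
qed

text \<open>The sum is the trace of the commutator of \<open>e\<close> and \<open>f\<close>, which
  acts diagonally on \<open>B\<close>. In the study of roots this takes the place of the
  representation theory of sl2.\<close>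

lemma trace_commutator_zero:
  assumes "finite B" "cvec.independent B" "clinear e" "clinear f"
    "\<And>b. b \<in> B \<Longrightarrow> e b \<in> cvec.span B" "\<And>b. b \<in> B \<Longrightarrow> f b \<in> cvec.span B"
    "\<And>b. b \<in> B \<Longrightarrow> e (f b) - f (e b) = w b *\<^sub>C b"
  shows "(\<Sum>b\<in>B. w b) = 0"
proof -
  let ?r = "cvec.representation B"
  have sp: "e x \<in> cvec.span B" "f x \<in> cvec.span B" if "x \<in> cvec.span B" for x
    using that clinear_span_subset[OF assms(3) cvec.subspace_span] clinear_span_subset[OF assms(4) cvec.subspace_span]
    assms(5,6) by blast+
  have "?r (e (f b)) b - ?r (f (e b)) b = w b" if "b \<in> B" for b
  proof -
    have "?r (e (f b)) b - ?r (f (e b)) b = ?r (e (f b) - f (e b)) b"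
      by (simp add: cvec.representation_diff[OF assms(2)] sp cvec.span_base that)
    also have "\<dots> = w b"
      by (simp add: assms(7) that cvec.representation_scale[OF assms(2)] cvec.span_base
          cvec.representation_basis[OF assms(2)])
    finally show ?thesis .
  qed
  then have "(\<Sum>b\<in>B. w b) = (\<Sum>b\<in>B. ?r (e (f b)) b - ?r (f (e b)) b)" by simp
  also have "\<dots> = 0" using trace_commute[OF assms(1-6)] by (simp add: sum_subtractf)
  finally show ?thesis .
qed

text \<open>The product of the operators \<open>T - c\<close>, that is, a monic polynomial in
  \<open>T\<close> given by the list of its roots. In this form concatenation is multiplication, and
  the scalar by which the product acts on an eigenvector can be read off.\<close>

definition kill_roots :: "('v::complex_vec \<Rightarrow> 'v) \<Rightarrow> complex list \<Rightarrow> 'v \<Rightarrow> 'v" where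
  "kill_roots T cs = fold (\<lambda>c v. T v - c *\<^sub>C v) cs"

lemma kill_roots_simps [simp]:
  "kill_roots T [] v = v" "kill_roots T (c # cs) v = kill_roots T cs (T v - c *\<^sub>C v)"
  by (simp_all add: kill_roots_def)

lemma kill_roots_append: "kill_roots T (cs @ ds) v = kill_roots T ds (kill_roots T cs v)"
  by (simp add: kill_roots_def)

lemma kill_roots_clinear:
  assumes "clinear T" shows "clinear (kill_roots T cs)"
proof (rule clinearI)
  show "kill_roots T cs (x + y) = kill_roots T cs x + kill_roots T cs y" for x y
  proof (induction cs arbitrary: x y)
    case (Cons c cs)
    have "T (x + y) - c *\<^sub>C (x + y) = (T x - c *\<^sub>C x) + (T y - c *\<^sub>C y)"
      by (simp add: clinear_simps[OF assms] scaleC_add_right)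
    then show ?case using Cons by simp
  qed simp
  show "kill_roots T cs (d *\<^sub>C x) = d *\<^sub>C kill_roots T cs x" for d x
  proof (induction cs arbitrary: x)
    case (Cons c cs)
    have "T (d *\<^sub>C x) - c *\<^sub>C d *\<^sub>C x = d *\<^sub>C (T x - c *\<^sub>C x)"
      by (simp add: clinear_simps[OF assms] cvec.scale_right_diff_distrib scaleC_scaleC mult.commute)
    then show ?case using Cons by simp
  qed simp
qed

lemma kill_roots_intertwine:
  assumes "\<And>v. T (A v) = A (T v)" "clinear A"
  shows "kill_roots T cs (A v) = A (kill_roots T cs v)"
  by (induction cs arbitrary: v)
     (simp_all add: assms(1) clinear_simps[OF assms(2), symmetric])

lemma kill_roots_commute:
  assumes "clinear T"
  shows "kill_roots T cs (kill_roots T ds v) = kill_roots T ds (kill_roots T cs v)"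
proof (rule kill_roots_intertwine[OF _ kill_roots_clinear[OF assms]])
  show "T (kill_roots T ds v) = kill_roots T ds (T v)" for v
    by (rule kill_roots_intertwine[symmetric]) (simp_all add: assms)
qed

text \<open>Over the complex numbers \<open>p\<close> has a root \<open>c\<close>. The cofactor of
  \<open>X - c\<close> annihilates \<open>T v - c *\<^sub>C v\<close>, so induction on the degree
  applies to that vector.\<close>

lemma poly_annihilator_imp_kill_roots:
  assumes "clinear T" "p \<noteq> 0" "(\<Sum>i\<le>degree p. coeff p i *\<^sub>C (T ^^ i) v) = 0"
  shows "\<exists>cs. kill_roots T cs v = 0"
  using assms(2,3)
proof (induction "degree p" arbitrary: p v)
  case 0
  then have "coeff p 0 *\<^sub>C v = 0" "coeff p 0 \<noteq> 0"
    by (auto simp: leading_coeff_0_iff[symmetric] simp del: leading_coeff_0_iff)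
  then have "v = 0" by simp
  then show ?case by (intro exI[of _ "[]"]) simp
next
  case (Suc n)
  then have "\<not> constant (poly p)" by (simp add: constant_degree)
  then obtain c where "poly p c = 0" using fundamental_theorem_of_algebra by blast
  then obtain q where q: "p = [:-c, 1:] * q" by (metis dvdE poly_eq_0_iff_dvd)
  then have q0: "q \<noteq> 0" using Suc.prems by auto
  have deg: "degree p = Suc (degree q)" unfolding q by (subst degree_mult_eq) (use q0 in auto)
  define w where "w = T v - c *\<^sub>C v"
  have tw: "(T ^^ i) w = (T ^^ Suc i) v - c *\<^sub>C (T ^^ i) v" for i
  proof (induction i)
    case (Suc i)
    then show ?case by (simp add: clinear_simps[OF assms(1)])
  qed (simp add: w_def)
  have "(\<Sum>i\<le>degree q. coeff q i *\<^sub>C (T ^^ i) w) =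
    (\<Sum>i\<le>degree q. coeff q i *\<^sub>C (T ^^ Suc i) v) - (\<Sum>i\<le>degree q. (c * coeff q i) *\<^sub>C (T ^^ i) v)"
    by (simp only: tw cvec.scale_right_diff_distrib sum_subtractf scaleC_scaleC mult.commute)
  also have "(\<Sum>i\<le>degree q. (c * coeff q i) *\<^sub>C (T ^^ i) v) = (\<Sum>i\<le>degree p. (c * coeff q i) *\<^sub>C (T ^^ i) v)"
    by (simp add: deg coeff_eq_0)
  also have "(\<Sum>i\<le>degree q. coeff q i *\<^sub>C (T ^^ Suc i) v) =
     (\<Sum>i\<le>degree p. (case i of 0 \<Rightarrow> 0 | Suc j \<Rightarrow> coeff q j) *\<^sub>C (T ^^ i) v)"
    by (simp only: deg sum.atMost_Suc_shift) simp
  also have "\<dots> - (\<Sum>i\<le>degree p. (c * coeff q i) *\<^sub>C (T ^^ i) v) = (\<Sum>i\<le>degree p. coeff p i *\<^sub>C (T ^^ i) v)"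
    unfolding sum_subtractf[symmetric]
    by (rule sum.cong[OF refl])
       (simp add: q coeff_pCons cvec.scale_left_diff_distrib[symmetric] split: nat.split)
  finally have "(\<Sum>i\<le>degree q. coeff q i *\<^sub>C (T ^^ i) w) = 0" using Suc.prems by simp
  then obtain cs where "kill_roots T cs w = 0" using Suc.hyps(1)[of q w] Suc.hyps(2) deg q0 by auto
  then show ?case by (intro exI[of _ "c # cs"]) (simp add: w_def)
qed

text \<open>A substitute for the minimal polynomial: the iterates of each vector are linearly
  dependent, and the lists of roots found for a finite basis of \<open>V\<close> are
  concatenated.\<close>

lemma finite_dim_kill_roots:
  assumes lin: "clinear T" and fin: "finite F" and sub: "V \<subseteq> cvec.span F"
    and st: "\<And>v. v \<in> V \<Longrightarrow> T v \<in> V"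
  shows "\<exists>cs. \<forall>v\<in>V. kill_roots T cs v = 0"
proof -
  have one: "\<exists>cs. kill_roots T cs v = 0" if v: "v \<in> V" for v
  proof -
    have iter: "(T ^^ i) v \<in> V" for i by (induction i) (auto simp: v st)
    define n where "n = card F"
    show ?thesis
    \<comment> \<open>Dependence is a property of the set of iterates. If two iterates coincide,
      this set may well be independent, and \<open>X^j - X^i\<close> serves as annihilating
      polynomial instead.\<close>
    proof (cases "inj_on (\<lambda>i. (T ^^ i) v) {..n}")
      case True
      let ?A = "(\<lambda>i. (T ^^ i) v) ` {..n}"
      have "card ?A = Suc n" using True by (simp add: card_image)
      then have "cvec.dependent ?A"
        using cvec.independent_span_bound[OF fin, of ?A] iter sub n_def by fastforce
      then obtain u where u: "(\<Sum>x\<in>?A. u x *\<^sub>C x) = 0" "\<exists>x\<in>?A. u x \<noteq> 0"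
        using cvec.dependent_finite[of ?A] by auto
      define a where "a i = u ((T ^^ i) v)" for i
      have s: "(\<Sum>i\<le>n. a i *\<^sub>C (T ^^ i) v) = 0"
        using u(1) True by (simp add: sum.reindex a_def)
      obtain k where k: "k \<le> n" "a k \<noteq> 0" using u(2) a_def by auto
      define p where "p = (\<Sum>i\<le>n. monom (a i) i)"
      have cp: "coeff p i = (if i \<le> n then a i else 0)" for i
        by (simp add: p_def coeff_sum)
      have "p \<noteq> 0" using k cp by (metis coeff_0)
      have "degree p \<le> n" by (rule degree_le) (simp add: cp)
      then have "(\<Sum>i\<le>degree p. coeff p i *\<^sub>C (T ^^ i) v) = (\<Sum>i\<le>n. coeff p i *\<^sub>C (T ^^ i) v)"
        by (intro sum.mono_neutral_left) (auto simp: coeff_eq_0)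
      also have "\<dots> = 0" using s by (simp add: cp)
      finally show ?thesis by (rule poly_annihilator_imp_kill_roots[OF lin \<open>p \<noteq> 0\<close>])
    next
      case False
      then obtain i j where ij: "i < j" "(T ^^ i) v = (T ^^ j) v"
        unfolding inj_on_def by (metis linorder_neqE_nat)
      define p where "p = monom (1::complex) j - monom 1 i"
      have cp: "coeff p k = (if k = j then 1 else 0) - (if k = i then 1 else 0)" for k
        using ij by (simp add: p_def)
      have "p \<noteq> 0" using cp[of j] ij by auto
      have "degree p \<le> j" by (rule degree_le) (use ij cp in auto)
      then have "(\<Sum>i\<le>degree p. coeff p i *\<^sub>C (T ^^ i) v) = (\<Sum>k\<le>j. coeff p k *\<^sub>C (T ^^ k) v)"
        by (intro sum.mono_neutral_left) (auto simp: coeff_eq_0)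
      also have "\<dots> = (\<Sum>k\<le>j. (if k = j then (T ^^ k) v else 0) - (if k = i then (T ^^ k) v else 0))"
        by (intro sum.cong) (auto simp: cp scaleC_one)
      also have "\<dots> = 0" using ij by (simp add: sum_subtractf)
      finally show ?thesis by (rule poly_annihilator_imp_kill_roots[OF lin \<open>p \<noteq> 0\<close>])
    qed
  qed
  obtain B where B: "finite B" "B \<subseteq> V" "cvec.independent B" "cvec.span B = cvec.span V"
    using finite_basis_subset[OF fin sub] .
  have "\<exists>cs. \<forall>v\<in>B. kill_roots T cs v = 0" using B(1,2)
  proof (induction B rule: finite_induct)
    case (insert x B)
    then obtain cs where "\<forall>v\<in>B. kill_roots T cs v = 0" by auto
    moreover obtain ds where "kill_roots T ds x = 0" using one[of x] insert.prems by auto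
    moreover note cs = calculation
    have "kill_roots T (cs @ ds) v = 0" if "v \<in> insert x B" for v
      using that cs kill_roots_commute[OF lin, of ds cs v] clinear_simps(3)[OF kill_roots_clinear[OF lin]]
      by (auto simp: kill_roots_append)
    then show ?case by blast
  qed simp
  then obtain cs where cs: "\<forall>v\<in>B. kill_roots T cs v = 0" by blast
  have "kill_roots T cs v = 0" if "v \<in> V" for v
  proof (rule clinear_eq_on_span[OF kill_roots_clinear[OF lin]])
    show "clinear (\<lambda>_. 0 :: 'a)" by (simp add: clinear_iff)
    show "kill_roots T cs x = 0" if "x \<in> B" for x using cs that by blast
    show "v \<in> cvec.span B" unfolding B(4) by (rule cvec.span_base[OF that])
  qed
  then show ?thesis by blast
qed

section \<open>Weight spaces of a family of operators: for the adjoint action, for \<open>M\<close>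
  and for \<open>M \<otimes> S\<close>\<close>

locale weight_action =
  fixes t :: "'x set" and act :: "'x \<Rightarrow> 'v::complex_vec \<Rightarrow> 'v"
  assumes act_clinear: "x \<in> t \<Longrightarrow> clinear (act x)"
begin

definition wspace :: "('x \<Rightarrow> complex) \<Rightarrow> 'v set" where
  "wspace \<mu> = {v. \<forall>x\<in>t. act x v = \<mu> x *\<^sub>C v}"

text \<open>Fixing the value 0 outside \<open>t\<close> ensures that distinct weights differ at a
  point of \<open>t\<close>.\<close>

definition functionals :: "('x \<Rightarrow> complex) set" where
  "functionals = {\<mu>. \<forall>x. x \<notin> t \<longrightarrow> \<mu> x = 0}"

lemma wspace_subspace: "cvec.subspace (wspace \<mu>)"
  by (auto simp: wspace_def cvec.subspace_def clinear_simps[OF act_clinear] scaleC_add_right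
      scaleC_scaleC mult.commute)

lemma functionals_distinct:
  assumes "\<mu> \<in> functionals" "\<nu> \<in> functionals" "\<mu> \<noteq> \<nu>"
  obtains x where "x \<in> t" "\<mu> x \<noteq> \<nu> x"
  using assms unfolding functionals_def by fastforce

text \<open>The operator \<open>act x - \<nu> x\<close> removes the component of weight \<nu> and
  multiplies the one of weight \<mu> by a factor that is nonzero for suitable \<open>x\<close>; the
  rest is induction on the number of components. For \<open>U = {0}\<close> this is the independence
  of weight spaces.\<close>

lemma weight_component_mem:
  assumes U: "cvec.subspace U" "\<And>x u. x \<in> t \<Longrightarrow> u \<in> U \<Longrightarrow> act x u \<in> U"
    and "finite I" "I \<subseteq> functionals" "\<And>\<mu>. \<mu> \<in> I \<Longrightarrow> v \<mu> \<in> wspace \<mu>"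
    and "(\<Sum>\<mu>\<in>I. v \<mu>) \<in> U" "\<mu> \<in> I"
  shows "v \<mu> \<in> U"
  using assms(3-)
proof (induction "card I" arbitrary: I v \<mu>)
  case 0
  then show ?case by simp
next
  case (Suc n)
  have *: "v \<mu> \<in> U" if j: "\<nu> \<in> I" "\<mu> \<in> I" "\<nu> \<noteq> \<mu>" for \<nu> \<mu>
  proof -
    obtain x where x: "x \<in> t" "\<nu> x \<noteq> \<mu> x"
      using j Suc.prems(2) functionals_distinct[of \<nu> \<mu>] by blast
    let ?w = "\<lambda>\<kappa>. (\<kappa> x - \<nu> x) *\<^sub>C v \<kappa>"
    have "act x (\<Sum>\<mu>\<in>I. v \<mu>) - \<nu> x *\<^sub>C (\<Sum>\<mu>\<in>I. v \<mu>) = (\<Sum>\<kappa>\<in>I. ?w \<kappa>)"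
      using Suc.prems(3) x(1)
      by (simp add: clinear_simps[OF act_clinear[OF x(1)]] cvec.scale_sum_right wspace_def
          sum_subtractf cvec.scale_left_diff_distrib)
    also have "\<dots> = (\<Sum>\<kappa>\<in>I - {\<nu>}. ?w \<kappa>)"
      using j Suc.prems(1) by (simp add: sum.remove)
    finally have "(\<Sum>\<kappa>\<in>I - {\<nu>}. ?w \<kappa>) \<in> U"
      using U Suc.prems(4) x(1) by (metis cvec.subspace_diff cvec.subspace_scale)
    moreover have "?w \<kappa> \<in> wspace \<kappa>" if "\<kappa> \<in> I" for \<kappa>
      using Suc.prems(3)[OF that] cvec.subspace_scale[OF wspace_subspace] by blast
    ultimately have "?w \<mu> \<in> U"
      using Suc.hyps(1)[of "I - {\<nu>}" ?w \<mu>] Suc.hyps(2) Suc.prems(1,2) j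
      by (simp add: subset_iff)
    then have "(1 / (\<mu> x - \<nu> x)) *\<^sub>C ?w \<mu> \<in> U" using U by (metis cvec.subspace_scale)
    then show ?thesis using x by (simp add: scaleC_scaleC scaleC_one)
  qed
  show ?case
  proof (cases "\<exists>\<nu>\<in>I. \<nu> \<noteq> \<mu>")
    case True
    then show ?thesis using * Suc.prems(5) by blast
  next
    case False
    then have "I = {\<mu>}" using Suc.prems by blast
    then show ?thesis using Suc.prems by simp
  qed
qed

text \<open>The terms of a linear combination are collected by weight. The function \<open>f\<close>
  vanishes off \<Lambda>, so that the index set can be enlarged freely.\<close>

lemma span_weight_decomp:
  assumes "v \<in> cvec.span (vec ` J)"
  shows "\<exists>\<Lambda> f. finite \<Lambda> \<and> \<Lambda> \<subseteq> wt ` J \<and> (\<forall>\<mu>. f \<mu> \<in> cvec.span (vec ` {j\<in>J. wt j = \<mu>})) \<and>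
     (\<forall>\<mu>. \<mu> \<notin> \<Lambda> \<longrightarrow> f \<mu> = 0) \<and> v = (\<Sum>\<mu>\<in>\<Lambda>. f \<mu>)"
  using assms
proof (induction rule: cvec.span_induct_alt)
  case base
  show ?case by (intro exI[of _ "{}"] exI[of _ "\<lambda>_. 0"]) (simp add: cvec.span_zero)
next
  case (step c x y)
  then obtain \<Lambda> f j where *: "finite \<Lambda>" "\<Lambda> \<subseteq> wt ` J" "\<And>\<mu>. f \<mu> \<in> cvec.span (vec ` {j\<in>J. wt j = \<mu>})"
     "\<And>\<mu>. \<mu> \<notin> \<Lambda> \<Longrightarrow> f \<mu> = 0" "y = (\<Sum>\<mu>\<in>\<Lambda>. f \<mu>)" "j \<in> J" "x = vec j" by blast
  let ?g = "\<lambda>\<mu>. f \<mu> + (if \<mu> = wt j then c *\<^sub>C x else 0)"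
  have "?g \<mu> \<in> cvec.span (vec ` {j\<in>J. wt j = \<mu>})" for \<mu>
    by (rule cvec.span_add[OF *(3)])
       (use *(6,7) in \<open>auto intro!: cvec.span_scale intro: cvec.span_base simp: cvec.span_zero\<close>)
  moreover have "(\<Sum>\<mu>\<in>insert (wt j) \<Lambda>. f \<mu>) = y"
    unfolding *(5) by (rule sum.mono_neutral_right) (use * in auto)
  then have "c *\<^sub>C x + y = (\<Sum>\<mu>\<in>insert (wt j) \<Lambda>. ?g \<mu>)"
    using *(1) by (simp only: sum.distrib) simp
  ultimately show ?case
    using * by (intro exI[of _ "insert (wt j) \<Lambda>"] exI[of _ ?g]) auto
qed

text \<open>Subtracting \<open>v\<close> from its decomposition leaves a sum of vectors of distinct
  weights that is 0, so each of them is 0. All bounds on dimensions of weight spaces come from this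
  lemma.\<close>

lemma weight_span_eq:
  assumes wt: "\<And>j. j \<in> J \<Longrightarrow> wt j \<in> functionals \<and> vec j \<in> wspace (wt j)"
    and v: "v \<in> cvec.span (vec ` J)" "v \<in> wspace \<mu>" "\<mu> \<in> functionals"
  shows "v \<in> cvec.span (vec ` {j\<in>J. wt j = \<mu>})"
proof -
  obtain \<Lambda> f where *: "finite \<Lambda>" "\<Lambda> \<subseteq> wt ` J" "\<And>\<mu>. f \<mu> \<in> cvec.span (vec ` {j\<in>J. wt j = \<mu>})"
     "\<And>\<mu>. \<mu> \<notin> \<Lambda> \<Longrightarrow> f \<mu> = 0" "v = (\<Sum>\<mu>\<in>\<Lambda>. f \<mu>)"
    using span_weight_decomp[OF v(1), of wt] by blast
  have fw: "f \<nu> \<in> wspace \<nu>" for \<nu>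
  proof -
    have "cvec.span (vec ` {j\<in>J. wt j = \<nu>}) \<subseteq> wspace \<nu>"
      by (rule cvec.span_minimal) (use wt wspace_subspace in auto)
    then show ?thesis using *(3) by blast
  qed
  let ?g = "\<lambda>\<nu>. f \<nu> - (if \<nu> = \<mu> then v else 0)"
  have "(\<Sum>\<nu>\<in>insert \<mu> \<Lambda>. f \<nu>) = v"
    unfolding *(5) by (rule sum.mono_neutral_right) (use * in auto)
  then have "(\<Sum>\<nu>\<in>insert \<mu> \<Lambda>. ?g \<nu>) = 0"
    using *(1) by (simp only: sum_subtractf) simp
  then have "?g \<mu> \<in> {0}"
    using * fw v wt by (intro weight_component_mem[of "{0}" "insert \<mu> \<Lambda>" ?g \<mu>])
      (auto simp: clinear_simps[OF act_clinear] intro!: cvec.subspace_diff[OF wspace_subspace] cvec.subspace_0[OF wspace_subspace])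
  then have "v = f \<mu>" by simp
  then show ?thesis using *(3)[of \<mu>] by metis
qed

text \<open>Applied with \<open>U = ker D\<close>, it makes the kernel of the Dirac operator a
  weight module.\<close>

lemma stable_weight_decomp:
  assumes wt: "\<And>j. j \<in> J \<Longrightarrow> wt j \<in> functionals \<and> vec j \<in> wspace (wt j)"
    and U: "cvec.subspace U" "\<And>x u. x \<in> t \<Longrightarrow> u \<in> U \<Longrightarrow> act x u \<in> U"
    and v: "v \<in> U" "v \<in> cvec.span (vec ` J)"
  shows "\<exists>\<Lambda> f. finite \<Lambda> \<and> \<Lambda> \<subseteq> wt ` J \<and> (\<forall>\<mu>\<in>\<Lambda>. f \<mu> \<in> U \<inter> wspace \<mu>) \<and> v = (\<Sum>\<mu>\<in>\<Lambda>. f \<mu>)"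
proof -
  obtain \<Lambda> f where *: "finite \<Lambda>" "\<Lambda> \<subseteq> wt ` J" "\<And>\<mu>. f \<mu> \<in> cvec.span (vec ` {j\<in>J. wt j = \<mu>})"
     "v = (\<Sum>\<mu>\<in>\<Lambda>. f \<mu>)"
    using span_weight_decomp[OF v(2), of wt] by blast
  have fw: "f \<nu> \<in> wspace \<nu>" for \<nu>
  proof -
    have "cvec.span (vec ` {j\<in>J. wt j = \<nu>}) \<subseteq> wspace \<nu>"
      by (rule cvec.span_minimal) (use wt wspace_subspace in auto)
    then show ?thesis using *(3) by blast
  qed
  have "f \<mu> \<in> U" if "\<mu> \<in> \<Lambda>" for \<mu>
  proof (rule weight_component_mem[OF U *(1) _ _ _ that])
    show "\<Lambda> \<subseteq> functionals" using *(2) wt by blast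
    show "f \<nu> \<in> wspace \<nu>" for \<nu> by (rule fw)
    show "(\<Sum>\<mu>\<in>\<Lambda>. f \<mu>) \<in> U" using v(1) *(4) by simp
  qed
  then have "\<forall>\<mu>\<in>\<Lambda>. f \<mu> \<in> U \<inter> wspace \<mu>" using fw by simp
  then show ?thesis using *(1,2,4) by (intro exI[of _ \<Lambda>] exI[of _ f]) simp
qed

end

section \<open>The Killing form and dual bases\<close>

locale lie_fd = lie_algebra br for br :: "'g::complex_vec \<Rightarrow> 'g \<Rightarrow> 'g" +
  assumes finite_dim: "finite_dim_type TYPE('g)"
begin

abbreviation "K \<equiv> killing br"

lemma br_simps:
  "br (x + y) z = br x z + br y z" "br z (x + y) = br z x + br z y"
  "br (c *\<^sub>C x) z = c *\<^sub>C br x z" "br z (c *\<^sub>C x) = c *\<^sub>C br z x"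
  "br 0 z = 0" "br z 0 = 0" "br (- x) z = - br x z" "br z (- x) = - br z x"
  "br (x - y) z = br x z - br y z" "br z (x - y) = br z x - br z y"
  using clinear_simps[OF br_linear_left[of z]] clinear_simps[OF br_linear_right[of z]] by simp_all

lemma br_sum:
  "br (\<Sum>i\<in>A. g i) z = (\<Sum>i\<in>A. br (g i) z)" "br z (\<Sum>i\<in>A. g i) = (\<Sum>i\<in>A. br z (g i))"
  by (rule clinear_simps(6)[OF br_linear_left[of z]], rule clinear_simps(6)[OF br_linear_right[of z]])

lemma br_anti: "br x y = - br y x"
proof -
  have "br (x + y) (x + y) = (br x x + br y x) + (br x y + br y y)" by (simp only: br_simps)
  then have "br x y + br y x = 0" by (simp add: br_self add.commute)
  then show ?thesis by (simp add: eq_neg_iff_add_eq_0)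
qed

lemma br_br: "br (br x y) z = br x (br y z) - br y (br x z)"
  using jacobi[of x y z] br_anti[of z "br x y"] br_anti[of z x] by (simp add: br_simps algebra_simps)

lemma independent_finite:
  assumes "cvec.independent (B :: 'g set)" shows "finite B"
proof -
  obtain A :: "'g set" where "finite A" "cvec.span A = UNIV"
    using finite_dim unfolding finite_dim_type_def by blast
  then show ?thesis using cvec.independent_span_bound[of A B] assms by simp
qed

text \<open>This is literally the basis chosen inside \<open>lin_trace\<close>; the Killing form
  becomes a trace in fixed coordinates by unfolding alone.\<close>

definition trace_basis :: "'g set" where
  "trace_basis = (SOME B. cvec.independent B \<and> cvec.span B = UNIV)"

lemma trace_basis: "cvec.independent trace_basis" "cvec.span trace_basis = UNIV" "finite trace_basis"
proof -
  obtain B where "cvec.independent B" "UNIV \<subseteq> cvec.span (B :: 'g set)"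
    using cvec.maximal_independent_subset[of UNIV] by blast
  then have "\<exists>B :: 'g set. cvec.independent B \<and> cvec.span B = UNIV" by blast
  from someI_ex[OF this] show "cvec.independent trace_basis" "cvec.span trace_basis = UNIV"
    unfolding trace_basis_def by auto
  then show "finite trace_basis" by (simp add: independent_finite)
qed

abbreviation (input) "tr f \<equiv> \<Sum>b\<in>trace_basis. cvec.representation trace_basis (f b) b"

lemma tr_simps:
  "tr (\<lambda>z. f z + g z) = tr f + tr g" "tr (\<lambda>z. f z - g z) = tr f - tr g" "tr (\<lambda>z. c *\<^sub>C f z) = c * tr f"
  by (simp_all add: cvec.representation_add[OF trace_basis(1)] cvec.representation_diff[OF trace_basis(1)]
      cvec.representation_scale[OF trace_basis(1)] trace_basis(2) sum.distrib sum_subtractf sum_distrib_left)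

lemma tr_commute: "clinear e \<Longrightarrow> clinear f \<Longrightarrow> tr (\<lambda>z. e (f z)) = tr (\<lambda>z. f (e z))"
  using trace_commute[OF trace_basis(3,1)] trace_basis(2) by auto

lemma K_def: "K x y = tr (\<lambda>z. br x (br y z))"
  unfolding killing_def lin_trace_def Let_def trace_basis_def ..

lemma K_sym: "K x y = K y x"
  unfolding K_def by (rule tr_commute) (rule br_linear_right)+

lemma K_add1: "K (x + y) z = K x z + K y z" and K_scale1: "K (c *\<^sub>C x) z = c * K x z"
  unfolding K_def by (simp_all only: br_simps tr_simps)

lemma K_add2: "K z (x + y) = K z x + K z y" and K_scale2: "K z (c *\<^sub>C x) = c * K z x"
  using K_add1 K_scale1 K_sym by metis+

lemma K_zero [simp]: "K 0 z = 0" "K z 0 = 0"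
  using K_scale1[of 0 0 z] K_scale2[of z 0 0] by simp_all

lemma K_minus: "K (- x) z = - K x z" "K z (- x) = - K z x"
  using K_scale1[of "-1" x z] K_scale2[of z "-1" x] by (simp_all add: cvec.scale_minus_left scaleC_one)

lemma K_diff: "K (x - y) z = K x z - K y z" "K z (x - y) = K z x - K z y"
  using K_add1[of x "-y" z] K_add2[of z x "-y"] by (simp_all add: K_minus)

lemma K_sum: "K (\<Sum>i\<in>A. f i) z = (\<Sum>i\<in>A. K (f i) z)" "K z (\<Sum>i\<in>A. f i) = (\<Sum>i\<in>A. K z (f i))"
  by (induction A rule: infinite_finite_induct) (simp_all add: K_add1 K_add2)

lemmas K_simps = K_add1 K_add2 K_scale1 K_scale2 K_minus K_diff K_sum

lemma K_inv: "K (br x y) z = K x (br y z)"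
proof -
  have "tr (\<lambda>w. br y (br x (br z w))) = tr (\<lambda>w. br x (br z (br y w)))"
    by (rule tr_commute) (auto simp: clinear_iff br_simps)
  then show ?thesis unfolding K_def br_br br_simps by (simp only: br_br br_simps tr_simps)
qed

lemma K_skew: "K (br w x) y = - K x (br w y)"
  using K_inv[of x w y] br_anti[of w x] by (simp add: K_simps)

lemma K_span_zero: "(\<And>b. b \<in> B \<Longrightarrow> K x b = 0) \<Longrightarrow> y \<in> cvec.span B \<Longrightarrow> K x y = 0"
  by (erule cvec.span_induct_alt[where h = "\<lambda>y. K x y = 0"]) (simp_all add: K_simps)

text \<open>Dual bases \<open>b\<close> and \<open>d b\<close> of \<open>V\<close>, characterized by
  the two expansion formulas instead of the pairings between them, because computations with Casimir
  sums substitute exactly these expansions. An orthonormal basis is the case where \<open>d\<close>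
  is the identity.\<close>

definition dual_on :: "'g set \<Rightarrow> 'g set \<Rightarrow> ('g \<Rightarrow> 'g) \<Rightarrow> bool" where
  "dual_on V B d \<longleftrightarrow> finite B \<and> B \<subseteq> V \<and> d ` B \<subseteq> V \<and>
     (\<forall>x\<in>V. x = (\<Sum>b\<in>B. K x (d b) *\<^sub>C b)) \<and> (\<forall>x\<in>V. x = (\<Sum>b\<in>B. K x b *\<^sub>C d b))"

lemma dual_onD:
  assumes "dual_on V B d"
  shows "finite B" "\<And>b. b \<in> B \<Longrightarrow> b \<in> V" "\<And>b. b \<in> B \<Longrightarrow> d b \<in> V"
    "\<And>x. x \<in> V \<Longrightarrow> (\<Sum>b\<in>B. K x (d b) *\<^sub>C b) = x" "\<And>x. x \<in> V \<Longrightarrow> (\<Sum>b\<in>B. K x b *\<^sub>C d b) = x"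
  using assms unfolding dual_on_def by (blast, blast, blast, metis, metis)

text \<open>The map \<open>f\<close> sends \<open>x\<close> to the vector with coordinates
  \<open>K x c\<close>. Nondegeneracy makes it injective, hence bijective on \<open>V\<close>, and
  \<open>d b\<close> is the preimage of \<open>b\<close>.\<close>

lemma dual_basis_exists:
  assumes nd: "nondegenerate_on br V" and B: "cvec.independent B" "cvec.span B = V"
  shows "\<exists>d. dual_on V B d \<and> (\<forall>b\<in>B. \<forall>c\<in>B. K (d b) c = (if b = c then 1 else 0))"
proof -
  have fin: "finite B" by (rule independent_finite[OF B(1)])
  have coef: "(\<Sum>c\<in>B. u c *\<^sub>C c) = (\<Sum>c\<in>B. w c *\<^sub>C c) \<Longrightarrow> c \<in> B \<Longrightarrow> u c = w c" for u w c
    using cvec.independentD[OF B(1) fin order_refl, of "\<lambda>c. u c - w c" c]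
    by (simp add: cvec.scale_left_diff_distrib sum_subtractf)
  have nd': "x = 0" if "x \<in> V" "\<And>b. b \<in> B \<Longrightarrow> K x b = 0" for x
    using nd that K_span_zero[of B x] B unfolding nondegenerate_on_def by blast
  define f where "f x = (\<Sum>c\<in>B. K x c *\<^sub>C c)" for x
  have "\<exists>x \<in> cvec.span B. f x = b" if "b \<in> B" for b
  proof (rule clinear_bij_span[OF _ fin B(1)])
    show "clinear f"
      by (rule clinearI)
         (simp_all add: f_def K_simps scaleC_add_left sum.distrib cvec.scale_sum_right scaleC_scaleC)
    show "f x \<in> cvec.span B" for x
      unfolding f_def by (intro cvec.span_sum cvec.span_scale cvec.span_base)
    show "x = 0" if "x \<in> cvec.span B" "f x = 0" for x
      by (rule nd') (use that coef[of "K x" "\<lambda>_. 0"] B in \<open>auto simp: f_def\<close>)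
    show "b \<in> cvec.span B" using that by (rule cvec.span_base)
  qed
  then obtain d where d: "\<And>b. b \<in> B \<Longrightarrow> d b \<in> V" "\<And>b. b \<in> B \<Longrightarrow> f (d b) = b"
    using B by metis
  have delta: "K (d b) c = (if b = c then 1 else 0)" if "b \<in> B" "c \<in> B" for b c
  proof -
    have "(\<Sum>c\<in>B. K (d b) c *\<^sub>C c) = (\<Sum>c\<in>B. (if b = c then 1 else 0) *\<^sub>C c)"
      using d(2)[OF that(1)] that fin unfolding f_def
      by (simp add: if_distrib[where f = "\<lambda>x. x *\<^sub>C _"] scaleC_one cong: if_cong)
    from coef[OF this that(2)] show ?thesis .
  qed
  have "x = (\<Sum>b\<in>B. K x (d b) *\<^sub>C b)" if x: "x \<in> V" for x
  proof -
    have "x \<in> cvec.span B" using x B by simp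
    then obtain r where r: "x = (\<Sum>b\<in>B. r b *\<^sub>C b)" unfolding cvec.span_finite[OF fin] by auto
    have "K x (d c) = r c" if "c \<in> B" for c
      using that fin by (simp add: r K_simps K_sym[of _ "d c"] delta if_distrib cong: if_cong)
    then show ?thesis using r by simp
  qed
  moreover have "x = (\<Sum>b\<in>B. K x b *\<^sub>C d b)" if x: "x \<in> V" for x
  proof -
    have "x - (\<Sum>b\<in>B. K x b *\<^sub>C d b) = 0"
    proof (rule nd')
      show "x - (\<Sum>b\<in>B. K x b *\<^sub>C d b) \<in> V"
        using x d(1) B(2) by (metis (no_types, lifting) cvec.span_diff cvec.span_scale cvec.span_sum)
      show "K (x - (\<Sum>b\<in>B. K x b *\<^sub>C d b)) c = 0" if "c \<in> B" for c
        using that fin by (simp add: K_simps delta if_distrib cong: if_cong)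
    qed
    then show ?thesis by simp
  qed
  ultimately have "dual_on V B d"
    unfolding dual_on_def using fin d B cvec.span_superset by blast
  then show ?thesis using delta by blast
qed

definition bilin :: "('g \<Rightarrow> 'g \<Rightarrow> 'b::complex_vec) \<Rightarrow> bool" where
  "bilin f \<longleftrightarrow> (\<forall>y. clinear (\<lambda>x. f x y)) \<and> (\<forall>x. clinear (f x))"

lemma bilin_simps:
  assumes "bilin f"
  shows "f (x + y) z = f x z + f y z" "f z (x + y) = f z x + f z y"
    "f (c *\<^sub>C x) z = c *\<^sub>C f x z" "f z (c *\<^sub>C x) = c *\<^sub>C f z x"
    "f (\<Sum>i\<in>A. g i) z = (\<Sum>i\<in>A. f (g i) z)" "f z (\<Sum>i\<in>A. g i) = (\<Sum>i\<in>A. f z (g i))"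
  using assms clinear_simps[of "\<lambda>x. f x z"] clinear_simps[of "f z"] unfolding bilin_def by blast+

text \<open>The canonical tensor \<open>\<Sum> b \<otimes> d b\<close> is symmetric because the form
  is; the bilinear map \<open>f\<close> evaluates it.\<close>

lemma dual_swap:
  assumes D: "dual_on V B d" and f: "bilin f"
  shows "(\<Sum>b\<in>B. f b (d b)) = (\<Sum>b\<in>B. f (d b) b)"
proof -
  have "(\<Sum>b\<in>B. f b (d b)) = (\<Sum>b\<in>B. f (\<Sum>c\<in>B. K b c *\<^sub>C d c) (d b))"
    using dual_onD[OF D] by simp
  also have "\<dots> = (\<Sum>b\<in>B. \<Sum>c\<in>B. K b c *\<^sub>C f (d c) (d b))"
    by (simp add: bilin_simps[OF f])
  also have "\<dots> = (\<Sum>c\<in>B. \<Sum>b\<in>B. K b c *\<^sub>C f (d c) (d b))" by (rule sum.swap)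
  also have "\<dots> = (\<Sum>c\<in>B. f (d c) (\<Sum>b\<in>B. K c b *\<^sub>C d b))"
    by (simp add: bilin_simps[OF f] K_sym)
  also have "\<dots> = (\<Sum>c\<in>B. f (d c) c)"
    using dual_onD[OF D] by simp
  finally show ?thesis .
qed

text \<open>The canonical tensor is annihilated by every operator that is skew for the form. The
  centrality of the Casimir element and the equivariance of \<open>D\<close> and of the cubic term
  all reduce to this.\<close>

lemma dual_inv:
  assumes D: "dual_on V B d" and f: "bilin f" and A: "\<And>x. x \<in> V \<Longrightarrow> A x \<in> V"
    "\<And>x y. x \<in> V \<Longrightarrow> y \<in> V \<Longrightarrow> K (A x) y = - K x (A y)"
  shows "(\<Sum>b\<in>B. f (A b) (d b)) = - (\<Sum>b\<in>B. f b (A (d b)))"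
proof -
  have "(\<Sum>b\<in>B. f (A b) (d b)) = (\<Sum>b\<in>B. f (\<Sum>c\<in>B. K (A b) (d c) *\<^sub>C c) (d b))"
    using dual_onD[OF D] A(1) by simp
  also have "\<dots> = (\<Sum>b\<in>B. \<Sum>c\<in>B. K (A b) (d c) *\<^sub>C f c (d b))"
    by (simp add: bilin_simps[OF f])
  also have "\<dots> = (\<Sum>c\<in>B. \<Sum>b\<in>B. K (A b) (d c) *\<^sub>C f c (d b))" by (rule sum.swap)
  also have "\<dots> = (\<Sum>c\<in>B. f c (\<Sum>b\<in>B. (- K (A (d c)) b) *\<^sub>C d b))"
  proof -
    have "K (A b) (d c) = - K (A (d c)) b" if "b \<in> B" "c \<in> B" for b c
      using A(2)[of b "d c"] dual_onD(2,3)[OF D] that by (metis K_sym)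
    then show ?thesis by (simp only: bilin_simps[OF f]) simp
  qed
  also have "\<dots> = (\<Sum>c\<in>B. f c (- A (d c)))"
    using dual_onD(5)[OF D A(1)[OF dual_onD(3)[OF D]]] by (simp add: cvec.scale_minus_left sum_negf)
  also have "\<dots> = - (\<Sum>b\<in>B. f b (A (d b)))"
    using f by (simp add: bilin_def clinear_simps sum_negf)
  finally show ?thesis .
qed

end

section \<open>The orthogonal decomposition of the Lie algebra into \<open>h\<close> and
  \<open>q\<close>\<close>

locale dirac_pair = lie_fd br for br :: "'g::complex_vec \<Rightarrow> 'g \<Rightarrow> 'g" +
  fixes h t Z :: "'g set"
  assumes h_sub: "lie_subalgebra br h" and h_nondeg: "nondegenerate_on br h"
    and cartan: "cartan_subalgebra br t" and t_h: "t \<subseteq> h"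
    and onb: "orthonormal_basis_q br h Z"
begin

abbreviation "q \<equiv> q_space br h"

lemma h_subspace: "cvec.subspace h" and h_br: "x \<in> h \<Longrightarrow> y \<in> h \<Longrightarrow> br x y \<in> h"
  using h_sub unfolding lie_subalgebra_def by blast+

lemma q_subspace: "cvec.subspace q"
  by (auto simp: cvec.subspace_def q_space_def K_simps)

lemma q_br: "x \<in> h \<Longrightarrow> y \<in> q \<Longrightarrow> br x y \<in> q"
  by (auto simp: q_space_def K_skew h_br)

lemma q_h_orth: "x \<in> q \<Longrightarrow> y \<in> h \<Longrightarrow> K x y = 0" "x \<in> h \<Longrightarrow> y \<in> q \<Longrightarrow> K x y = 0"
  by (auto simp: q_space_def K_sym)

lemma Z: "finite Z" "cvec.independent Z" "cvec.span Z = q"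
    "\<And>x y. x \<in> Z \<Longrightarrow> y \<in> Z \<Longrightarrow> K x y = (if x = y then 1 else 0)"
  using onb unfolding orthonormal_basis_q_def by auto

lemma Z_q: "z \<in> Z \<Longrightarrow> z \<in> q"
  using Z(3) cvec.span_base by blast

lemma q_expand: "x \<in> q \<Longrightarrow> (\<Sum>z\<in>Z. K x z *\<^sub>C z) = x"
proof -
  assume "x \<in> q"
  then obtain r where r: "x = (\<Sum>b\<in>Z. r b *\<^sub>C b)" unfolding Z(3)[symmetric] cvec.span_finite[OF Z(1)] by auto
  have "K x c = r c" if "c \<in> Z" for c
  proof -
    have "K x c = (\<Sum>b\<in>Z. if b = c then r b else 0)"
      unfolding r K_simps by (rule sum.cong) (use that Z(4) in auto)
    then show ?thesis using that Z(1) by simp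
  qed
  then show ?thesis using r by simp
qed

lemma dual_q: "dual_on q Z (\<lambda>x. x)"
  unfolding dual_on_def using Z(1) Z_q q_expand by auto

lemma q_nondeg: "x \<in> q \<Longrightarrow> (\<And>y. y \<in> q \<Longrightarrow> K x y = 0) \<Longrightarrow> x = 0"
  using q_expand[of x] Z_q by simp

text \<open>The sum is the orthogonal projection of \<open>x\<close> to \<open>h\<close>.\<close>

lemma dual_h_decomp:
  assumes D: "dual_on h B d"
  shows "(\<Sum>b\<in>B. K x (d b) *\<^sub>C b) \<in> h" "x - (\<Sum>b\<in>B. K x (d b) *\<^sub>C b) \<in> q"
proof -
  show "(\<Sum>b\<in>B. K x (d b) *\<^sub>C b) \<in> h"
    using dual_onD(2)[OF D] h_subspace by (intro cvec.subspace_sum cvec.subspace_scale) auto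
  have "K x y = (\<Sum>b\<in>B. K x (d b) * K b y)" if "y \<in> h" for y
  proof -
    have "K x y = K x (\<Sum>b\<in>B. K y b *\<^sub>C d b)" using dual_onD(5)[OF D that] by simp
    also have "\<dots> = (\<Sum>b\<in>B. K x (d b) * K b y)" by (simp add: K_simps K_sym mult.commute)
    finally show ?thesis .
  qed
  then show "x - (\<Sum>b\<in>B. K x (d b) *\<^sub>C b) \<in> q"
    by (simp add: q_space_def K_simps)
qed

lemma h_dual_exists: "\<exists>B d. dual_on h B d"
proof -
  obtain B where "B \<subseteq> h" "cvec.independent B" "h \<subseteq> cvec.span B"
    using cvec.maximal_independent_subset by blast
  moreover from this have "cvec.span B = h"
    using h_subspace cvec.span_minimal by blast
  ultimately show ?thesis using dual_basis_exists[OF h_nondeg] by blast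
qed

lemma hq_decomp: obtains a b where "a \<in> h" "b \<in> q" "x = a + b"
proof -
  obtain B d where D: "dual_on h B d" using h_dual_exists by blast
  show ?thesis using that[OF dual_h_decomp[OF D, of x]] by simp
qed

lemma hq_zero: "x \<in> h \<Longrightarrow> x \<in> q \<Longrightarrow> x = 0"
  using h_nondeg q_h_orth unfolding nondegenerate_on_def by blast

text \<open>The two summands are orthogonal, the form is nondegenerate on \<open>h\<close>, and the
  orthonormal basis makes it nondegenerate on \<open>q\<close>.\<close>

lemma g_nondeg: "(\<And>y. K x y = 0) \<Longrightarrow> x = 0"
  by (rule hq_decomp[of x])
     (metis K_add1 add.right_neutral h_nondeg hq_zero nondegenerate_on_def q_h_orth(1) q_nondeg add_0)

text \<open>Gluing the dual bases of \<open>h\<close> and the orthonormal basis of \<open>q\<close>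
  splits the Casimir element of the whole Lie algebra into an \<open>h\<close>-part and a
  \<open>q\<close>-part, the latter being a sum of squares.\<close>

lemma dual_g:
  assumes D: "dual_on h B d"
  shows "B \<inter> Z = {}" "dual_on UNIV (B \<union> Z) (\<lambda>b. if b \<in> Z then b else d b)"
proof -
  show disj: "B \<inter> Z = {}"
  proof (rule ccontr)
    assume "B \<inter> Z \<noteq> {}"
    then obtain b where "b \<in> B" "b \<in> Z" by blast
    then have "b = 0" using hq_zero dual_onD(2)[OF D] Z_q by blast
    then show False using Z(4)[of b b] \<open>b \<in> Z\<close> by simp
  qed
  let ?d = "\<lambda>b. if b \<in> Z then b else d b"
  have s: "(\<Sum>b\<in>B \<union> Z. f b) = (\<Sum>b\<in>B. f b) + (\<Sum>b\<in>Z. f b)" for f :: "'g \<Rightarrow> 'g"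
    by (rule sum.union_disjoint) (use disj dual_onD(1)[OF D] Z in auto)
  have nz: "b \<in> B \<Longrightarrow> b \<notin> Z" for b using disj by blast
  have "x = (\<Sum>b\<in>B \<union> Z. K x (?d b) *\<^sub>C b) \<and> x = (\<Sum>b\<in>B \<union> Z. K x b *\<^sub>C ?d b)" for x
  proof -
    obtain a c where x: "a \<in> h" "c \<in> q" "x = a + c" by (rule hq_decomp)
    have "(\<Sum>b\<in>B. K x (d b) *\<^sub>C b) = a" "(\<Sum>b\<in>B. K x b *\<^sub>C d b) = a"
      using dual_onD[OF D] x by (simp_all add: K_simps q_h_orth)
    moreover have "(\<Sum>z\<in>Z. K x z *\<^sub>C z) = c"
      using q_expand Z_q x by (simp add: K_simps q_h_orth)
    ultimately show ?thesis using x unfolding s by (simp add: nz)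
  qed
  then show "dual_on UNIV (B \<union> Z) ?d"
    unfolding dual_on_def using dual_onD(1)[OF D] Z(1) by blast
qed

end

section \<open>Roots\<close>

text \<open>It permits the evaluation of the Killing form in a basis of weight vectors.\<close>

lemma (in lie_fd) trace_basis_indep:
  assumes f: "clinear f" and B: "cvec.independent B" "cvec.span B = UNIV"
  shows "tr f = (\<Sum>b\<in>B. cvec.representation B (f b) b)"
proof -
  let ?C = trace_basis
  let ?r = "cvec.representation B" and ?s = "cvec.representation ?C"
  have fin: "finite B" by (rule independent_finite[OF B(1)])
  have "(\<Sum>b\<in>B. ?r (f b) b) = (\<Sum>b\<in>B. \<Sum>c\<in>?C. ?s b c * ?r (f c) b)"
  proof (rule sum.cong[OF refl])
    fix b assume "b \<in> B"
    have "b = (\<Sum>c\<in>?C. ?s b c *\<^sub>C c)"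
      using cvec.sum_representation_eq[OF trace_basis(1) _ trace_basis(3) order_refl, of b] trace_basis(2) by simp
    then have "f b = (\<Sum>c\<in>?C. ?s b c *\<^sub>C f c)"
      by (metis (no_types, lifting) clinear_simps(2,6)[OF f] sum.cong)
    then show "?r (f b) b = (\<Sum>c\<in>?C. ?s b c * ?r (f c) b)"
      using cvec.representation_sum[OF B(1), of ?C "\<lambda>c. ?s b c *\<^sub>C f c"]
      by (simp add: B cvec.representation_scale[OF B(1)])
  qed
  also have "\<dots> = (\<Sum>c\<in>?C. \<Sum>b\<in>B. ?r (f c) b * ?s b c)"
    by (subst sum.swap) (simp add: mult.commute)
  also have "\<dots> = (\<Sum>c\<in>?C. ?s (f c) c)"
  proof (rule sum.cong[OF refl])
    fix c
    have "f c = (\<Sum>b\<in>B. ?r (f c) b *\<^sub>C b)"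
      using cvec.sum_representation_eq[OF B(1) _ fin order_refl, of "f c"] B(2) by simp
    moreover have "?s (\<Sum>b\<in>B. ?r (f c) b *\<^sub>C b) = (\<lambda>d. \<Sum>b\<in>B. ?s (?r (f c) b *\<^sub>C b) d)"
      by (rule cvec.representation_sum[OF trace_basis(1)]) (simp add: trace_basis)
    ultimately show "(\<Sum>b\<in>B. ?r (f c) b * ?s b c) = ?s (f c) c"
      by (simp add: cvec.representation_scale[OF trace_basis(1)] trace_basis(2))
  qed
  finally show ?thesis by simp
qed

context dirac_pair
begin

sublocale ad: weight_action t br
  by (rule weight_action.intro) (rule br_linear_right)

lemma t_subspace: "cvec.subspace t" and t_abel: "x \<in> t \<Longrightarrow> y \<in> t \<Longrightarrow> br x y = 0"
  and t_central: "(\<And>y. y \<in> t \<Longrightarrow> br y x = 0) \<Longrightarrow> x \<in> t"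
  and t_diag: "y \<in> t \<Longrightarrow> cvec.span {x. \<exists>c. br y x = c *\<^sub>C x} = UNIV"
  using cartan unfolding cartan_subalgebra_def by blast+

lemma dual_space_functionals: "\<mu> \<in> dual_space t \<Longrightarrow> \<mu> \<in> ad.functionals"
  unfolding dual_space_def ad.functionals_def by blast

lemma dual_spaceD:
  assumes "\<mu> \<in> dual_space t"
  shows "x \<in> t \<Longrightarrow> y \<in> t \<Longrightarrow> \<mu> (x + y) = \<mu> x + \<mu> y" "x \<in> t \<Longrightarrow> \<mu> (c *\<^sub>C x) = c * \<mu> x"
    "x \<notin> t \<Longrightarrow> \<mu> x = 0"
  using assms unfolding dual_space_def by blast+

lemma dual_space_ops:
  "(\<lambda>_. 0) \<in> dual_space t"
  "\<mu> \<in> dual_space t \<Longrightarrow> (\<lambda>x. - \<mu> x) \<in> dual_space t"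
  "\<mu> \<in> dual_space t \<Longrightarrow> (\<lambda>x. a * \<mu> x) \<in> dual_space t"
  "\<mu> \<in> dual_space t \<Longrightarrow> \<nu> \<in> dual_space t \<Longrightarrow> (\<lambda>x. \<mu> x + \<nu> x) \<in> dual_space t"
  "\<mu> \<in> dual_space t \<Longrightarrow> \<nu> \<in> dual_space t \<Longrightarrow> (\<lambda>x. \<mu> x - \<nu> x) \<in> dual_space t"
  unfolding dual_space_def by (simp_all add: algebra_simps)

lemma dual_space_sum: "(\<And>i. i \<in> A \<Longrightarrow> \<mu> i \<in> dual_space t) \<Longrightarrow> (\<lambda>x. \<Sum>i\<in>A. \<mu> i x) \<in> dual_space t"
  by (induction A rule: infinite_finite_induct) (simp_all add: dual_space_ops)

lemma dual_space_lin:
  assumes "\<mu> \<in> dual_space t" "\<And>i. i \<in> A \<Longrightarrow> x i \<in> t"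
  shows "\<mu> (\<Sum>i\<in>A. c i *\<^sub>C x i) = (\<Sum>i\<in>A. c i * \<mu> (x i))"
  using assms(2)
proof (induction A rule: infinite_finite_induct)
  case (insert i A)
  then show ?case
    using t_subspace by (simp add: dual_spaceD[OF assms(1)] cvec.subspace_scale cvec.subspace_sum)
qed (use dual_spaceD(2)[OF assms(1), of 0 0] t_subspace cvec.subspace_0 in auto)

lemma root_space_eq: "root_space br t UNIV \<alpha> = ad.wspace \<alpha>"
  unfolding root_space_def ad.wspace_def by simp

text \<open>A joint eigenspace of \<open>T\<close> is stable under a further element
  \<open>y\<close> of the commutative \<open>t\<close>, and a stable subspace contains the
  \<open>y\<close>-components of its vectors.\<close>

lemma simultaneous_eigenvectors:
  assumes "finite T" "T \<subseteq> t"
  shows "cvec.span {x. \<exists>c. \<forall>y\<in>T. br y x = c y *\<^sub>C x} = UNIV"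
  using assms
proof (induction T rule: finite_induct)
  case (insert y T)
  let ?E = "{x. \<exists>c. \<forall>z\<in>insert y T. br z x = c z *\<^sub>C x}"
  have y: "y \<in> t" using insert.prems by blast
  interpret y: weight_action "{y}" br by (rule weight_action.intro) (rule br_linear_right)
  have "x \<in> cvec.span ?E" if xc: "\<exists>c. \<forall>z\<in>T. br z x = c z *\<^sub>C x" for x
  proof -
    obtain c where c: "\<forall>z\<in>T. br z x = c z *\<^sub>C x" using xc by blast
    let ?U = "{x. \<forall>z\<in>T. br z x = c z *\<^sub>C x}"
    define J where "J = {x. \<exists>d. br y x = d *\<^sub>C x}"
    have "\<forall>x\<in>J. \<exists>d. br y x = d *\<^sub>C x" by (simp add: J_def)
    then obtain d where d: "\<And>x. x \<in> J \<Longrightarrow> br y x = d x *\<^sub>C x" by (metis bchoice)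
    \<comment> \<open>The eigenvalue \<open>d x\<close> is encoded as a weight of the one-element
      family \<open>{y}\<close>: the function with this value at \<open>y\<close> and 0
      elsewhere.\<close>
    have "\<exists>\<Lambda> f. finite \<Lambda> \<and> \<Lambda> \<subseteq> (\<lambda>x z. if z = y then d x else 0) ` J \<and>
        (\<forall>\<mu>\<in>\<Lambda>. f \<mu> \<in> ?U \<inter> y.wspace \<mu>) \<and> x = (\<Sum>\<mu>\<in>\<Lambda>. f \<mu>)"
    proof (rule y.stable_weight_decomp[where vec = "\<lambda>x. x"])
      show "cvec.subspace ?U"
        by (auto simp: cvec.subspace_def br_simps scaleC_add_right scaleC_scaleC mult.commute)
      show "br w u \<in> ?U" if "w \<in> {y}" "u \<in> ?U" for w u
      proof clarify
        fix z assume "z \<in> T"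
        then have "br y z = 0" using insert.prems t_abel by blast
        then have "br z (br y u) = br y (br z u)" using br_br[of y z u] by (simp add: br_simps)
        then show "br z (br w u) = c z *\<^sub>C br w u" using that \<open>z \<in> T\<close> by (simp add: br_simps)
      qed
      show "x \<in> cvec.span ((\<lambda>x. x) ` J)" using t_diag[OF y] J_def by simp
    qed (use c d in \<open>auto simp: y.functionals_def y.wspace_def\<close>)
    then obtain \<Lambda> f where f: "\<forall>\<mu>\<in>\<Lambda>. f \<mu> \<in> ?U \<inter> y.wspace \<mu>" "x = (\<Sum>\<mu>\<in>\<Lambda>. f \<mu>)" by blast
    have "f \<mu> \<in> ?E" if "\<mu> \<in> \<Lambda>" for \<mu>
      using f(1) that by (auto simp: y.wspace_def insert.hyps intro!: exI[of _ "c(y := \<mu> y)"])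
    then show ?thesis unfolding f(2) by (intro cvec.span_sum cvec.span_base)
  qed
  then have "{x. \<exists>c. \<forall>z\<in>T. br z x = c z *\<^sub>C x} \<subseteq> cvec.span ?E" by blast
  then have "cvec.span {x. \<exists>c. \<forall>z\<in>T. br z x = c z *\<^sub>C x} \<subseteq> cvec.span ?E"
    by (rule cvec.span_minimal) (rule cvec.subspace_span)
  then show ?case using insert by blast
qed simp

text \<open>It suffices to diagonalize a finite basis of \<open>t\<close>, since on a nonzero joint
  eigenvector the eigenvalues extend to a linear functional. For \<open>x = 0\<close> they are
  undetermined, and the vector is assigned to weight 0.\<close>

lemma weights_span: "cvec.span (\<Union>\<alpha>\<in>dual_space t. ad.wspace \<alpha>) = UNIV"
proof -
  obtain T where T: "T \<subseteq> t" "cvec.independent T" "t \<subseteq> cvec.span T"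
    using cvec.maximal_independent_subset by blast
  have "x \<in> (\<Union>\<alpha>\<in>dual_space t. ad.wspace \<alpha>)" if x: "\<exists>c. \<forall>y\<in>T. br y x = c y *\<^sub>C x" for x
  proof (cases "x = 0")
    case True
    then show ?thesis using dual_space_ops(1) cvec.subspace_0[OF ad.wspace_subspace] by blast
  next
    case False
    obtain c where c: "\<And>y. y \<in> T \<Longrightarrow> br y x = c y *\<^sub>C x" using x by blast
    have ex: "\<exists>a. br y x = a *\<^sub>C x" if "y \<in> t" for y
    proof -
      have "y \<in> cvec.span T" using that T by blast
      then show ?thesis
      proof (induction rule: cvec.span_induct_alt)
        case base
        show ?case by (intro exI[of _ 0]) (simp add: br_simps)
      next
        case (step d u y)
        then obtain a where "br y x = a *\<^sub>C x" by blast
        then show ?case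
          using c[OF step(1)]
          by (intro exI[of _ "d * c u + a"]) (simp add: br_simps scaleC_add_left scaleC_scaleC)
      qed
    qed
    define \<alpha> where "\<alpha> y = (if y \<in> t then SOME a. br y x = a *\<^sub>C x else 0)" for y
    have \<alpha>: "br y x = \<alpha> y *\<^sub>C x" if "y \<in> t" for y
      using someI_ex[OF ex[OF that]] that by (simp add: \<alpha>_def)
    have inj: "a *\<^sub>C x = b *\<^sub>C x \<Longrightarrow> a = b" for a b using False by simp
    have "\<alpha> \<in> dual_space t"
      unfolding dual_space_def
    proof (intro CollectI conjI ballI allI impI)
      fix y z assume *: "y \<in> t" "z \<in> t"
      then have "y + z \<in> t" using t_subspace cvec.subspace_add by blast
      then show "\<alpha> (y + z) = \<alpha> y + \<alpha> z"
        using * by (intro inj) (simp add: \<alpha>[symmetric] br_simps scaleC_add_left)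
    next
      fix a y assume *: "y \<in> t"
      then have "a *\<^sub>C y \<in> t" using t_subspace cvec.subspace_scale by blast
      then show "\<alpha> (a *\<^sub>C y) = a * \<alpha> y"
        using * by (intro inj) (simp add: \<alpha>[symmetric] br_simps scaleC_scaleC[symmetric])
    qed (simp add: \<alpha>_def)
    moreover have "x \<in> ad.wspace \<alpha>" using \<alpha> by (simp add: ad.wspace_def)
    ultimately show ?thesis by blast
  qed
  then have "{x. \<exists>c. \<forall>y\<in>T. br y x = c y *\<^sub>C x} \<subseteq> (\<Union>\<alpha>\<in>dual_space t. ad.wspace \<alpha>)" by blast
  then show ?thesis
    using simultaneous_eigenvectors[OF independent_finite[OF T(2)] T(1)] cvec.span_mono by blast
qed

definition weight_basis :: "'g set \<Rightarrow> ('g \<Rightarrow> 'g \<Rightarrow> complex) \<Rightarrow> bool" where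
  "weight_basis B wt \<longleftrightarrow> finite B \<and> cvec.independent B \<and> cvec.span B = UNIV \<and>
     (\<forall>b\<in>B. wt b \<in> dual_space t \<and> b \<in> ad.wspace (wt b))"

lemma weight_basisD:
  assumes "weight_basis B wt"
  shows "finite B" "cvec.independent B" "cvec.span B = UNIV"
    "\<And>b. b \<in> B \<Longrightarrow> wt b \<in> dual_space t" "\<And>b. b \<in> B \<Longrightarrow> b \<in> ad.wspace (wt b)"
  using assms unfolding weight_basis_def by blast+

text \<open>The prescribed vectors \<open>S\<close> matter in \<open>root_space_dim1\<close>;
  elsewhere \<open>S\<close> is empty.\<close>

lemma weight_basis_extend:
  assumes S: "S \<subseteq> (\<Union>\<alpha>\<in>dual_space t. ad.wspace \<alpha>)" "cvec.independent S"
  obtains B wt where "weight_basis B wt" "S \<subseteq> B"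
proof -
  obtain B where B: "S \<subseteq> B" "B \<subseteq> (\<Union>\<alpha>\<in>dual_space t. ad.wspace \<alpha>)" "cvec.independent B"
    "(\<Union>\<alpha>\<in>dual_space t. ad.wspace \<alpha>) \<subseteq> cvec.span B"
    using cvec.maximal_independent_subset_extend[OF S] by blast
  have "cvec.span B = UNIV"
    using cvec.span_minimal[OF B(4)] weights_span by (simp add: top.extremum_unique)
  moreover obtain wt where "\<forall>b\<in>B. wt b \<in> dual_space t \<and> b \<in> ad.wspace (wt b)"
    using bchoice[of B "\<lambda>b \<alpha>. \<alpha> \<in> dual_space t \<and> b \<in> ad.wspace \<alpha>"] B(2) by blast
  ultimately have "weight_basis B wt"
    unfolding weight_basis_def using independent_finite[OF B(3)] B(3) by simp
  then show ?thesis using that B(1) by simp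
qed

lemma wspace_br:
  "x \<in> ad.wspace \<alpha> \<Longrightarrow> y \<in> ad.wspace \<beta> \<Longrightarrow> br x y \<in> ad.wspace (\<lambda>z. \<alpha> z + \<beta> z)"
proof -
  assume *: "x \<in> ad.wspace \<alpha>" "y \<in> ad.wspace \<beta>"
  have "br z (br x y) = br (br z x) y + br x (br z y)" for z
    using br_br[of z x y] by simp
  then show ?thesis using * by (simp add: ad.wspace_def br_simps scaleC_add_left)
qed

lemma wspace_orth:
  assumes "x \<in> ad.wspace \<alpha>" "y \<in> ad.wspace \<beta>" "z \<in> t" "\<alpha> z + \<beta> z \<noteq> 0"
  shows "K x y = 0"
proof -
  have "K (br z x) y = - K x (br z y)" by (rule K_skew)
  then have "(\<alpha> z + \<beta> z) * K x y = 0"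
    using assms(1-3) by (simp add: ad.wspace_def K_simps algebra_simps)
  then show ?thesis using assms(4) by simp
qed

lemma wspace_zero: "ad.wspace (\<lambda>_. 0) = t"
  using t_abel t_central by (auto simp: ad.wspace_def)

lemma wspace_eq_span:
  assumes B: "weight_basis B wt" and \<mu>: "\<mu> \<in> dual_space t"
  shows "ad.wspace \<mu> = cvec.span {b \<in> B. wt b = \<mu>}"
proof
  show "ad.wspace \<mu> \<subseteq> cvec.span {b \<in> B. wt b = \<mu>}"
  proof
    fix v assume "v \<in> ad.wspace \<mu>"
    then have "v \<in> cvec.span ((\<lambda>x. x) ` {b \<in> B. wt b = \<mu>})"
      by (intro ad.weight_span_eq)
         (use weight_basisD[OF B] \<mu> dual_space_functionals in auto)
    then show "v \<in> cvec.span {b \<in> B. wt b = \<mu>}" by simp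
  qed
  show "cvec.span {b \<in> B. wt b = \<mu>} \<subseteq> ad.wspace \<mu>"
    by (rule cvec.span_minimal) (use weight_basisD[OF B] ad.wspace_subspace in auto)
qed

text \<open>\<open>t\<close> is the weight space of 0 and is orthogonal to all others; so an element
  of \<open>t\<close> orthogonal to \<open>t\<close> is orthogonal to everything.\<close>

lemma t_nondeg: "nondegenerate_on br t"
  unfolding nondegenerate_on_def
proof (intro ballI impI)
  fix x assume x: "x \<in> t" "\<forall>y\<in>t. K x y = 0"
  have "K x y = 0" for y
  proof (rule K_span_zero)
    show "y \<in> cvec.span (\<Union>\<alpha>\<in>dual_space t. ad.wspace \<alpha>)" by (simp add: weights_span)
    show "K x b = 0" if bb: "b \<in> (\<Union>\<alpha>\<in>dual_space t. ad.wspace \<alpha>)" for b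
    proof -
      obtain \<alpha> where \<alpha>: "\<alpha> \<in> dual_space t" "b \<in> ad.wspace \<alpha>" using bb by blast
      show ?thesis
      proof (cases "\<alpha> = (\<lambda>_. 0)")
        case True
        then show ?thesis using \<alpha> x wspace_zero by blast
      next
        case False
        then obtain z where "\<alpha> z \<noteq> 0" by blast
        moreover then have "z \<in> t" using dual_spaceD(3)[OF \<alpha>(1)] by blast
        ultimately show ?thesis using wspace_orth[of x "\<lambda>_. 0" b \<alpha> z] x \<alpha> wspace_zero by simp
      qed
    qed
  qed
  then show "x = 0" by (rule g_nondeg)
qed

text \<open>The vector that represents \<mu> through the Killing form, so that
  \<open>\<mu> (tdual \<nu>)\<close> is the induced form \<open>(\<mu>, \<nu>)\<close> on the dual
  of \<open>t\<close>.\<close>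

definition tdual :: "('g \<Rightarrow> complex) \<Rightarrow> 'g" where
  "tdual \<mu> = (SOME x. x \<in> t \<and> (\<forall>y\<in>t. K x y = \<mu> y))"

lemma tdual:
  assumes "\<mu> \<in> dual_space t"
  shows "tdual \<mu> \<in> t" "\<And>y. y \<in> t \<Longrightarrow> K (tdual \<mu>) y = \<mu> y"
proof -
  obtain T where T: "T \<subseteq> t" "cvec.independent T" "t \<subseteq> cvec.span T"
    using cvec.maximal_independent_subset by blast
  have sp: "cvec.span T = t" using T t_subspace cvec.span_minimal by blast
  obtain d where D: "dual_on t T d" using dual_basis_exists[OF t_nondeg T(2) sp] by blast
  define x where "x = (\<Sum>b\<in>T. \<mu> b *\<^sub>C d b)"
  have "x \<in> t" unfolding x_def
    by (intro cvec.subspace_sum[OF t_subspace] cvec.subspace_scale[OF t_subspace] dual_onD(3)[OF D])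
  moreover have "K x y = \<mu> y" if "y \<in> t" for y
  proof -
    have "\<mu> y = \<mu> (\<Sum>b\<in>T. K y (d b) *\<^sub>C b)" using dual_onD(4)[OF D that] by simp
    also have "\<dots> = (\<Sum>b\<in>T. K y (d b) * \<mu> b)"
      by (rule dual_space_lin[OF assms]) (use T in auto)
    finally show ?thesis by (simp add: x_def K_simps K_sym mult.commute)
  qed
  ultimately have "\<exists>x. x \<in> t \<and> (\<forall>y\<in>t. K x y = \<mu> y)" by blast
  note P = someI_ex[OF this, folded tdual_def]
  show "tdual \<mu> \<in> t" using P by (rule conjunct1)
  show "K (tdual \<mu>) y = \<mu> y" if "y \<in> t" for y using conjunct2[OF P] that by (rule bspec)
qed

text \<open>Both sides lie in \<open>t\<close> and, by invariance of the form, have the same pairing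
  with every element of \<open>t\<close>.\<close>

lemma br_opposite:
  assumes "\<alpha> \<in> dual_space t" "e \<in> ad.wspace \<alpha>" "f \<in> ad.wspace (\<lambda>x. - \<alpha> x)"
  shows "br e f = K e f *\<^sub>C tdual \<alpha>"
proof -
  have t: "br e f - K e f *\<^sub>C tdual \<alpha> \<in> t"
    using wspace_br[OF assms(2,3)] tdual[OF assms(1)] t_subspace
    by (simp add: wspace_zero cvec.subspace_diff cvec.subspace_scale)
  have "K (br e f - K e f *\<^sub>C tdual \<alpha>) y = 0" if "y \<in> t" for y
  proof -
    have "K (br e f) y = K (br y e) f" using K_inv[of y e f] K_sym[of "br e f" y] by simp
    then show ?thesis
      using assms(2) that tdual[OF assms(1)] by (simp add: ad.wspace_def K_simps)
  qed
  then show ?thesis using t t_nondeg unfolding nondegenerate_on_def by (metis eq_iff_diff_eq_0)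
qed

text \<open>A weight vector is orthogonal to every weight space except that of the opposite weight,
  and a nonzero one is not orthogonal to everything.\<close>

lemma opposite_exists:
  assumes "\<alpha> \<in> dual_space t" "e \<in> ad.wspace \<alpha>" "e \<noteq> 0"
  obtains f where "f \<in> ad.wspace (\<lambda>x. - \<alpha> x)" "K e f = 1"
proof -
  have "\<exists>f \<in> ad.wspace (\<lambda>x. - \<alpha> x). K e f \<noteq> 0"
  proof (rule ccontr)
    assume neg: "\<not> ?thesis"
    have "K e y = 0" for y
    proof (rule K_span_zero)
      show "y \<in> cvec.span (\<Union>\<alpha>\<in>dual_space t. ad.wspace \<alpha>)" by (simp add: weights_span)
      show "K e b = 0" if bb: "b \<in> (\<Union>\<alpha>\<in>dual_space t. ad.wspace \<alpha>)" for b
      proof -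
        obtain \<beta> where \<beta>: "\<beta> \<in> dual_space t" "b \<in> ad.wspace \<beta>" using bb by blast
        show ?thesis
        proof (cases "\<exists>z\<in>t. \<alpha> z + \<beta> z \<noteq> 0")
          case True
          then show ?thesis using wspace_orth assms(2) \<beta> by blast
        next
          case False
          then have "\<beta> z = - \<alpha> z" for z
            using dual_spaceD(3)[OF assms(1)] dual_spaceD(3)[OF \<beta>(1)]
            by (cases "z \<in> t") (auto simp: add_eq_0_iff)
          then have "\<beta> = (\<lambda>x. - \<alpha> x)" by blast
          then show ?thesis using neg \<beta> by blast
        qed
      qed
    qed
    then show False using g_nondeg assms(3) by blast
  qed
  then obtain f where f: "f \<in> ad.wspace (\<lambda>x. - \<alpha> x)" "K e f \<noteq> 0" by blast
  show ?thesis
    by (rule that[of "(1 / K e f) *\<^sub>C f"])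
       (use f cvec.subspace_scale[OF ad.wspace_subspace] in \<open>auto simp: K_simps\<close>)
qed

text \<open>The trace is evaluated in a basis of weight vectors. Where the weights take real values,
  \<open>K x x\<close> becomes a sum of squares; this is the source of positive
  definiteness.\<close>

lemma K_t_formula:
  assumes B: "weight_basis B wt" and "x \<in> t" "y \<in> t"
  shows "K x y = (\<Sum>b\<in>B. wt b x * wt b y)"
proof -
  note BD = weight_basisD[OF B]
  have "K x y = tr (\<lambda>z. br x (br y z))" by (rule K_def)
  also have "\<dots> = (\<Sum>b\<in>B. cvec.representation B (br x (br y b)) b)"
    by (rule trace_basis_indep[OF _ BD(2,3)]) (simp add: clinear_iff br_simps)
  also have "\<dots> = (\<Sum>b\<in>B. wt b x * wt b y)"
  proof (rule sum.cong[OF refl])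
    fix b assume b: "b \<in> B"
    have "br x (br y b) = (wt b x * wt b y) *\<^sub>C b"
      using BD(5)[OF b] assms by (simp add: ad.wspace_def br_simps scaleC_scaleC mult.commute)
    then show "cvec.representation B (br x (br y b)) b = wt b x * wt b y"
      using b by (simp add: cvec.representation_scale[OF BD(2)] cvec.span_base cvec.representation_basis[OF BD(2)])
  qed
  finally show ?thesis .
qed

text \<open>The trace of \<open>tdual \<alpha> = [e, f]\<close> on the sum of the weight spaces of the \<open>\<alpha>\<close>-string
  through \<open>wt b\<close> vanishes.\<close>

lemma root_string:
  assumes B: "weight_basis B wt" and \<alpha>: "\<alpha> \<in> dual_space t" "e \<in> ad.wspace \<alpha>" "e \<noteq> 0"
    and b: "b \<in> B"
  shows "\<exists>r::real. wt b (tdual \<alpha>) = of_real r * \<alpha> (tdual \<alpha>)"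
proof -
  note BD = weight_basisD[OF B]
  obtain f where f: "f \<in> ad.wspace (\<lambda>x. - \<alpha> x)" "K e f = 1"
    using opposite_exists[OF \<alpha>] by blast
  have ef: "br e f = tdual \<alpha>" using br_opposite[OF \<alpha>(1,2) f(1)] f(2) by (simp add: scaleC_one)
  define s where "s n = (\<lambda>x. wt b x + of_int n * \<alpha> x)" for n :: int
  define C where "C = {c \<in> B. wt c \<in> range s}"
  have s_dual: "s n \<in> dual_space t" for n
    unfolding s_def using BD(4)[OF b] \<alpha>(1) by (intro dual_space_ops)
  have in_span: "x \<in> cvec.span C" if "x \<in> ad.wspace (s n)" for x n
  proof -
    have "x \<in> cvec.span {b \<in> B. wt b = s n}" using that wspace_eq_span[OF B s_dual] by blast
    also have "\<dots> \<subseteq> cvec.span C" by (rule cvec.span_mono) (auto simp: C_def)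
    finally show ?thesis .
  qed
  have "\<exists>n. \<forall>c\<in>C. wt c = s (n c)" unfolding C_def by (intro bchoice) auto
  then obtain n where n: "\<And>c. c \<in> C \<Longrightarrow> wt c = s (n c)" by blast
  have C: "finite C" "cvec.independent C" "C \<subseteq> B"
    using BD cvec.independent_mono[of B C] by (auto simp: C_def)
  have "(\<Sum>c\<in>C. wt c (tdual \<alpha>)) = 0"
  proof (rule trace_commutator_zero[OF C(1,2) br_linear_right[of e] br_linear_right[of f]])
    fix c assume c: "c \<in> C"
    have w: "c \<in> ad.wspace (s (n c))" using BD(5)[of c] C(3) c n[OF c] by auto
    have "br e c \<in> ad.wspace (s (n c + 1))" "br f c \<in> ad.wspace (s (n c - 1))"
      using wspace_br[OF \<alpha>(2) w] wspace_br[OF f(1) w] by (simp_all add: s_def algebra_simps)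
    then show "br e c \<in> cvec.span C" "br f c \<in> cvec.span C" by (blast intro: in_span)+
    show "br e (br f c) - br f (br e c) = wt c (tdual \<alpha>) *\<^sub>C c"
      using w tdual(1)[OF \<alpha>(1)] c by (simp add: br_br[symmetric] ef ad.wspace_def n)
  qed
  moreover have "wt c (tdual \<alpha>) = wt b (tdual \<alpha>) + of_int (n c) * \<alpha> (tdual \<alpha>)" if "c \<in> C" for c
    using n[OF that] by (simp add: s_def)
  ultimately have eq: "of_nat (card C) * wt b (tdual \<alpha>) + of_int (\<Sum>c\<in>C. n c) * \<alpha> (tdual \<alpha>) = 0"
    by (simp add: sum.distrib sum_distrib_right)
  have "wt b = s 0" by (simp add: s_def)
  then have "b \<in> C" using b by (auto simp: C_def)
  then have "card C > 0" using C(1) card_gt_0_iff by blast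
  then have "wt b (tdual \<alpha>) = of_real (- of_int (\<Sum>c\<in>C. n c) / of_nat (card C)) * \<alpha> (tdual \<alpha>)"
    using eq by (simp add: field_simps add_eq_0_iff)
  then show ?thesis by blast
qed

text \<open>Write \<open>H = tdual \<alpha>\<close> and \<open>wt b H = r b * \<alpha> H\<close>
  with real \<open>r b\<close>. The trace formula gives
  \<open>\<alpha> H = (\<Sum> (r b)^2) * (\<alpha> H)^2\<close>, so that \<open>\<alpha> H\<close>
  is real unless it is 0; in that case all weights vanish at \<open>H\<close> and the formula forces
  \<alpha> to be 0.\<close>

lemma root_norm_real:
  assumes B: "weight_basis B wt" and \<alpha>: "\<alpha> \<in> dual_space t" "\<alpha> \<noteq> (\<lambda>_. 0)" "e \<in> ad.wspace \<alpha>" "e \<noteq> 0"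
  shows "\<alpha> (tdual \<alpha>) \<noteq> 0" "\<And>b. b \<in> B \<Longrightarrow> wt b (tdual \<alpha>) \<in> \<real>"
proof -
  obtain r :: "'g \<Rightarrow> real" where r: "\<And>b. b \<in> B \<Longrightarrow> wt b (tdual \<alpha>) = of_real (r b) * \<alpha> (tdual \<alpha>)"
    using bchoice[of B "\<lambda>b r. wt b (tdual \<alpha>) = of_real r * \<alpha> (tdual \<alpha>)"] root_string[OF B \<alpha>(1,3,4)] by blast
  let ?a = "\<alpha> (tdual \<alpha>)"
  have ta: "tdual \<alpha> \<in> t" by (rule tdual[OF \<alpha>(1)])
  show nz: "?a \<noteq> 0"
  proof
    assume "?a = 0"
    then have "\<alpha> y = 0" if "y \<in> t" for y
      using tdual(2)[OF \<alpha>(1) that] K_t_formula[OF B ta that] r by simp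
    then show False using \<alpha>(2) dual_spaceD(3)[OF \<alpha>(1)] by blast
  qed
  have "?a = K (tdual \<alpha>) (tdual \<alpha>)" using tdual[OF \<alpha>(1)] by simp
  also have "\<dots> = of_real (\<Sum>b\<in>B. (r b)\<^sup>2) * ?a * ?a"
    unfolding K_t_formula[OF B ta ta] of_real_sum sum_distrib_right
    by (rule sum.cong) (simp_all add: r power2_eq_square)
  finally have "of_real (\<Sum>b\<in>B. (r b)\<^sup>2) * ?a = 1" using nz by (metis mult_cancel_right1 mult.assoc)
  then have "?a = of_real (1 / (\<Sum>b\<in>B. (r b)\<^sup>2))" using nz
    by (metis nonzero_eq_divide_eq mult.commute mult_zero_left of_real_1 of_real_divide zero_neq_one)
  then show "wt b (tdual \<alpha>) \<in> \<real>" if "b \<in> B" for b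
    using r[OF that] by (metis Reals_mult Reals_of_real)
qed

text \<open>The trace of \<open>H = [e, f]\<close> vanishes on the span of \<open>f\<close>, \<open>H\<close> and the root spaces of \<open>n \<alpha>\<close> for
  \<open>n \<ge> 1\<close>.  Since \<open>\<alpha> H \<noteq> 0\<close>, this says that the sum of \<open>n\<close> times the dimension of the root
  space of \<open>n \<alpha>\<close> is \<open>1\<close>.\<close>

lemma root_space_dim1:
  assumes \<alpha>: "\<alpha> \<in> dual_space t" "\<alpha> \<noteq> (\<lambda>_. 0)" and e: "e \<in> ad.wspace \<alpha>" "e \<noteq> 0"
  shows "ad.wspace \<alpha> = cvec.span {e}"
proof -
  obtain f where f: "f \<in> ad.wspace (\<lambda>x. - \<alpha> x)" "K e f = 1"
    using opposite_exists[OF \<alpha>(1) e] by blast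
  define H where "H = tdual \<alpha>"
  have ef: "br e f = H" using br_opposite[OF \<alpha>(1) e(1) f(1)] f(2) by (simp add: H_def scaleC_one)
  have Ht: "H \<in> t" unfolding H_def by (rule tdual[OF \<alpha>(1)])
  obtain B0 wt0 where "weight_basis B0 wt0"
    by (rule weight_basis_extend[of "{}"]) (auto simp: cvec.independent_empty)
  from root_norm_real(1)[OF this \<alpha> e] have aH: "\<alpha> H \<noteq> 0" by (simp add: H_def)
  have f0: "f \<noteq> 0" using f(2) by auto
  have H0: "H \<noteq> 0" using aH dual_spaceD(2)[OF \<alpha>(1) Ht, of 0] by auto
  have fH: "br H f = - \<alpha> H *\<^sub>C f" using f(1) Ht by (simp add: ad.wspace_def)
  have ft: "f \<notin> t" using fH aH f0 t_abel[OF Ht] by auto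
  have ind: "cvec.independent {f, H}"
  proof -
    have "cvec.span {H} \<subseteq> t" by (rule cvec.span_minimal) (use Ht t_subspace in auto)
    then show ?thesis using ft H0 by (auto simp: cvec.independent_insert)
  qed
  have fHw: "{f, H} \<subseteq> (\<Union>\<alpha>\<in>dual_space t. ad.wspace \<alpha>)"
    using f(1) Ht dual_space_ops(1) dual_space_ops(2)[OF \<alpha>(1)] wspace_zero by blast
  \<comment> \<open>The trace is taken over a subset of one basis of weight vectors, so
    \<open>f\<close> and \<open>H\<close> have to be put into that basis beforehand.\<close>
  obtain B wt where B: "weight_basis B wt" "{f, H} \<subseteq> B"
    using weight_basis_extend[OF fHw ind] by blast
  note BD = weight_basisD[OF B(1)]
  define s where "s n = (\<lambda>x. of_nat n * \<alpha> x)" for n :: nat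
  define C where "C = {c \<in> B. \<exists>n\<ge>1. wt c = s n}"
  have s_dual: "s n \<in> dual_space t" for n
    unfolding s_def using \<alpha>(1) by (rule dual_space_ops)
  have s1: "s 1 = \<alpha>" by (simp add: s_def)
  have in_span: "x \<in> cvec.span (insert f (insert H C))" if "x \<in> ad.wspace (s n)" "n \<ge> 1" for x n
  proof -
    have "x \<in> cvec.span {b \<in> B. wt b = s n}" using that wspace_eq_span[OF B(1) s_dual] by blast
    also have "\<dots> \<subseteq> cvec.span (insert f (insert H C))" by (rule cvec.span_mono) (use that in \<open>auto simp: C_def\<close>)
    finally show ?thesis .
  qed
  have "\<exists>n. \<forall>c\<in>C. n c \<ge> 1 \<and> wt c = s (n c)" unfolding C_def by (intro bchoice) auto
  then obtain n where n: "\<And>c. c \<in> C \<Longrightarrow> n c \<ge> 1" "\<And>c. c \<in> C \<Longrightarrow> wt c = s (n c)" by blast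
  have wC: "c \<in> ad.wspace (s (n c))" if "c \<in> C" for c
  proof -
    have "c \<in> B" using that by (simp add: C_def)
    from BD(5)[OF this] show ?thesis unfolding n(2)[OF that] .
  qed
  have C: "finite C" "C \<subseteq> B" using BD by (auto simp: C_def)
  have brH: "br H c = (of_nat (n c) * \<alpha> H) *\<^sub>C c" if "c \<in> C" for c
    using wC[OF that] Ht by (simp add: ad.wspace_def s_def)
  have cn0: "c \<noteq> 0" if "c \<in> C" for c
    using that C BD(2) cvec.dependent_zero by blast
  have fC: "f \<notin> C"
  proof
    assume "f \<in> C"
    then have "(of_nat (n f) * \<alpha> H) *\<^sub>C f = (- \<alpha> H) *\<^sub>C f" using brH fH by metis
    then have "(of_nat (n f) + 1) * \<alpha> H = 0" using f0 by (simp add: algebra_simps del: cvec.scale_minus_left)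
    then show False using aH by (simp add: of_nat_Suc[symmetric] add.commute del: of_nat_Suc)
  qed
  have HC: "H \<notin> C"
  proof
    assume "H \<in> C"
    then have "(of_nat (n H) * \<alpha> H) *\<^sub>C H = 0" using brH[of H] by (simp add: br_self)
    then show False using H0 aH n(1)[OF \<open>H \<in> C\<close>] by simp
  qed
  define w where "w c = (if c = f then - \<alpha> H else if c = H then 0 else of_nat (n c) * \<alpha> H)" for c
  have fne: "f \<noteq> H" using ft Ht by blast
  let ?C = "insert f (insert H C)"
  have "(\<Sum>c\<in>?C. w c) = 0"
  proof (rule trace_commutator_zero[OF _ _ br_linear_right[of e] br_linear_right[of f]])
    show "finite ?C" using C by simp
    show "cvec.independent ?C" by (rule cvec.independent_mono[OF BD(2)]) (use B(2) C in auto)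
    show "br e c \<in> cvec.span ?C" if c: "c \<in> ?C" for c
    proof -
      consider "c = f" | "c = H" | "c \<in> C" using c by blast
      then show ?thesis
      proof cases
        case 1
        then show ?thesis by (simp add: ef cvec.span_base)
      next
        case 2
        have "br e H = - \<alpha> H *\<^sub>C e" using e(1) Ht br_anti[of e H] by (simp add: ad.wspace_def)
        then show ?thesis
          using 2 in_span[of e 1] e(1) s1 by (simp add: cvec.span_scale cvec.span_neg)
      next
        case 3
        show ?thesis
          by (rule in_span[of _ "Suc (n c)"])
             (use wspace_br[OF e(1) wC[OF 3]] in \<open>auto simp: s_def algebra_simps\<close>)
      qed
    qed
    show "br f c \<in> cvec.span ?C" if c: "c \<in> ?C" for c
    proof -
      consider "c = f" | "c = H" | "c \<in> C" using c by blast
      then show ?thesis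
      proof cases
        case 1
        then show ?thesis by (simp add: br_self cvec.span_zero)
      next
        case 2
        have "br f H = \<alpha> H *\<^sub>C f" using fH br_anti[of f H] by simp
        then show ?thesis using 2 by (simp add: cvec.span_base cvec.span_scale)
      next
        case 3
        show ?thesis
        \<comment> \<open>\<open>f\<close> lowers \<open>n \<alpha>\<close> to
          \<open>(n - 1) \<alpha>\<close>. For \<open>n = 1\<close> the result lies in
          \<open>t\<close>, where \<open>br_opposite\<close> makes it a multiple of
          \<open>H\<close>; thus one vector of \<open>t\<close> is enough to close the
          subspace.\<close>
        proof (cases "n c = 1")
          case True
          then have "c \<in> ad.wspace \<alpha>" using wC[OF 3] s1 by simp
          then have "br f c = (- K c f) *\<^sub>C H"
            using br_opposite[OF \<alpha>(1) _ f(1), of c] br_anti[of f c] by (simp add: H_def)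
          then show ?thesis by (simp add: cvec.span_base cvec.span_scale cvec.span_neg)
        next
          case False
          then obtain m where m: "n c = Suc m" "m \<ge> 1" using n(1)[OF 3] by (cases "n c") auto
          show ?thesis
            by (rule in_span[of _ m]) (use wspace_br[OF f(1) wC[OF 3]] m in \<open>auto simp: s_def algebra_simps\<close>)
        qed
      qed
    qed
    show "br e (br f c) - br f (br e c) = w c *\<^sub>C c" if c: "c \<in> ?C" for c
      using c fC HC fne by (auto simp: br_br[symmetric] ef w_def fH brH br_self)
  qed
  moreover have "(\<Sum>c\<in>?C. w c) = - \<alpha> H + (\<Sum>c\<in>C. of_nat (n c) * \<alpha> H)"
  proof -
    have "(\<Sum>c\<in>C. w c) = (\<Sum>c\<in>C. of_nat (n c) * \<alpha> H)"
      by (rule sum.cong) (use fC HC in \<open>auto simp: w_def\<close>)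
    then show ?thesis using C(1) fC HC fne by (simp add: w_def)
  qed
  ultimately have "\<alpha> H * of_nat (\<Sum>c\<in>C. n c) = \<alpha> H * 1"
    by (simp add: sum_distrib_left algebra_simps)
  then have n1: "(\<Sum>c\<in>C. n c) = 1"
    using aH by (metis mult_cancel_left of_nat_eq_1_iff)
  define A where "A = {b \<in> B. wt b = \<alpha>}"
  have A: "A \<subseteq> C" unfolding A_def C_def using s1 by auto
  have wA: "ad.wspace \<alpha> = cvec.span A" unfolding A_def by (rule wspace_eq_span[OF B(1) \<alpha>(1)])
  have "card C \<le> 1"
    using sum_mono[of C "\<lambda>_. 1" n] n(1) n1 by simp
  then have "card A \<le> 1" using card_mono[OF C(1) A] by simp
  moreover have "A \<noteq> {}" using wA e by auto
  ultimately obtain a where a: "A = {a}"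
  proof -
    have "card A \<noteq> 0" using \<open>A \<noteq> {}\<close> finite_subset[OF A C(1)] by simp
    then have "card A = 1" using \<open>card A \<le> 1\<close> by linarith
    then show ?thesis using that card_1_singletonE by blast
  qed
  then obtain r where r: "e = r *\<^sub>C a" using e(1) wA by (auto simp: cvec.span_singleton)
  then have "r \<noteq> 0" using e(2) by auto
  then have "a = (1 / r) *\<^sub>C e" using r by (simp add: scaleC_scaleC scaleC_one)
  then have "a \<in> cvec.span {e}" by (metis cvec.span_base cvec.span_scale insertI1)
  then have "cvec.span A \<subseteq> cvec.span {e}" unfolding a by (intro cvec.span_minimal) auto
  moreover have "cvec.span {e} \<subseteq> cvec.span A"
    using e(1) wA by (intro cvec.span_minimal) auto
  ultimately show ?thesis using wA by blast
qed

text \<open>Both projections commute with \<open>t\<close>, since \<open>h\<close> and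
  \<open>q\<close> are stable under it and meet only in 0.\<close>

lemma wspace_components:
  assumes "x \<in> ad.wspace \<alpha>" "x = a + c" "a \<in> h" "c \<in> q"
  shows "a \<in> ad.wspace \<alpha>" "c \<in> ad.wspace \<alpha>"
proof -
  have *: "br y a = \<alpha> y *\<^sub>C a \<and> br y c = \<alpha> y *\<^sub>C c" if y: "y \<in> t" for y
  proof -
    have yh: "y \<in> h" using y t_h by blast
    let ?a = "br y a - \<alpha> y *\<^sub>C a" and ?c = "br y c - \<alpha> y *\<^sub>C c"
    have "br y a + br y c = \<alpha> y *\<^sub>C a + \<alpha> y *\<^sub>C c"
      using assms(1) y unfolding assms(2) by (simp add: ad.wspace_def br_simps scaleC_add_right)
    then have "?a + ?c = 0" by (simp add: algebra_simps)
    moreover have ah: "?a \<in> h" using h_br[OF yh assms(3)] assms(3) h_subspace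
      by (simp add: cvec.subspace_diff cvec.subspace_scale)
    moreover have cq: "?c \<in> q" using q_br[OF yh assms(4)] assms(4) q_subspace
      by (simp add: cvec.subspace_diff cvec.subspace_scale)
    ultimately have "?a \<in> q" using cvec.subspace_neg[OF q_subspace cq] by (metis add_eq_0_iff2)
    then have "?a = 0" using ah hq_zero by blast
    with \<open>?a + ?c = 0\<close> show ?thesis by simp
  qed
  then show "a \<in> ad.wspace \<alpha>" "c \<in> ad.wspace \<alpha>" by (simp_all add: ad.wspace_def)
qed

text \<open>A nonzero component of a root vector in \<open>h\<close> or in \<open>q\<close> has the
  same weight, and therefore spans the one-dimensional root space.\<close>

lemma root_space_h_or_q:
  assumes \<alpha>: "\<alpha> \<in> dual_space t" "\<alpha> \<noteq> (\<lambda>_. 0)"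
  shows "ad.wspace \<alpha> \<subseteq> h \<or> ad.wspace \<alpha> \<subseteq> q"
proof (cases "ad.wspace \<alpha> \<subseteq> {0}")
  case True
  then show ?thesis using cvec.subspace_0[OF h_subspace] by blast
next
  case False
  then obtain e where e: "e \<in> ad.wspace \<alpha>" "e \<noteq> 0" by blast
  obtain a c where ac: "a \<in> h" "c \<in> q" "e = a + c" by (rule hq_decomp)
  have w: "a \<in> ad.wspace \<alpha>" "c \<in> ad.wspace \<alpha>" using wspace_components[OF e(1) ac(3,1,2)] by auto
  show ?thesis
  proof (cases "a = 0")
    case True
    then have "c \<noteq> 0" using ac e by simp
    then have "ad.wspace \<alpha> = cvec.span {c}" by (rule root_space_dim1[OF \<alpha> w(2)])
    also have "\<dots> \<subseteq> q" by (rule cvec.span_minimal) (use ac q_subspace in auto)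
    finally show ?thesis by blast
  next
    case False
    have "ad.wspace \<alpha> = cvec.span {a}" by (rule root_space_dim1[OF \<alpha> w(1) False])
    also have "\<dots> \<subseteq> h" by (rule cvec.span_minimal) (use ac h_subspace in auto)
    finally show ?thesis by blast
  qed
qed

end

section \<open>Positive systems\<close>

context dirac_pair
begin

text \<open>Fourier--Motzkin elimination of the element \<open>a\<close>: if \<open>y\<close> is positive on the other elements but
  not on \<open>a\<close>, each of them is replaced by its positive combination with \<open>a\<close> that vanishes at \<open>y\<close>.\<close>

lemma positive_functional:
  assumes P: "P \<subseteq> dual_space t" "(\<lambda>_. 0) \<notin> P"
    and add: "\<And>\<phi> \<psi>. \<phi> \<in> P \<Longrightarrow> \<psi> \<in> P \<Longrightarrow> (\<lambda>x. \<phi> x + \<psi> x) \<in> P"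
    and scale: "\<And>\<phi> r. \<phi> \<in> P \<Longrightarrow> r > 0 \<Longrightarrow> (\<lambda>x. complex_of_real r * \<phi> x) \<in> P"
    and A: "finite A" "A \<subseteq> P"
  shows "\<exists>x\<in>t. \<forall>\<phi>\<in>A. Re (\<phi> x) > 0"
proof -
  have "\<forall>A. finite A \<and> card A \<le> n \<and> A \<subseteq> P \<longrightarrow> (\<exists>x\<in>t. \<forall>\<phi>\<in>A. Re (\<phi> x) > 0)" for n
  proof (induction n)
    case 0
    show ?case using cvec.subspace_0[OF t_subspace] by auto
  next
    case (Suc n)
    show ?case
    proof (intro allI impI)
      fix A assume A: "finite A \<and> card A \<le> Suc n \<and> A \<subseteq> P"
      show "\<exists>x\<in>t. \<forall>\<phi>\<in>A. Re (\<phi> x) > 0"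
      proof (cases "A = {}")
        case True
        then show ?thesis using cvec.subspace_0[OF t_subspace] by auto
      next
        case False
        then obtain a where a: "a \<in> A" by blast
        define A' where "A' = A - {a}"
        have A': "finite A'" "card A' \<le> n" "A' \<subseteq> P" "A = insert a A'"
          using A a by (auto simp: A'_def)
        then obtain y where y: "y \<in> t" "\<And>\<phi>. \<phi> \<in> A' \<Longrightarrow> Re (\<phi> y) > 0" using Suc.IH by meson
        have aP: "a \<in> P" using A a by blast
        have lin: "Re (\<phi> (complex_of_real r *\<^sub>C u + v)) = r * Re (\<phi> u) + Re (\<phi> v)"
          if "\<phi> \<in> P" "u \<in> t" "v \<in> t" for \<phi> r u v
          using that P(1) dual_spaceD[of \<phi>] cvec.subspace_scale[OF t_subspace] by auto
        have mem: "complex_of_real r *\<^sub>C u + v \<in> t" if "u \<in> t" "v \<in> t" for r u v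
          using that t_subspace cvec.subspace_add cvec.subspace_scale by metis
        consider "Re (a y) > 0" | "Re (a y) = 0" | "Re (a y) < 0" by linarith
        then show ?thesis
        proof cases
          case 1
          then show ?thesis using y A'(4) by blast
        next
          case 2
          have "a \<noteq> (\<lambda>_. 0)" using aP P(2) by blast
          then obtain z where z: "a z \<noteq> 0" by blast
          then have zt: "z \<in> t" using dual_spaceD(3) P(1) aP by blast
          \<comment> \<open>The conjugate factor turns the value of \<open>a\<close> at
            \<open>m\<close> into the positive number |a z|^2.\<close>
          define m where "m = cnj (a z) *\<^sub>C z"
          have m: "m \<in> t" unfolding m_def using zt t_subspace cvec.subspace_scale by blast
          have "a m = cnj (a z) * a z" unfolding m_def using dual_spaceD(2) P(1) aP zt by blast
          then have am: "Re (a m) > 0" using z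
            by (metis Re_complex_of_real complex_norm_square mult.commute norm_eq_zero of_real_power zero_less_norm_iff zero_less_power)
          \<comment> \<open>A multiple of \<open>y\<close> large enough to outweigh \<open>m\<close>
            on all of \<open>A'\<close>; since \<open>Re (a y) = 0\<close>, it does not disturb the
            positive value at \<open>a\<close>.\<close>
          define R where "R = 1 + (\<Sum>\<phi>\<in>A'. \<bar>Re (\<phi> m)\<bar> / Re (\<phi> y))"
          have "Re (\<phi> (complex_of_real R *\<^sub>C y + m)) > 0" if "\<phi> \<in> A'" for \<phi>
          proof -
            have "\<bar>Re (\<phi> m)\<bar> / Re (\<phi> y) \<le> (\<Sum>\<phi>\<in>A'. \<bar>Re (\<phi> m)\<bar> / Re (\<phi> y))"
              by (rule member_le_sum[OF that]) (use A' y in \<open>auto intro!: divide_nonneg_nonneg simp: less_imp_le\<close>)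
            then have "\<bar>Re (\<phi> m)\<bar> / Re (\<phi> y) < R" by (simp add: R_def)
            then have "\<bar>Re (\<phi> m)\<bar> < R * Re (\<phi> y)" using y(2)[OF that] by (simp add: field_simps)
            then show ?thesis using lin[of \<phi> y m R] that A'(3) y(1) m by auto
          qed
          moreover have "Re (a (complex_of_real R *\<^sub>C y + m)) > 0"
            using lin[OF aP y(1) m, of R] 2 am by simp
          ultimately show ?thesis using mem[OF y(1) m] A'(4) by blast
        next
          case 3
          define k where "k = - Re (a y)"
          have k: "k > 0" using 3 by (simp add: k_def)
          define g where "g \<phi> = (\<lambda>x. complex_of_real k * \<phi> x + complex_of_real (Re (\<phi> y)) * a x)" for \<phi> :: "'g \<Rightarrow> complex"
          have "g ` A' \<subseteq> P" unfolding g_def using A'(3) aP y(2) k by (auto intro!: add scale)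
          moreover have "card (g ` A') \<le> n" using card_image_le[OF A'(1), of g] A'(2) by linarith
          ultimately obtain z where z: "z \<in> t" "\<And>\<phi>. \<phi> \<in> A' \<Longrightarrow> Re (g \<phi> z) > 0"
            using Suc.IH A'(1) by (meson finite_imageI image_eqI)
          \<comment> \<open>The coefficient \<open>c\<close> of \<open>y\<close> has to exceed every
            quotient in this set and to stay below \<open>Re (a z) / k\<close>. The inserted element
            keeps the set nonempty and is itself below that bound.\<close>
          let ?lo = "insert (Re (a z) / k - 1) ((\<lambda>\<phi>. - Re (\<phi> z) / Re (\<phi> y)) ` A')"
          have fin: "finite ?lo" "?lo \<noteq> {}" using A'(1) by auto
          have "- Re (\<phi> z) / Re (\<phi> y) < Re (a z) / k" if "\<phi> \<in> A'" for \<phi>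
          proof -
            have "k * Re (\<phi> z) + Re (\<phi> y) * Re (a z) > 0" using z(2)[OF that] by (simp add: g_def)
            then show ?thesis using y(2)[OF that] k by (simp add: field_simps)
          qed
          then have "Max ?lo < Re (a z) / k" using fin by (subst Max_less_iff) auto
          then obtain c where c: "Max ?lo < c" "c < Re (a z) / k" using dense by blast
          have "Re (\<phi> (complex_of_real c *\<^sub>C y + z)) > 0" if "\<phi> \<in> A'" for \<phi>
          proof -
            have "- Re (\<phi> z) / Re (\<phi> y) \<le> Max ?lo" using fin that by (intro Max_ge) auto
            then have "- Re (\<phi> z) / Re (\<phi> y) < c" using c by simp
            then have "- Re (\<phi> z) < c * Re (\<phi> y)" using y(2)[OF that] by (simp add: field_simps)
            then show ?thesis using lin[of \<phi> y z c] that A'(3) y(1) z by auto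
          qed
          moreover have "Re (a (complex_of_real c *\<^sub>C y + z)) > 0"
          proof -
            have "c * k < Re (a z)" using c(2) k by (simp add: field_simps)
            then show ?thesis using lin[OF aP y(1) z(1), of c] by (simp add: k_def)
          qed
          ultimately show ?thesis using mem[OF y(1) z(1)] A'(4) by blast
        qed
      qed
    qed
  qed
  then show ?thesis using A by blast
qed

section \<open>A fixed basis of weight vectors, adapted to \<open>h\<close> and
  \<open>q\<close>\<close>

definition RB :: "'g set" where "RB = (SOME B. \<exists>wt. weight_basis B wt)"
definition wt :: "'g \<Rightarrow> 'g \<Rightarrow> complex" where "wt = (SOME wt. weight_basis RB wt)"

lemma RB: "weight_basis RB wt"
proof -
  obtain B wt where "weight_basis B wt"
    by (rule weight_basis_extend[of "{}"]) (auto simp: cvec.independent_empty)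
  then have "\<exists>B wt. weight_basis B wt" by blast
  from someI_ex[OF this, folded RB_def] show ?thesis unfolding wt_def by (rule someI_ex)
qed

lemmas RBD = weight_basisD[OF RB]

lemma RB_nonzero: "b \<in> RB \<Longrightarrow> b \<noteq> 0"
  using RBD(2) cvec.dependent_zero by blast

lemma RB_zero_t: "b \<in> RB \<Longrightarrow> wt b = (\<lambda>_. 0) \<Longrightarrow> b \<in> t"
  using RBD(5)[of b] wspace_zero by simp

lemma RB_h_or_q: "b \<in> RB \<Longrightarrow> b \<in> h \<or> b \<in> q"
  using root_space_h_or_q[OF RBD(4)[of b]] RBD(5)[of b] RB_zero_t[of b] t_h
  by (cases "wt b = (\<lambda>_. 0)") auto

lemma RB_part_span:
  assumes V: "cvec.subspace V" "cvec.subspace W" "V \<inter> W \<subseteq> {0}" and RB: "RB \<subseteq> V \<union> W"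
  shows "cvec.span (RB \<inter> V) = V"
proof
  show "cvec.span (RB \<inter> V) \<subseteq> V" by (rule cvec.span_minimal) (use V in auto)
  show "V \<subseteq> cvec.span (RB \<inter> V)"
  proof
    fix x assume x: "x \<in> V"
    have "x \<in> cvec.span RB" by (simp add: RBD(3))
    then have "x \<in> cvec.span ((RB \<inter> V) \<union> (RB \<inter> W))" using RB by (simp add: Int_Un_distrib[symmetric] Int_absorb2)
    then obtain v w where vw: "x = v + w" "v \<in> cvec.span (RB \<inter> V)" "w \<in> cvec.span (RB \<inter> W)"
      unfolding cvec.span_Un by auto
    have "v \<in> V" using vw(2) cvec.span_minimal[of "RB \<inter> V" V] V by blast
    moreover have "w \<in> W" using vw(3) cvec.span_minimal[of "RB \<inter> W" W] V by blast
    moreover have "w = x - v" using vw(1) by simp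
    ultimately have "w = 0" using x V cvec.subspace_diff by blast
    then show "x \<in> cvec.span (RB \<inter> V)" using vw by simp
  qed
qed

lemma h_span: "cvec.span (RB \<inter> h) = h"
  by (rule RB_part_span[OF h_subspace q_subspace]) (use hq_zero RB_h_or_q in auto)

lemma q_span: "cvec.span (RB \<inter> q) = q"
  by (rule RB_part_span[OF q_subspace h_subspace]) (use hq_zero RB_h_or_q in auto)

lemma RB_q_nonzero_wt: "b \<in> RB \<Longrightarrow> b \<in> q \<Longrightarrow> wt b \<noteq> (\<lambda>_. 0)"
  using RBD(5)[of b] wspace_zero t_h hq_zero[of b] RB_nonzero[of b] by auto

lemma roots_eq: "\<alpha> \<in> roots br t UNIV \<longleftrightarrow> \<alpha> \<noteq> (\<lambda>_. 0) \<and> \<alpha> \<in> wt ` RB"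
proof
  assume \<alpha>: "\<alpha> \<in> roots br t UNIV"
  then have d: "\<alpha> \<in> dual_space t" "\<alpha> \<noteq> (\<lambda>_. 0)" "ad.wspace \<alpha> \<noteq> {0}"
    unfolding roots_def root_space_eq by auto
  have "{b \<in> RB. wt b = \<alpha>} \<noteq> {}"
    using d(3) wspace_eq_span[OF RB d(1)] by (metis cvec.span_empty)
  then show "\<alpha> \<noteq> (\<lambda>_. 0) \<and> \<alpha> \<in> wt ` RB" using d by blast
next
  assume "\<alpha> \<noteq> (\<lambda>_. 0) \<and> \<alpha> \<in> wt ` RB"
  then show "\<alpha> \<in> roots br t UNIV"
    unfolding roots_def root_space_eq using RBD(4,5) RB_nonzero by auto
qed

lemma finite_roots: "finite (roots br t UNIV)"
  using roots_eq RBD(1) by (metis finite_imageI finite_subset subsetI)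

lemma root_neg: "\<alpha> \<in> roots br t UNIV \<Longrightarrow> (\<lambda>x. - \<alpha> x) \<in> roots br t UNIV"
proof -
  assume \<alpha>: "\<alpha> \<in> roots br t UNIV"
  then have d: "\<alpha> \<in> dual_space t" "\<alpha> \<noteq> (\<lambda>_. 0)" "ad.wspace \<alpha> \<noteq> {0}"
    unfolding roots_def root_space_eq by auto
  obtain e where e: "e \<in> ad.wspace \<alpha>" "e \<noteq> 0" using d(3) cvec.subspace_0[OF ad.wspace_subspace] by blast
  obtain f where f: "f \<in> ad.wspace (\<lambda>x. - \<alpha> x)" "K e f = 1" by (rule opposite_exists[OF d(1) e])
  have "f \<noteq> 0" using f(2) by auto
  moreover have "(\<lambda>x. - \<alpha> x) \<noteq> (\<lambda>_. 0)" using d(2) by (auto simp: fun_eq_iff)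
  ultimately show ?thesis using dual_space_ops(2)[OF d(1)] f(1) unfolding roots_def root_space_eq by blast
qed

lemma root_in_real_span: "\<alpha> \<in> roots br t UNIV \<Longrightarrow> \<alpha> \<in> real_root_span br t"
proof -
  assume \<alpha>: "\<alpha> \<in> roots br t UNIV"
  have "(\<Sum>\<beta>\<in>roots br t UNIV. complex_of_real (if \<beta> = \<alpha> then 1 else 0) * \<beta> x) = \<alpha> x" for x
  proof -
    have "(\<Sum>\<beta>\<in>roots br t UNIV. complex_of_real (if \<beta> = \<alpha> then 1 else 0) * \<beta> x) =
        (\<Sum>\<beta>\<in>roots br t UNIV. if \<beta> = \<alpha> then \<beta> x else 0)"
      by (rule sum.cong) auto
    then show ?thesis using \<alpha> finite_roots by simp
  qed
  then show ?thesis unfolding real_root_span_def by (intro CollectI exI[of _ "\<lambda>\<beta>. if \<beta> = \<alpha> then 1 else 0"]) auto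
qed

lemma real_span_dual: "real_root_span br t \<subseteq> dual_space t"
  unfolding real_root_span_def by (auto simp: roots_def intro!: dual_space_sum dual_space_ops)

end

section \<open>Positive and negative root vectors\<close>

locale dirac_setting = dirac_pair br h t Z
  for br :: "'g::complex_vec \<Rightarrow> 'g \<Rightarrow> 'g" and h t Z +
  fixes Dp :: "('g \<Rightarrow> complex) set"
  assumes pos: "positive_system br t Dp"
begin

lemma Dp_props:
  shows Dp_roots: "Dp \<subseteq> roots br t UNIV"
    and Dp_sign: "\<And>\<alpha>. \<alpha> \<in> roots br t UNIV \<Longrightarrow> (\<alpha> \<in> Dp) \<noteq> ((\<lambda>x. - \<alpha> x) \<in> Dp)"
    and Dp_functional: "\<exists>x\<in>t. \<forall>\<alpha>\<in>Dp. Re (\<alpha> x) > 0"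
proof -
  obtain P where P: "P \<subseteq> real_root_span br t"
    "\<forall>\<phi>\<in>real_root_span br t. \<phi> \<noteq> (\<lambda>_. 0) \<longrightarrow> (\<phi> \<in> P) \<noteq> ((\<lambda>x. - \<phi> x) \<in> P)"
    "(\<lambda>_. 0) \<notin> P" "\<forall>\<phi>\<in>P. \<forall>\<psi>\<in>P. (\<lambda>x. \<phi> x + \<psi> x) \<in> P"
    "\<forall>\<phi>\<in>P. \<forall>r::real. r > 0 \<longrightarrow> (\<lambda>x. complex_of_real r * \<phi> x) \<in> P"
    "Dp = roots br t UNIV \<inter> P"
    using pos unfolding positive_system_def by auto
  show "Dp \<subseteq> roots br t UNIV" using P(6) by blast
  show "(\<alpha> \<in> Dp) \<noteq> ((\<lambda>x. - \<alpha> x) \<in> Dp)" if \<alpha>: "\<alpha> \<in> roots br t UNIV" for \<alpha>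
    using P(2,6) root_in_real_span[OF \<alpha>] root_neg[OF \<alpha>] \<alpha> by (auto simp: roots_def)
  show "\<exists>x\<in>t. \<forall>\<alpha>\<in>Dp. Re (\<alpha> x) > 0"
    by (rule positive_functional[of P])
       (use P real_span_dual finite_roots in auto)
qed

text \<open>\<open>Re (\<mu> x0)\<close> serves as the height of a weight: positive root vectors
  raise it, negative ones lower it. Word lengths are bounded and the descending induction is run by
  means of this height.\<close>

definition x0 :: 'g where "x0 = (SOME x. x \<in> t \<and> (\<forall>\<alpha>\<in>Dp. Re (\<alpha> x) > 0))"

lemma x0: "x0 \<in> t" "\<And>\<alpha>. \<alpha> \<in> Dp \<Longrightarrow> Re (\<alpha> x0) > 0"
proof -
  have "\<exists>x. x \<in> t \<and> (\<forall>\<alpha>\<in>Dp. Re (\<alpha> x) > 0)" using Dp_functional by blast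
  note P = someI_ex[OF this, folded x0_def]
  show "x0 \<in> t" using P by (rule conjunct1)
  show "Re (\<alpha> x0) > 0" if "\<alpha> \<in> Dp" for \<alpha> using conjunct2[OF P] that by (rule bspec)
qed

definition Epos :: "'g set" where "Epos = {b \<in> RB. wt b \<in> Dp}"
definition Eneg :: "'g set" where "Eneg = {b \<in> RB. (\<lambda>x. - wt b x) \<in> Dp}"
definition E0 :: "'g set" where "E0 = {b \<in> RB. wt b = (\<lambda>_. 0)}"

lemma RB_cases:
  assumes "b \<in> RB" obtains "b \<in> Epos" | "b \<in> Eneg" | "b \<in> E0"
proof (cases "wt b = (\<lambda>_. 0)")
  case True
  then show ?thesis using that(3) assms by (simp add: E0_def)
next
  case False
  then have "wt b \<in> roots br t UNIV" using roots_eq assms by blast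
  then show ?thesis using Dp_sign that assms by (auto simp: Epos_def Eneg_def)
qed

lemma E_subset: "Epos \<subseteq> RB" "Eneg \<subseteq> RB" "E0 \<subseteq> RB"
  by (auto simp: Epos_def Eneg_def E0_def)

lemma E_finite: "finite Epos" "finite Eneg" "finite E0"
  using E_subset RBD(1) finite_subset by blast+

lemma E0_t: "E0 \<subseteq> t" using RB_zero_t by (auto simp: E0_def)

lemma Dp_nz: "(\<lambda>_. 0) \<notin> Dp" using x0(2) by force

lemma RB_q_cases: "b \<in> RB \<Longrightarrow> b \<in> q \<Longrightarrow> b \<in> Epos \<or> b \<in> Eneg"
  using RB_cases[of b] RB_q_nonzero_wt[of b] by (auto simp: E0_def)

text \<open>There are finitely many positive roots, so every root vector changes the height by at
  least a fixed amount. Differences of heights thereby bound numbers of steps.\<close>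

lemma eps_exists: "\<exists>\<epsilon>>0. \<forall>\<alpha>\<in>Dp. \<epsilon> \<le> Re (\<alpha> x0)"
proof -
  \<comment> \<open>The inserted 1 keeps the set nonempty if there are no roots at all.\<close>
  let ?S = "insert 1 ((\<lambda>\<alpha>. Re (\<alpha> x0)) ` Dp)"
  have fin: "finite ?S" using finite_subset[OF Dp_roots finite_roots] by simp
  have "Min ?S > 0" using fin x0(2) by (subst Min_gr_iff) auto
  moreover have "\<forall>\<alpha>\<in>Dp. Min ?S \<le> Re (\<alpha> x0)" using fin by auto
  ultimately show ?thesis by blast
qed

lemma root_sum_eq: "A \<subseteq> roots br t UNIV \<Longrightarrow> root_sum br t A = cvec.span {b \<in> RB. wt b \<in> A}"
proof
  assume A: "A \<subseteq> roots br t UNIV"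
  then have Ad: "A \<subseteq> dual_space t" unfolding roots_def by blast
  show "root_sum br t A \<subseteq> cvec.span {b \<in> RB. wt b \<in> A}"
    unfolding root_sum_def root_space_eq
  proof (rule cvec.span_minimal[OF _ cvec.subspace_span], rule UN_least)
    fix \<alpha> assume "\<alpha> \<in> A"
    then have "ad.wspace \<alpha> = cvec.span {b \<in> RB. wt b = \<alpha>}" using wspace_eq_span[OF RB] Ad by blast
    also have "\<dots> \<subseteq> cvec.span {b \<in> RB. wt b \<in> A}" by (rule cvec.span_mono) (use \<open>\<alpha> \<in> A\<close> in auto)
    finally show "ad.wspace \<alpha> \<subseteq> cvec.span {b \<in> RB. wt b \<in> A}" .
  qed
  show "cvec.span {b \<in> RB. wt b \<in> A} \<subseteq> root_sum br t A"
    unfolding root_sum_def root_space_eq by (rule cvec.span_mono) (use RBD(5) in auto)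
qed

lemma n_plus_eq: "n_plus br t Dp = cvec.span Epos"
  unfolding n_plus_def Epos_def by (rule root_sum_eq[OF Dp_roots])

lemma wspace_h: "b \<in> RB \<Longrightarrow> wt b \<noteq> (\<lambda>_. 0) \<Longrightarrow> b \<in> h \<Longrightarrow> ad.wspace (wt b) \<subseteq> h"
  using root_space_dim1[OF RBD(4) _ RBD(5) RB_nonzero, of b] cvec.span_minimal[of "{b}" h] h_subspace by auto

lemma wspace_q: "b \<in> RB \<Longrightarrow> b \<in> q \<Longrightarrow> ad.wspace (wt b) \<subseteq> q"
  using root_space_dim1[OF RBD(4) _ RBD(5) RB_nonzero, of b] RB_q_nonzero_wt[of b]
    cvec.span_minimal[of "{b}" q] q_subspace by auto

lemma roots_h_iff:
  assumes "b \<in> RB" "wt b \<noteq> (\<lambda>_. 0)"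
  shows "wt b \<in> roots br t h \<longleftrightarrow> b \<in> h"
proof
  have e: "root_space br t h (wt b) = h \<inter> ad.wspace (wt b)"
    unfolding root_space_def ad.wspace_def by auto
  show "wt b \<in> roots br t h" if "b \<in> h"
    using that assms RBD(4,5) RB_nonzero[of b] e unfolding roots_def by auto
  show "b \<in> h" if "wt b \<in> roots br t h"
  proof (rule ccontr)
    assume "b \<notin> h"
    then have "ad.wspace (wt b) \<subseteq> q" using wspace_q RB_h_or_q assms by blast
    then have "root_space br t h (wt b) \<subseteq> {0}" using e hq_zero by auto
    moreover have "0 \<in> root_space br t h (wt b)"
      using e cvec.subspace_0 h_subspace ad.wspace_subspace by auto
    ultimately show False using that unfolding roots_def by blast
  qed
qed

lemma n_h_eq: "n_h br h t Dp = cvec.span (Epos \<inter> h)"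
proof -
  have "b \<in> {b \<in> RB. wt b \<in> Dp \<inter> roots br t h} \<longleftrightarrow> b \<in> Epos \<inter> h" for b
    using roots_h_iff[of b] Dp_nz by (cases "wt b = (\<lambda>_. 0)") (auto simp: Epos_def)
  then have "{b \<in> RB. wt b \<in> Dp \<inter> roots br t h} = Epos \<inter> h" by (rule Set.set_eqI)
  then show ?thesis unfolding n_h_def using root_sum_eq[of "Dp \<inter> roots br t h"] Dp_roots by auto
qed

lemma roots_q_iff:
  assumes "b \<in> RB" "wt b \<noteq> (\<lambda>_. 0)"
  shows "wt b \<in> roots_q br h t \<longleftrightarrow> b \<in> q"
  using assms wspace_q[of b] RBD(5)[of b] roots_eq unfolding roots_q_def root_space_eq by auto

lemma n_q_plus_eq: "n_q_plus br h t Dp = cvec.span (Epos \<inter> q)"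
proof -
  have "b \<in> {b \<in> RB. wt b \<in> Dp \<inter> roots_q br h t} \<longleftrightarrow> b \<in> Epos \<inter> q" for b
    using roots_q_iff[of b] Dp_nz by (cases "wt b = (\<lambda>_. 0)") (auto simp: Epos_def)
  then have "{b \<in> RB. wt b \<in> Dp \<inter> roots_q br h t} = Epos \<inter> q" by (rule Set.set_eqI)
  then show ?thesis unfolding n_q_plus_def using root_sum_eq[of "Dp \<inter> roots_q br h t"] Dp_roots by auto
qed

text \<open>The form pairs opposite root spaces nontrivially, whereas \<open>h\<close> and
  \<open>q\<close> are orthogonal; so opposite root vectors belong to the same summand.\<close>

lemma K_pairs_q:
  assumes "b \<in> RB" "b \<in> q" "c \<in> RB" "wt c = (\<lambda>x. - wt b x)"
  shows "c \<in> q"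
proof -
  have nz: "wt b \<noteq> (\<lambda>_. 0)" using RB_q_nonzero_wt assms by blast
  then have nz': "wt c \<noteq> (\<lambda>_. 0)" using assms(4) by (auto simp: fun_eq_iff)
  obtain f where f: "f \<in> ad.wspace (\<lambda>x. - wt b x)" "K b f = 1"
    by (rule opposite_exists[OF RBD(4) RBD(5) RB_nonzero]) (use assms in auto)
  show ?thesis
  proof (rule ccontr)
    assume "c \<notin> q"
    then have "ad.wspace (wt c) \<subseteq> h" using RB_h_or_q wspace_h assms nz' by blast
    then have "K b f = 0" using f(1) assms q_h_orth by auto
    then show False using f(2) by simp
  qed
qed

lemma n_q_minus_eq: "n_q_minus br h t Dp = cvec.span (Eneg \<inter> q)"
proof -
  let ?A = "(\<lambda>\<beta> x. - \<beta> x) ` (Dp \<inter> roots_q br h t)"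
  have A: "?A \<subseteq> roots br t UNIV" using root_neg Dp_roots by auto
  have "{b \<in> RB. wt b \<in> ?A} = Eneg \<inter> q"
  proof (intro equalityI subsetI)
    fix b assume "b \<in> {b \<in> RB. wt b \<in> ?A}"
    then obtain \<beta> where b: "b \<in> RB" "wt b = (\<lambda>x. - \<beta> x)" "\<beta> \<in> Dp" "\<beta> \<in> roots_q br h t" by blast
    have "\<beta> \<in> roots br t UNIV" using Dp_roots b by blast
    then have nz: "\<beta> \<noteq> (\<lambda>_. 0)" and "\<beta> \<in> wt ` RB" using roots_eq[of \<beta>] by simp_all
    from this(2) obtain c where c: "\<beta> = wt c" "c \<in> RB" by (rule imageE)
    have "c \<in> q" using roots_q_iff[OF c(2)] nz b(4) unfolding c(1) by simp
    then have "b \<in> q" using K_pairs_q[of c b] b c by simp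
    then show "b \<in> Eneg \<inter> q" using b by (simp add: Eneg_def)
  next
    fix b assume b: "b \<in> Eneg \<inter> q"
    then have bR: "b \<in> RB" and D: "(\<lambda>x. - wt b x) \<in> Dp" by (auto simp: Eneg_def)
    then have "(\<lambda>x. - wt b x) \<in> roots br t UNIV" using Dp_roots by blast
    then have nz: "(\<lambda>x. - wt b x) \<noteq> (\<lambda>_. 0)" and "(\<lambda>x. - wt b x) \<in> wt ` RB"
      using roots_eq[of "\<lambda>x. - wt b x"] by simp_all
    from this(2) obtain c where c: "(\<lambda>x. - wt b x) = wt c" "c \<in> RB" by (rule imageE)
    have "c \<in> q" using K_pairs_q[of b c] b bR c by simp
    then have m: "(\<lambda>x. - wt b x) \<in> Dp \<inter> roots_q br h t"
      using roots_q_iff[OF c(2)] nz D unfolding c(1) by simp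
    have "wt b \<in> ?A" by (rule image_eqI[OF _ m]) simp
    then show "b \<in> {b \<in> RB. wt b \<in> ?A}" using bR by simp
  qed
  then show ?thesis unfolding n_q_minus_def using root_sum_eq[OF A] by simp
qed

section \<open>The two isotropic halves of \<open>q\<close>\<close>

abbreviation "nqp \<equiv> n_q_plus br h t Dp"
abbreviation "nqm \<equiv> n_q_minus br h t Dp"

lemma nq_sub: "nqp \<subseteq> q" "nqm \<subseteq> q" "cvec.subspace nqp" "cvec.subspace nqm"
proof -
  show "nqp \<subseteq> q" unfolding n_q_plus_eq by (rule cvec.span_minimal[OF Int_lower2 q_subspace])
  show "nqm \<subseteq> q" unfolding n_q_minus_eq by (rule cvec.span_minimal[OF Int_lower2 q_subspace])
  show "cvec.subspace nqp" unfolding n_q_plus_eq by (rule cvec.subspace_span)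
  show "cvec.subspace nqm" unfolding n_q_minus_eq by (rule cvec.subspace_span)
qed

text \<open>Two positive weights add up to something with positive real part at \<open>x0\<close>,
  hence not to 0, and then \<open>wspace_orth\<close> applies.\<close>

lemma Epos_orth: "b \<in> Epos \<Longrightarrow> c \<in> Epos \<Longrightarrow> K b c = 0"
proof -
  assume *: "b \<in> Epos" "c \<in> Epos"
  have "Re (wt b x0 + wt c x0) > 0" using * x0(2) by (simp add: Epos_def add_pos_pos)
  then have "wt b x0 + wt c x0 \<noteq> 0" by (metis less_irrefl zero_complex.sel(1))
  then show ?thesis using wspace_orth[OF RBD(5) RBD(5) x0(1)] * E_subset by blast
qed

lemma Eneg_orth: "b \<in> Eneg \<Longrightarrow> c \<in> Eneg \<Longrightarrow> K b c = 0"
proof -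
  assume *: "b \<in> Eneg" "c \<in> Eneg"
  have "Re (- wt b x0) > 0" "Re (- wt c x0) > 0"
    using * x0(2)[of "\<lambda>x. - wt b x"] x0(2)[of "\<lambda>x. - wt c x"] by (simp_all add: Eneg_def)
  then have "Re (wt b x0 + wt c x0) < 0" by simp
  then have "wt b x0 + wt c x0 \<noteq> 0" by (metis less_irrefl zero_complex.sel(1))
  then show ?thesis using wspace_orth[OF RBD(5) RBD(5) x0(1)] * E_subset by blast
qed

lemma K_span_span: "(\<And>b c. b \<in> A \<Longrightarrow> c \<in> C \<Longrightarrow> K b c = 0) \<Longrightarrow> x \<in> cvec.span A \<Longrightarrow> y \<in> cvec.span C \<Longrightarrow> K x y = 0"
  by (rule K_span_zero[of C]) (metis K_sym K_span_zero[of A])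

lemma nqp_orth: "x \<in> nqp \<Longrightarrow> y \<in> nqp \<Longrightarrow> K x y = 0"
  unfolding n_q_plus_eq by (rule K_span_span) (auto simp: Epos_orth)

lemma nqm_orth: "x \<in> nqm \<Longrightarrow> y \<in> nqm \<Longrightarrow> K x y = 0"
  unfolding n_q_minus_eq by (rule K_span_span) (auto simp: Eneg_orth)

lemma q_split: "a \<in> q \<Longrightarrow> \<exists>p. p \<in> nqp \<and> a - p \<in> nqm"
proof -
  assume "a \<in> q"
  then have "a \<in> cvec.span (RB \<inter> q)" by (simp add: q_span)
  also have "\<dots> \<subseteq> cvec.span ((Epos \<inter> q) \<union> (Eneg \<inter> q))" by (rule cvec.span_mono) (use RB_q_cases in blast)
  finally obtain p m where "a = p + m" "p \<in> nqp" "m \<in> nqm"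
    unfolding cvec.span_Un n_q_plus_eq n_q_minus_eq by auto
  then show ?thesis by (intro exI[of _ p]) simp
qed

text \<open>The difference lies in both isotropic halves and is thus orthogonal to all of
  \<open>q\<close>. Together with \<open>q_split\<close> this gives sense to the definite
  description in \<open>q_plus_part\<close>.\<close>

lemma q_split_unique:
  assumes "p \<in> nqp" "a - p \<in> nqm" "p' \<in> nqp" "a - p' \<in> nqm"
  shows "p = p'"
proof -
  have d: "p - p' \<in> nqp" using assms nq_sub by (simp add: cvec.subspace_diff)
  have "(a - p') - (a - p) \<in> nqm" using assms nq_sub by (metis cvec.subspace_diff)
  then have d': "p - p' \<in> nqm" by simp
  have "p - p' = 0"
  proof (rule q_nondeg)
    show "p - p' \<in> q" using d nq_sub by blast
    show "K (p - p') y = 0" if y: "y \<in> q" for y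
    proof -
      obtain r where r: "r \<in> nqp" "y - r \<in> nqm" using q_split[OF y] by blast
      have "K (p - p') (r + (y - r)) = K (p - p') r + K (p - p') (y - r)" by (rule K_add2)
      then show ?thesis using nqp_orth[OF d r(1)] nqm_orth[OF d' r(2)] by simp
    qed
  qed
  then show ?thesis by simp
qed

abbreviation "qp \<equiv> q_plus_part br h t Dp"

lemma qp: "a \<in> q \<Longrightarrow> qp a \<in> nqp \<and> a - qp a \<in> nqm"
  unfolding q_plus_part_def by (rule theI') (use q_split q_split_unique in blast)

lemma qp_eqI: "p \<in> nqp \<Longrightarrow> a - p \<in> nqm \<Longrightarrow> qp a = p"
  unfolding q_plus_part_def by (rule the_equality) (use q_split_unique in auto)

lemma qp_add: "a \<in> q \<Longrightarrow> b \<in> q \<Longrightarrow> qp (a + b) = qp a + qp b"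
proof (rule qp_eqI)
  assume *: "a \<in> q" "b \<in> q"
  show "qp a + qp b \<in> nqp" using qp[OF *(1)] qp[OF *(2)] nq_sub by (simp add: cvec.subspace_add)
  have "(a - qp a) + (b - qp b) \<in> nqm" using qp[OF *(1)] qp[OF *(2)] nq_sub cvec.subspace_add by metis
  then show "a + b - (qp a + qp b) \<in> nqm" by (simp add: algebra_simps)
qed

lemma qp_scale: "a \<in> q \<Longrightarrow> qp (c *\<^sub>C a) = c *\<^sub>C qp a"
proof (rule qp_eqI)
  assume *: "a \<in> q"
  show "c *\<^sub>C qp a \<in> nqp" using qp[OF *(1)] nq_sub by (simp add: cvec.subspace_scale)
  have "c *\<^sub>C (a - qp a) \<in> nqm" using qp[OF *(1)] nq_sub cvec.subspace_scale by metis
  then show "c *\<^sub>C a - c *\<^sub>C qp a \<in> nqm" by (simp add: cvec.scale_right_diff_distrib)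
qed

text \<open>The amount by which a product of basis vectors, recorded as a word, shifts the weight of
  a vector.\<close>

definition wsum :: "'g list \<Rightarrow> 'g \<Rightarrow> complex" where
  "wsum ys = (\<lambda>x. \<Sum>y\<leftarrow>ys. wt y x)"

lemma wsum_simps [simp]: "wsum [] = (\<lambda>_. 0)" "wsum (y # ys) = (\<lambda>x. wt y x + wsum ys x)"
  by (simp_all add: wsum_def)

lemma wsum_dual: "set ys \<subseteq> RB \<Longrightarrow> wsum ys \<in> dual_space t"
  by (induction ys) (simp_all add: dual_space_ops RBD(4))

lemma wsum_Eneg_bound:
  assumes "\<forall>\<alpha>\<in>Dp. \<epsilon> \<le> Re (\<alpha> x0)" "set ys \<subseteq> Eneg"
  shows "Re (wsum ys x0) \<le> - \<epsilon> * real (length ys)"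
  using assms(2)
proof (induction ys)
  case (Cons y ys)
  then have "\<epsilon> \<le> Re (- wt y x0)" using assms(1) by (auto simp: Eneg_def)
  then show ?case using Cons by (simp add: algebra_simps)
qed simp

lemma tdual_unique: "\<mu> \<in> dual_space t \<Longrightarrow> x \<in> t \<Longrightarrow> (\<And>y. y \<in> t \<Longrightarrow> K x y = \<mu> y) \<Longrightarrow> tdual \<mu> = x"
proof -
  assume *: "\<mu> \<in> dual_space t" "x \<in> t" "\<And>y. y \<in> t \<Longrightarrow> K x y = \<mu> y"
  have "tdual \<mu> - x \<in> t" using tdual(1) * t_subspace by (simp add: cvec.subspace_diff)
  moreover have "\<forall>y\<in>t. K (tdual \<mu> - x) y = 0" using tdual(2)[OF *(1)] * by (simp add: K_simps)
  ultimately have "tdual \<mu> - x = 0" using t_nondeg unfolding nondegenerate_on_def by blast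
  then show ?thesis by simp
qed

lemma tdual_add: "\<mu> \<in> dual_space t \<Longrightarrow> \<nu> \<in> dual_space t \<Longrightarrow> tdual (\<lambda>x. \<mu> x + \<nu> x) = tdual \<mu> + tdual \<nu>"
  by (rule tdual_unique) (simp_all add: dual_space_ops tdual K_simps cvec.subspace_add[OF t_subspace])

lemma wt_tdual_wsum_real: "set ys \<subseteq> Eneg \<Longrightarrow> b \<in> RB \<Longrightarrow> wt b (tdual (wsum ys)) \<in> \<real>"
proof (induction ys)
  case Nil
  have "tdual (\<lambda>_. 0) = 0"
    by (rule tdual_unique) (simp_all add: dual_space_ops cvec.subspace_0[OF t_subspace])
  then show ?case using dual_spaceD(2)[OF RBD(4)[OF Nil(2)], of 0 0] cvec.subspace_0[OF t_subspace] by simp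
next
  case (Cons y ys)
  have y: "y \<in> RB" "set ys \<subseteq> RB" using Cons.prems E_subset by auto
  have "wt y \<noteq> (\<lambda>_. 0)"
  proof
    assume "wt y = (\<lambda>_. 0)"
    then show False using Cons.prems Dp_nz by (simp add: Eneg_def)
  qed
  then have "wt b (tdual (wt y)) \<in> \<real>"
    using root_norm_real(2)[OF RB RBD(4) _ RBD(5) RB_nonzero] y Cons.prems by blast
  moreover have "tdual (wsum (y # ys)) = tdual (wt y) + tdual (wsum ys)"
    using tdual_add[OF RBD(4)[OF y(1)] wsum_dual[OF y(2)]] by simp
  moreover have "wt b (tdual (wt y) + tdual (wsum ys)) = wt b (tdual (wt y)) + wt b (tdual (wsum ys))"
    by (rule dual_spaceD(1)[OF RBD(4)[OF Cons.prems(2)] tdual(1)[OF RBD(4)[OF y(1)]] tdual(1)[OF wsum_dual[OF y(2)]]])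
  ultimately show ?case using Cons by simp
qed

text \<open>The values of the roots at \<open>tdual (wsum ys)\<close> are real and the condition on \<open>\<mu>\<close> bounds the sum
  of their squares.  In turn they determine the value of \<open>wsum ys\<close> at \<open>x0\<close>, which grows with the
  length of \<open>ys\<close>.\<close>

lemma quadric_length_bound:
  assumes \<kappa>: "\<kappa> \<in> dual_space t" and y0: "y0 \<in> t"
  shows "\<exists>n. \<forall>ys \<mu>. set ys \<subseteq> Eneg \<longrightarrow> \<mu> = (\<lambda>x. \<kappa> x + wsum ys x) \<longrightarrow> \<mu> (tdual \<mu>) + \<mu> y0 = c \<longrightarrow> length ys \<le> n"
proof -
  obtain \<epsilon> where \<epsilon>: "\<epsilon> > 0" "\<forall>\<alpha>\<in>Dp. \<epsilon> \<le> Re (\<alpha> x0)" using eps_exists by blast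
  define L where "L = tdual \<kappa>"
  have L: "L \<in> t" unfolding L_def by (rule tdual[OF \<kappa>])
  \<comment> \<open>With \<open>H = tdual (wsum ys)\<close> and the real numbers
    \<open>hh b = wt b H\<close>, the real part of the condition reads
    \<open>C = \<Sum> (hh b)^2 + \<Sum> r b * hh b\<close>; \<open>r\<close> and \<open>C\<close>
    collect the linear and the constant contributions.\<close>
  define r where "r b = Re (2 * wt b L + wt b y0)" for b
  define u where "u b = Re (wt b x0)" for b
  define C where "C = Re (c - K L L - \<kappa> y0)"
  \<comment> \<open>Two cross terms are estimated by \<open>- (x * y) \<le> (x^2 + y^2) / 2\<close>:
    the linear term of the condition, which bounds half the sum of the \<open>(hh b)^2\<close>, and
    the expression of the height through the \<open>hh b\<close>.\<close>
  define M where "M = (C + (\<Sum>b\<in>RB. (r b)\<^sup>2) / 2) + (\<Sum>b\<in>RB. (u b)\<^sup>2) / 2"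
  have "real (length ys) \<le> M / \<epsilon>"
    if ys: "set ys \<subseteq> Eneg" and \<mu>: "\<mu> = (\<lambda>x. \<kappa> x + wsum ys x)" and eq: "\<mu> (tdual \<mu>) + \<mu> y0 = c" for ys \<mu>
  proof -
    have sd: "wsum ys \<in> dual_space t" using wsum_dual ys E_subset by blast
    define H where "H = tdual (wsum ys)"
    have H: "H \<in> t" unfolding H_def by (rule tdual[OF sd])
    have td: "tdual \<mu> = L + H" unfolding \<mu> L_def H_def by (rule tdual_add[OF \<kappa> sd])
    have \<mu>d: "\<mu> \<in> dual_space t" unfolding \<mu> by (rule dual_space_ops(4)[OF \<kappa> sd])
    define hh where "hh b = Re (wt b H)" for b
    have hh: "wt b H = of_real (hh b)" if "b \<in> RB" for b
      using wt_tdual_wsum_real[OF ys that] unfolding hh_def H_def by (simp add: complex_is_Real_iff complex_eq_iff)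
    have "\<mu> (tdual \<mu>) = K (tdual \<mu>) (tdual \<mu>)" using tdual[OF \<mu>d] by simp
    also have "\<dots> = K L L + 2 * K L H + K H H" unfolding td by (simp add: K_simps K_sym[of H L])
    finally have "c = K L L + 2 * K L H + K H H + (\<kappa> y0 + K H y0)"
      using eq tdual(2)[OF sd y0] by (simp add: \<mu> H_def)
    then have "c - K L L - \<kappa> y0 = K H H + (2 * K L H + K y0 H)" using K_sym[of H y0] by simp
    also have "\<dots> = (\<Sum>b\<in>RB. wt b H * wt b H) + (\<Sum>b\<in>RB. (2 * wt b L + wt b y0) * wt b H)"
      unfolding K_t_formula[OF RB H H] K_t_formula[OF RB L H] K_t_formula[OF RB y0 H]
      by (simp add: sum_distrib_left sum.distrib algebra_simps)
    also have "\<dots> = (\<Sum>b\<in>RB. of_real (hh b) * of_real (hh b)) + (\<Sum>b\<in>RB. (2 * wt b L + wt b y0) * of_real (hh b))"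
      by (simp add: hh)
    finally have Ceq: "C = (\<Sum>b\<in>RB. (hh b)\<^sup>2) + (\<Sum>b\<in>RB. r b * hh b)"
      unfolding C_def r_def by (simp add: power2_eq_square)
    have "wsum ys x0 = K H x0" using tdual(2)[OF sd x0(1)] by (simp add: H_def)
    also have "\<dots> = (\<Sum>b\<in>RB. of_real (hh b) * wt b x0)" unfolding K_t_formula[OF RB H x0(1)] by (simp add: hh)
    finally have "Re (wsum ys x0) = (\<Sum>b\<in>RB. hh b * u b)" by (simp add: u_def)
    then have "\<epsilon> * real (length ys) \<le> - (\<Sum>b\<in>RB. hh b * u b)"
      using wsum_Eneg_bound[OF \<epsilon>(2) ys] by simp
    also have "\<dots> \<le> (\<Sum>b\<in>RB. ((hh b)\<^sup>2 + (u b)\<^sup>2) / 2)"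
      unfolding sum_negf[symmetric]
    proof (rule sum_mono)
      fix b show "- (hh b * u b) \<le> ((hh b)\<^sup>2 + (u b)\<^sup>2) / 2"
        using zero_le_power2[of "hh b + u b"] by (simp add: power2_eq_square algebra_simps)
    qed
    also have "\<dots> = (\<Sum>b\<in>RB. (hh b)\<^sup>2) / 2 + (\<Sum>b\<in>RB. (u b)\<^sup>2) / 2"
      by (simp add: sum.distrib add_divide_distrib sum_divide_distrib)
    also have "(\<Sum>b\<in>RB. (hh b)\<^sup>2) / 2 \<le> C + (\<Sum>b\<in>RB. (r b)\<^sup>2) / 2"
    proof -
      have "- (\<Sum>b\<in>RB. r b * hh b) \<le> (\<Sum>b\<in>RB. ((hh b)\<^sup>2 + (r b)\<^sup>2) / 2)"
        unfolding sum_negf[symmetric]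
      proof (rule sum_mono)
        fix b show "- (r b * hh b) \<le> ((hh b)\<^sup>2 + (r b)\<^sup>2) / 2"
          using zero_le_power2[of "hh b + r b"] by (simp add: power2_eq_square algebra_simps)
      qed
      also have "\<dots> = (\<Sum>b\<in>RB. (hh b)\<^sup>2) / 2 + (\<Sum>b\<in>RB. (r b)\<^sup>2) / 2"
        by (simp add: sum.distrib add_divide_distrib sum_divide_distrib)
      finally show ?thesis using Ceq by linarith
    qed
    finally have "\<epsilon> * real (length ys) \<le> M" unfolding M_def by simp
    then show ?thesis using \<epsilon>(1) by (simp add: field_simps)
  qed
  then have "length ys \<le> nat \<lceil>M / \<epsilon>\<rceil>"
    if "set ys \<subseteq> Eneg" "\<mu> = (\<lambda>x. \<kappa> x + wsum ys x)" "\<mu> (tdual \<mu>) + \<mu> y0 = c" for ys \<mu>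
    using that by (metis le_nat_iff nat_le_real_less of_nat_le_iff order_trans real_nat_ceiling_ge)
  then show ?thesis by blast
qed

end

section \<open>The Clifford action and the square of the Dirac operator\<close>

lemma half_double: "(1/2) *\<^sub>C (x + x) = (x :: 'a::complex_vec)"
  by (simp add: scaleC_add_right scaleC_add_left[symmetric] scaleC_one)

text \<open>The uniqueness half of the universal property, applied to the family of values of
  \<open>F\<close> itself. It reduces identities between operators to words, as the next lemma does
  for pure tensors.\<close>

lemma ext_linear_eq:
  assumes F: "clinear F" and G: "clinear G" and "\<And>vs. F (wedge vs) = G (wedge vs)"
  shows "F u = G u"
proof -
  interpret F: Vector_Spaces.linear scaleC scaleC F by fact
  let ?f = "\<lambda>vs. F (wedge vs)"
  interpret l: Vector_Spaces.linear fscale scaleC "free_ext ?f" by (rule free_ext_linear)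
  have "\<exists>!F. clinear F \<and> (\<forall>x. F (abs_ext (gen x)) = ?f x)"
    by (rule ext_universal) (auto simp: ext_rels_def l.diff l.scale wedge_rels F.add F.scale F.zero)
  then show ?thesis using assms by (metis wedge.abs_eq)
qed

lemma tensor_linear_eq:
  assumes F: "clinear F" and G: "clinear G" and "\<And>a b. F (tens a b) = G (tens a b)"
  shows "F u = G u"
proof -
  interpret F: Vector_Spaces.linear scaleC scaleC F by fact
  let ?f = "\<lambda>(a, b). F (tens a b)"
  interpret l: Vector_Spaces.linear fscale scaleC "free_ext ?f" by (rule free_ext_linear)
  have "\<exists>!F. clinear F \<and> (\<forall>x. F (abs_tensor (gen x)) = ?f x)"
    by (rule tensor_universal) (auto simp: tensor_rels_def l.diff l.scale tens_bilinear F.add F.scale)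
  moreover have "\<forall>x. F (abs_tensor (gen x)) = ?f x" "\<forall>x. G (abs_tensor (gen x)) = ?f x"
    using assms(3) by (auto simp: tens.abs_eq)
  ultimately show ?thesis using F G by blast
qed

lemma tens_simps:
  fixes a a' :: "'a::complex_vec" and b b' :: "'b::complex_vec"
    and f :: "'i \<Rightarrow> 'a" and g :: "'i \<Rightarrow> 'b"
  shows "tens (0 :: 'a) b = 0" "tens a (0 :: 'b) = 0" "tens (a - a') b = tens a b - tens a' b" "tens a (b - b') = tens a b - tens a b'"
  "tens (- a) b = - tens a b" "tens a (- b) = - tens a b"
  "tens (\<Sum>i\<in>I. f i) b = (\<Sum>i\<in>I. tens (f i) b)" "tens a (\<Sum>i\<in>I. g i) = (\<Sum>i\<in>I. tens a (g i))"
proof -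
  have 1: "clinear (\<lambda>a. tens a b)" and 2: "clinear (tens a :: 'b \<Rightarrow> _)" for a :: 'a and b :: 'b
    by (simp_all add: clinear_iff tens_bilinear)
  show "tens (0 :: 'a) b = 0" "tens (- a) b = - tens a b" "tens (a - a') b = tens a b - tens a' b"
    by (rule clinear_simps(3-5)[OF 1])+
  show "tens a (0 :: 'b) = 0" "tens a (- b) = - tens a b" "tens a (b - b') = tens a b - tens a b'"
    by (rule clinear_simps(3-5)[OF 2])+
  show "tens (\<Sum>i\<in>I. f i) b = (\<Sum>i\<in>I. tens (f i) b)" by (rule clinear_simps(6)[OF 1])
  show "tens a (\<Sum>i\<in>I. g i) = (\<Sum>i\<in>I. tens a (g i))" by (rule clinear_simps(6)[OF 2])
qed

lemmas ext_mult_simps = clinear_simps[OF ext_mult(1)]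

lemma ext_mult_zero_left: "ext_mult 0 u = 0"
  using ext_mult_linear_left(2)[of 0 0 u] by simp

text \<open>Polarization of the relation that squares vanish.\<close>

lemma ext_mult_anti: "ext_mult v (ext_mult w u) = - ext_mult w (ext_mult v u)"
proof -
  have "ext_mult (v + w) (ext_mult (v + w) u) = 0" by (rule ext_mult_linear_left(3))
  then have "ext_mult v (ext_mult w u) + ext_mult w (ext_mult v u) = 0"
    by (simp add: ext_mult_linear_left ext_mult_simps add.commute)
  then show ?thesis by (simp add: eq_neg_iff_add_eq_0)
qed

text \<open>A repeated factor is moved next to its copy at the cost of a sign. This is why finitely
  many words suffice to span the spin module.\<close>

lemma wedge_not_distinct: "\<not> distinct vs \<Longrightarrow> wedge vs = 0"
proof (induction vs)
  case (Cons v vs)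
  have "ext_mult v (wedge ws) = 0" if "v \<in> set ws" for ws
    using that
  proof (induction ws)
    case (Cons w ws)
    show ?case
    proof (cases "v = w")
      case True
      then show ?thesis using ext_mult_linear_left(3)[of v "wedge ws"] by (simp add: ext_mult(2))
    next
      case False
      then have "ext_mult v (wedge ws) = 0" using Cons by simp
      then show ?thesis using ext_mult_anti[of v w "wedge ws"] by (simp add: ext_mult(2) ext_mult_simps)
    qed
  qed simp
  then show ?case using Cons by (cases "v \<in> set vs") (auto simp: ext_mult(2)[symmetric] ext_mult_simps)
qed simp

definition linform :: "('a::complex_vec \<Rightarrow> complex) \<Rightarrow> bool" where
  "linform \<xi> \<longleftrightarrow> (\<forall>x y. \<xi> (x + y) = \<xi> x + \<xi> y) \<and> (\<forall>c x. \<xi> (c *\<^sub>C x) = c * \<xi> x)"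

lemma contract_clinear: "linform \<xi> \<Longrightarrow> clinear (contract \<xi>)"
  by (rule contract(1)) (auto simp: linform_def)

lemma contract_wedge: "linform \<xi> \<Longrightarrow> contract \<xi> (wedge vs) = contract_word \<xi> vs"
  unfolding contract_word_eq by (rule contract(2)) (auto simp: linform_def)

text \<open>Contraction is an antiderivation; on words this is the recursion of
  \<open>contract_word\<close>.\<close>

lemma contract_ext_mult:
  assumes "linform \<xi>"
  shows "contract \<xi> (ext_mult v u) = \<xi> v *\<^sub>C u - ext_mult v (contract \<xi> u)"
proof -
  note c = clinear_simps[OF contract_clinear[OF assms]]
  show ?thesis
    by (rule ext_linear_eq[where F = "\<lambda>u. contract \<xi> (ext_mult v u)" and G = "\<lambda>u. \<xi> v *\<^sub>C u - ext_mult v (contract \<xi> u)"])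
       (simp_all add: clinear_iff c ext_mult_simps scaleC_add_right scaleC_scaleC mult.commute
         ext_mult(2) contract_wedge[OF assms] cvec.scale_right_diff_distrib algebra_simps)
qed

lemma contract_linear_left:
  assumes "linform \<xi>" "linform \<eta>"
  shows "contract (\<lambda>x. \<xi> x + \<eta> x) u = contract \<xi> u + contract \<eta> u"
    "contract (\<lambda>x. c * \<xi> x) u = c *\<^sub>C contract \<xi> u"
proof -
  have l: "linform (\<lambda>x. \<xi> x + \<eta> x)" "linform (\<lambda>x. c * \<xi> x)"
    using assms by (simp_all add: linform_def algebra_simps)
  note simps = clinear_iff clinear_simps[OF contract_clinear[OF l(1)]] clinear_simps[OF contract_clinear[OF l(2)]]
    clinear_simps[OF contract_clinear[OF assms(1)]] clinear_simps[OF contract_clinear[OF assms(2)]]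
  show "contract (\<lambda>x. \<xi> x + \<eta> x) u = contract \<xi> u + contract \<eta> u"
  proof (rule ext_linear_eq[where G = "\<lambda>u. contract \<xi> u + contract \<eta> u"])
    show "contract (\<lambda>x. \<xi> x + \<eta> x) (wedge vs) = contract \<xi> (wedge vs) + contract \<eta> (wedge vs)" for vs
      unfolding contract_wedge[OF l(1)] contract_wedge[OF assms(1)] contract_wedge[OF assms(2)]
      by (induction vs) (simp_all add: scaleC_add_left ext_mult_simps)
  qed (simp_all add: simps scaleC_add_right)
  show "contract (\<lambda>x. c * \<xi> x) u = c *\<^sub>C contract \<xi> u"
  proof (rule ext_linear_eq[where G = "\<lambda>u. c *\<^sub>C contract \<xi> u"])
    show "contract (\<lambda>x. c * \<xi> x) (wedge vs) = c *\<^sub>C contract \<xi> (wedge vs)" for vs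
      unfolding contract_wedge[OF l(2)] contract_wedge[OF assms(1)]
      by (induction vs) (simp_all add: ext_mult_simps scaleC_scaleC cvec.scale_right_diff_distrib)
  qed (simp_all add: simps scaleC_add_right scaleC_scaleC mult.commute)
qed

text \<open>By the antiderivation rule the anticommutator of two contractions commutes with exterior
  multiplication, and it kills the empty word.\<close>

lemma contract_anti:
  assumes "linform \<xi>" "linform \<eta>"
  shows "contract \<xi> (contract \<eta> u) + contract \<eta> (contract \<xi> u) = 0"
proof -
  note c = clinear_simps[OF contract_clinear[OF assms(1)]] clinear_simps[OF contract_clinear[OF assms(2)]]
  show ?thesis
  proof (rule ext_linear_eq[where F = "\<lambda>u. contract \<xi> (contract \<eta> u) + contract \<eta> (contract \<xi> u)" and G = "\<lambda>_. 0"])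
    show "contract \<xi> (contract \<eta> (wedge vs)) + contract \<eta> (contract \<xi> (wedge vs)) = 0" for vs
    proof (induction vs)
      case Nil
      then show ?case using assms by (simp add: contract_wedge c)
    next
      case (Cons v vs)
      have "contract \<xi> (contract \<eta> (wedge (v # vs))) + contract \<eta> (contract \<xi> (wedge (v # vs))) =
        ext_mult v (contract \<xi> (contract \<eta> (wedge vs)) + contract \<eta> (contract \<xi> (wedge vs)))"
        unfolding ext_mult(2)[symmetric]
        by (simp add: contract_ext_mult assms c ext_mult_simps)
      then show ?case using Cons by (simp add: ext_mult_simps)
    qed
  qed (simp_all add: clinear_iff c scaleC_add_right)
qed

context lie_fd begin

lemma linform_K: "linform (K x)"
  by (simp add: linform_def K_simps)

text \<open>The canonical tensor does not depend on the dual bases, so one may pass from the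
  orthonormal basis \<open>Z\<close> to root vectors.\<close>

lemma dual_change:
  assumes "dual_on V B d" "dual_on V C e" and f: "bilin f"
  shows "(\<Sum>b\<in>B. f b (d b)) = (\<Sum>c\<in>C. f c (e c))"
proof -
  note D = dual_onD[OF assms(1)] and E = dual_onD[OF assms(2)]
  have "(\<Sum>b\<in>B. f b (d b)) = (\<Sum>b\<in>B. f (\<Sum>c\<in>C. K b (e c) *\<^sub>C c) (d b))"
    using D E by simp
  also have "\<dots> = (\<Sum>b\<in>B. \<Sum>c\<in>C. K b (e c) *\<^sub>C f c (d b))"
    by (simp add: bilin_simps[OF f])
  also have "\<dots> = (\<Sum>c\<in>C. \<Sum>b\<in>B. K b (e c) *\<^sub>C f c (d b))" by (rule sum.swap)
  also have "\<dots> = (\<Sum>c\<in>C. f c (\<Sum>b\<in>B. K (e c) b *\<^sub>C d b))"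
    by (simp add: bilin_simps[OF f] K_sym)
  also have "\<dots> = (\<Sum>c\<in>C. f c (e c))"
    using D E by simp
  finally show ?thesis .
qed

end

section \<open>Clifford relations, spin representation and cubic element\<close>

context dirac_setting
begin

abbreviation "gam \<equiv> gamma br h t Dp"
abbreviation "S \<equiv> spin_module br h t Dp"

lemma gam_clinear: "clinear (gam a)"
  unfolding gamma_def
  using clinear_simps[OF contract_clinear[OF linform_K[of "qp a"]]]
  by (simp add: clinear_iff ext_mult_simps scaleC_add_right)

lemmas gam_simps = clinear_simps[OF gam_clinear]

lemma gam_add: "a \<in> q \<Longrightarrow> b \<in> q \<Longrightarrow> gam (a + b) s = gam a s + gam b s"
proof -
  assume *: "a \<in> q" "b \<in> q"
  have "contract (K (qp a + qp b)) s = contract (K (qp a)) s + contract (K (qp b)) s"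
  proof -
    have "K (qp a + qp b) = (\<lambda>x. K (qp a) x + K (qp b) x)" by (simp add: fun_eq_iff K_simps)
    then show ?thesis using contract_linear_left(1)[OF linform_K[of "qp a"] linform_K[of "qp b"], of s] by simp
  qed
  moreover have "ext_mult (a + b - (qp a + qp b)) s = ext_mult (a - qp a) s + ext_mult (b - qp b) s"
    by (simp add: ext_mult_linear_left(1)[symmetric] algebra_simps)
  ultimately show ?thesis using * by (simp add: gamma_def qp_add)
qed

lemma gam_scale: "a \<in> q \<Longrightarrow> gam (c *\<^sub>C a) s = c *\<^sub>C gam a s"
proof -
  assume *: "a \<in> q"
  have "contract (K (c *\<^sub>C qp a)) s = c *\<^sub>C contract (K (qp a)) s"
  proof -
    have "K (c *\<^sub>C qp a) = (\<lambda>x. c * K (qp a) x)" by (simp add: fun_eq_iff K_simps)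
    then show ?thesis using contract_linear_left(2)[OF linform_K[of "qp a"] linform_K[of "qp a"], of c s] by simp
  qed
  moreover have "ext_mult (c *\<^sub>C a - c *\<^sub>C qp a) s = c *\<^sub>C ext_mult (a - qp a) s"
    by (simp add: ext_mult_linear_left(2)[symmetric] cvec.scale_right_diff_distrib)
  ultimately show ?thesis using * by (simp add: gamma_def qp_scale scaleC_add_right)
qed

text \<open>Two exterior multiplications anticommute, and so do two contractions. The mixed terms
  give the pairings between the two halves of \<open>q\<close>; since both halves are isotropic,
  these add up to \<open>K a b\<close>.\<close>

lemma gam_clifford:
  assumes "a \<in> q" "b \<in> q"
  shows "gam a (gam b s) + gam b (gam a s) = K a b *\<^sub>C s"
proof -
  define p m p' m' where d: "p = qp a" "m = a - p" "p' = qp b" "m' = b - p'"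
  have mem: "p \<in> nqp" "m \<in> nqm" "p' \<in> nqp" "m' \<in> nqm" using qp assms by (auto simp: d)
  have ab: "a = p + m" "b = p' + m'" by (simp_all add: d)
  have "K a b = K p m' + K p' m"
    unfolding ab using nqp_orth[OF mem(1,3)] nqm_orth[OF mem(2,4)] by (simp add: K_simps K_sym)
  moreover have "gam a (gam b s) + gam b (gam a s) =
     (ext_mult m (ext_mult m' s) + ext_mult m' (ext_mult m s)) +
     (contract (K p) (contract (K p') s) + contract (K p') (contract (K p) s)) +
     (K p m' *\<^sub>C s + K p' m *\<^sub>C s)"
    unfolding gamma_def d[symmetric]
    by (simp add: ext_mult_simps clinear_simps[OF contract_clinear[OF linform_K]]
        contract_ext_mult[OF linform_K] algebra_simps)
  ultimately show ?thesis
    using ext_mult_anti[of m m' s] contract_anti[OF linform_K linform_K, of p p' s]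
    by (simp add: scaleC_add_left)
qed

text \<open>The Clifford action composed with the projection onto \<open>q\<close>: unlike \<open>gamma\<close>, it is linear on the
  whole Lie algebra.\<close>

definition G :: "'g \<Rightarrow> 'g ext \<Rightarrow> 'g ext" where
  "G x s = (\<Sum>z\<in>Z. K x z *\<^sub>C gam z s)"

lemma G_bilinear:
  "G (x + y) s = G x s + G y s" "G (c *\<^sub>C x) s = c *\<^sub>C G x s"
  "G x (s + s') = G x s + G x s'" "G x (c *\<^sub>C s) = c *\<^sub>C G x s"
  by (simp_all add: G_def K_simps gam_simps scaleC_add_left scaleC_add_right sum.distrib
      cvec.scale_sum_right scaleC_scaleC mult.commute)

lemma G_clinear1: "clinear (\<lambda>x. G x s)" and G_clinear2: "clinear (G x)"
  by (simp_all add: clinear_iff G_bilinear)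

lemma G_simps:
  "G 0 s = 0" "G (- x) s = - G x s" "G (x - y) s = G x s - G y s" "G (\<Sum>i\<in>A. f i) s = (\<Sum>i\<in>A. G (f i) s)"
  "G x 0 = 0" "G x (- s) = - G x s" "G x (s - s') = G x s - G x s'" "G x (\<Sum>i\<in>A. g i) = (\<Sum>i\<in>A. G x (g i))"
  by (rule clinear_simps[OF G_clinear1] clinear_simps[OF G_clinear2])+

lemma gam_eq_G: "a \<in> q \<Longrightarrow> gam a s = G a s"
proof -
  assume a: "a \<in> q"
  have "gam (\<Sum>z\<in>A. K a z *\<^sub>C z) s = (\<Sum>z\<in>A. K a z *\<^sub>C gam z s)" if "A \<subseteq> Z" "finite A" for A
    using that(2,1)
  proof (induction A rule: finite_induct)
    case empty
    have "gam (0 *\<^sub>C 0) s = 0 *\<^sub>C gam 0 s" by (rule gam_scale) (rule cvec.subspace_0[OF q_subspace])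
    then show ?case by simp
  next
    case (insert z A)
    then have z: "z \<in> q" and A: "\<And>z. z \<in> A \<Longrightarrow> z \<in> q" using Z_q by auto
    have "(\<Sum>z\<in>A. K a z *\<^sub>C z) \<in> q"
      by (intro cvec.subspace_sum[OF q_subspace] cvec.subspace_scale[OF q_subspace] A)
    then show ?case
      using insert z by (simp add: gam_add gam_scale cvec.subspace_scale[OF q_subspace])
  qed
  from this[OF order_refl Z(1)] show ?thesis by (simp add: q_expand[OF a] G_def)
qed

lemma G_h: "x \<in> h \<Longrightarrow> G x s = 0"
  using q_h_orth(2) Z_q by (simp add: G_def)

text \<open>The second vector may be arbitrary, because both \<open>G\<close> and \<open>K a\<close>
  annihilate \<open>h\<close>. Brackets of elements of \<open>q\<close> can thus be inserted without
  projecting them first.\<close>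

lemma G_clifford: "a \<in> q \<Longrightarrow> G a (G u s) + G u (G a s) = K a u *\<^sub>C s"
proof -
  assume a: "a \<in> q"
  obtain x y where xy: "x \<in> h" "y \<in> q" "u = x + y" by (rule hq_decomp)
  have "G a (G y s) + G y (G a s) = K a y *\<^sub>C s"
    using gam_clifford[OF a xy(2), of s] gam_eq_G[OF a] gam_eq_G[OF xy(2)] by simp
  then show ?thesis using xy a q_h_orth(1)
    by (simp add: G_bilinear G_h G_simps K_simps)
qed

lemma G_swap: "a \<in> q \<Longrightarrow> G u (G a s) = K a u *\<^sub>C s - G a (G u s)"
  using G_clifford[of a u s] by (simp add: algebra_simps)

lemma G_expand: "(\<Sum>z\<in>Z. K x z *\<^sub>C G z s) = G x s"
  using gam_eq_G[OF Z_q] by (simp add: G_def[of x])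

text \<open>For \<open>x\<close> in \<open>h\<close> this is the spin representation, as
  \<open>spin_act_eq\<close> shows; unlike the definite description in \<open>spin_lift\<close>, the
  formula is visibly linear in \<open>x\<close>.\<close>

definition sp :: "'g \<Rightarrow> 'g ext \<Rightarrow> 'g ext" where
  "sp x s = (1/2) *\<^sub>C (\<Sum>z\<in>Z. G (br x z) (G z s))"

lemma sp_bilinear:
  "sp (x + y) s = sp x s + sp y s" "sp (c *\<^sub>C x) s = c *\<^sub>C sp x s"
  "sp x (s + s') = sp x s + sp x s'" "sp x (c *\<^sub>C s) = c *\<^sub>C sp x s"
  by (simp_all add: sp_def br_simps G_bilinear sum.distrib scaleC_add_right cvec.scale_sum_right[symmetric]
      scaleC_scaleC mult.commute)

lemma sp_clinear: "clinear (sp x)" and sp_clinear1: "clinear (\<lambda>x. sp x s)"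
  by (simp_all add: clinear_iff sp_bilinear)

lemmas sp_simps = clinear_simps(3-6)[OF sp_clinear] clinear_simps(3-6)[OF sp_clinear1]

text \<open>The right side involves only \<open>A\<close>, so the value in \<open>spin_lift\<close>
  is independent of the way \<open>A\<close> is written with the \<open>rot a b\<close>. For a
  single pair the sum over \<open>Z\<close> reassembles \<open>a\<close> and \<open>b\<close> from
  their coordinates.\<close>

lemma spin_lift_eq:
  assumes ps: "set ps \<subseteq> q \<times> q" "\<And>v. v \<in> q \<Longrightarrow> A v = (\<Sum>(a, b)\<leftarrow>ps. rot br a b v)"
  shows "(\<Sum>(a, b)\<leftarrow>ps. (1/2) *\<^sub>C (gam a (gam b s) - gam b (gam a s))) = (1/2) *\<^sub>C (\<Sum>z\<in>Z. G (A z) (G z s))"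
proof -
  have "(\<Sum>z\<in>Z. G (\<Sum>(a, b)\<leftarrow>ps. rot br a b z) (G z s)) = (\<Sum>(a, b)\<leftarrow>ps. gam a (gam b s) - gam b (gam a s))"
    if "set ps \<subseteq> q \<times> q" for ps
    using that
  proof (induction ps)
    case Nil
    then show ?case by (simp add: G_simps)
  next
    case (Cons p ps)
    obtain a b where p: "p = (a, b)" by force
    have ab: "a \<in> q" "b \<in> q" using Cons.prems p by auto
    have "(\<Sum>z\<in>Z. G (rot br a b z) (G z s)) = G a (\<Sum>z\<in>Z. K b z *\<^sub>C G z s) - G b (\<Sum>z\<in>Z. K a z *\<^sub>C G z s)"
      by (simp add: rot_def G_simps G_bilinear sum_subtractf)
    then have "(\<Sum>z\<in>Z. G (rot br a b z) (G z s)) = gam a (gam b s) - gam b (gam a s)"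
      using gam_eq_G ab by (simp add: G_expand)
    then show ?case using Cons by (simp add: p G_bilinear sum.distrib)
  qed
  from this[OF ps(1)] have "(\<Sum>z\<in>Z. G (A z) (G z s)) = (\<Sum>(a, b)\<leftarrow>ps. gam a (gam b s) - gam b (gam a s))"
    using ps(2) Z_q by simp
  moreover have "(\<Sum>(a, b)\<leftarrow>ps. (1/2) *\<^sub>C (gam a (gam b s) - gam b (gam a s))) =
      (1/2) *\<^sub>C (\<Sum>(a, b)\<leftarrow>ps. gam a (gam b s) - gam b (gam a s))" for ps
    by (induction ps) (auto simp: scaleC_add_right)
  ultimately show ?thesis by simp
qed

lemma spin_act_eq: "x \<in> h \<Longrightarrow> spin_act br h t Dp x = sp x"
proof -
  assume x: "x \<in> h"
  obtain zs where zs: "set zs = Z" "distinct zs" using finite_distinct_list[OF Z(1)] by blast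
  \<comment> \<open>On \<open>q\<close> the operator \<open>br x\<close> is half the sum of the
    \<open>rot (br x z) z\<close>: each of the two terms of \<open>rot\<close> sums to
    \<open>br x v\<close>, the second one by skewness of \<open>br x\<close>.\<close>
  define ps where "ps = map (\<lambda>z. ((1/2) *\<^sub>C br x z, z)) zs"
  have ps: "set ps \<subseteq> q \<times> q"
    using zs q_br[OF x] Z_q cvec.subspace_scale[OF q_subspace] by (auto simp: ps_def)
  have A: "br x v = (\<Sum>(a, b)\<leftarrow>ps. rot br a b v)" if v: "v \<in> q" for v
  proof -
    have "(\<Sum>(a, b)\<leftarrow>ps. rot br a b v) = (\<Sum>z\<in>Z. rot br ((1/2) *\<^sub>C br x z) z v)"
      using zs by (simp add: ps_def comp_def sum_list_distinct_conv_sum_set)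
    also have "\<dots> = (\<Sum>z\<in>Z. (1/2) *\<^sub>C (K v z *\<^sub>C br x z + K (br x v) z *\<^sub>C z))"
    proof (rule sum.cong[OF refl])
      fix z
      have "K (br x z) v = - K (br x v) z" using K_skew[of x z v] K_sym by metis
      then show "rot br ((1/2) *\<^sub>C br x z) z v = (1/2) *\<^sub>C (K v z *\<^sub>C br x z + K (br x v) z *\<^sub>C z)"
        by (simp add: rot_def K_simps scaleC_scaleC scaleC_add_right K_sym[of z v] mult.commute
            cvec.scale_minus_left[symmetric] del: cvec.scale_minus_left)
    qed
    also have "\<dots> = (1/2) *\<^sub>C (br x (\<Sum>z\<in>Z. K v z *\<^sub>C z) + (\<Sum>z\<in>Z. K (br x v) z *\<^sub>C z))"
      by (simp add: br_sum br_simps sum.distrib scaleC_add_right cvec.scale_sum_right)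
    also have "\<dots> = br x v"
      unfolding q_expand[OF v] q_expand[OF q_br[OF x v]] by (rule half_double)
    finally show ?thesis by simp
  qed
  show ?thesis
    unfolding spin_act_def spin_lift_def
  proof (rule the_equality)
    have "sp x = (\<lambda>s. \<Sum>(a, b)\<leftarrow>ps. (1/2) *\<^sub>C (gam a (gam b s) - gam b (gam a s)))"
    proof
      fix s show "sp x s = (\<Sum>(a, b)\<leftarrow>ps. (1/2) *\<^sub>C (gam a (gam b s) - gam b (gam a s)))"
        unfolding sp_def by (rule spin_lift_eq[OF ps A, symmetric])
    qed
    then show "\<exists>ps. set ps \<subseteq> q \<times> q \<and> (\<forall>v\<in>q. br x v = (\<Sum>(a, b)\<leftarrow>ps. rot br a b v)) \<and>
      sp x = (\<lambda>s. \<Sum>(a, b)\<leftarrow>ps. (1/2) *\<^sub>C (gam a (gam b s) - gam b (gam a s)))"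
      using ps A by blast
  next
    fix F
    assume "\<exists>ps. set ps \<subseteq> q \<times> q \<and> (\<forall>v\<in>q. br x v = (\<Sum>(a, b)\<leftarrow>ps. rot br a b v)) \<and>
      F = (\<lambda>s. \<Sum>(a, b)\<leftarrow>ps. (1/2) *\<^sub>C (gam a (gam b s) - gam b (gam a s)))"
    then obtain rs where rs: "set rs \<subseteq> q \<times> q" "\<And>v. v \<in> q \<Longrightarrow> br x v = (\<Sum>(a, b)\<leftarrow>rs. rot br a b v)"
      "F = (\<lambda>s. \<Sum>(a, b)\<leftarrow>rs. (1/2) *\<^sub>C (gam a (gam b s) - gam b (gam a s)))" by blast
    show "F = sp x"
    proof
      fix s show "F s = sp x s"
        unfolding sp_def rs(3) by (rule spin_lift_eq[OF rs(1,2)])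
    qed
  qed
qed

text \<open>Moving \<open>v\<close> to the left through both Clifford factors leaves two correction
  terms, each summing to \<open>G (br x v)\<close>; they account for the factor 1/2 in
  \<open>sp\<close>.\<close>

lemma sp_G: "x \<in> h \<Longrightarrow> sp x (G v s) = G (br x v) s + G v (sp x s)"
proof -
  assume x: "x \<in> h"
  have q: "sp x (G v s) = G (br x v) s + G v (sp x s)" if v: "v \<in> q" for v
  proof -
    have "(\<Sum>z\<in>Z. G (br x z) (G z (G v s))) =
        (\<Sum>z\<in>Z. G (K v z *\<^sub>C br x z) s + G (K (br x v) z *\<^sub>C z) s + G v (G (br x z) (G z s)))"
    proof (rule sum.cong[OF refl])
      fix z assume z: "z \<in> Z"
      have "K v (br x z) = - K (br x v) z" using K_skew[of x v z] by simp
      then show "G (br x z) (G z (G v s)) =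
        G (K v z *\<^sub>C br x z) s + G (K (br x v) z *\<^sub>C z) s + G v (G (br x z) (G z s))"
        using G_swap[OF v, of z s] G_swap[OF v, of "br x z" "G z s"]
        by (simp add: G_simps G_bilinear)
    qed
    also have "\<dots> = G (br x (\<Sum>z\<in>Z. K v z *\<^sub>C z)) s + G (\<Sum>z\<in>Z. K (br x v) z *\<^sub>C z) s + G v (\<Sum>z\<in>Z. G (br x z) (G z s))"
      by (simp add: sum.distrib G_simps br_sum br_simps)
    also have "\<dots> = G (br x v) s + G (br x v) s + G v (\<Sum>z\<in>Z. G (br x z) (G z s))"
      by (simp only: q_expand[OF v] q_expand[OF q_br[OF x v]])
    finally have "sp x (G v s) = (1/2) *\<^sub>C (G (br x v) s + G (br x v) s) + (1/2) *\<^sub>C G v (\<Sum>z\<in>Z. G (br x z) (G z s))"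
      by (simp add: sp_def scaleC_add_right)
    then show ?thesis unfolding half_double by (simp add: sp_def G_bilinear)
  qed
  obtain a b where ab: "a \<in> h" "b \<in> q" "v = a + b" by (rule hq_decomp)
  show ?thesis using q[OF ab(2)] G_h[OF ab(1)] G_h[OF h_br[OF x ab(1)]] ab(3)
    by (simp add: G_bilinear br_simps)
qed

text \<open>By \<open>sp_G\<close> the element \<open>x\<close> acts on each of the two Clifford
  factors of \<open>sp y\<close>. Invariance shifts the action on the second factor to the first,
  where the Jacobi identity combines the two terms.\<close>

lemma sp_br: "x \<in> h \<Longrightarrow> y \<in> h \<Longrightarrow> sp (br x y) s = sp x (sp y s) - sp y (sp x s)"
proof -
  assume x: "x \<in> h" and y: "y \<in> h"
  have inv: "(\<Sum>z\<in>Z. G (br y (br x z)) (G z s)) = - (\<Sum>z\<in>Z. G (br y z) (G (br x z) s))"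
    by (rule dual_inv[OF dual_q, of "\<lambda>u v. G (br y u) (G v s)"])
       (auto simp: bilin_def clinear_iff G_bilinear br_simps q_br[OF x] K_skew)
  have "sp x (sp y s) = (1/2) *\<^sub>C (\<Sum>z\<in>Z. sp x (G (br y z) (G z s)))"
    by (simp add: sp_def[of y] sp_simps sp_bilinear)
  also have "\<dots> = (1/2) *\<^sub>C ((\<Sum>z\<in>Z. G (br x (br y z)) (G z s)) + (\<Sum>z\<in>Z. G (br y z) (G (br x z) s)))
      + (1/2) *\<^sub>C (\<Sum>z\<in>Z. G (br y z) (G z (sp x s)))"
    by (simp add: sp_G[OF x] G_bilinear sum.distrib scaleC_add_right add.assoc)
  also have "(\<Sum>z\<in>Z. G (br y z) (G (br x z) s)) = - (\<Sum>z\<in>Z. G (br y (br x z)) (G z s))"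
    using inv by simp
  also have "(1/2) *\<^sub>C (\<Sum>z\<in>Z. G (br y z) (G z (sp x s))) = sp y (sp x s)" by (simp add: sp_def)
  also have "(\<Sum>z\<in>Z. G (br x (br y z)) (G z s)) + - (\<Sum>z\<in>Z. G (br y (br x z)) (G z s)) =
      (\<Sum>z\<in>Z. G (br (br x y) z) (G z s))"
    by (simp add: br_br G_simps sum_subtractf)
  also have "(1/2) *\<^sub>C \<dots> = sp (br x y) s" by (simp add: sp_def)
  finally show ?thesis by simp
qed

text \<open>The cubic element with one summation carried out: the coefficients
  \<open>K x (br y z)\<close> are the coordinates of the \<open>q\<close>-part of
  \<open>br y z\<close>.\<close>

definition gc :: "'g ext \<Rightarrow> 'g ext" where
  "gc s = (1/6) *\<^sub>C (\<Sum>y\<in>Z. \<Sum>z\<in>Z. G (br y z) (G y (G z s)))"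

lemma gamma_c_eq: "gamma_c br h t Dp Z = gc"
proof
  fix s
  have "(\<Sum>x\<in>Z. \<Sum>y\<in>Z. \<Sum>z\<in>Z. K x (br y z) *\<^sub>C gam x (gam y (gam z s))) =
    (\<Sum>x\<in>Z. \<Sum>y\<in>Z. \<Sum>z\<in>Z. K (br y z) x *\<^sub>C G x (G y (G z s)))"
    by (intro sum.cong refl) (simp add: gam_eq_G Z_q K_sym)
  also have "\<dots> = (\<Sum>y\<in>Z. \<Sum>x\<in>Z. \<Sum>z\<in>Z. K (br y z) x *\<^sub>C G x (G y (G z s)))" by (rule sum.swap)
  also have "\<dots> = (\<Sum>y\<in>Z. \<Sum>z\<in>Z. \<Sum>x\<in>Z. K (br y z) x *\<^sub>C G x (G y (G z s)))"
    by (intro sum.cong refl sum.swap)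
  finally show "gamma_c br h t Dp Z s = gc s" unfolding gamma_c_def gc_def G_expand by simp
qed

lemma gc_clinear: "clinear gc"
  by (simp add: clinear_iff gc_def G_bilinear sum.distrib scaleC_add_right cvec.scale_sum_right[symmetric]
      scaleC_scaleC mult.commute)

lemmas gc_simps = clinear_simps[OF gc_clinear]

text \<open>\<open>sp x\<close> acts as a derivation on the three Clifford factors. Invariance turns
  its effect on the second and third factor into brackets inside the first, and the three terms
  cancel by the Jacobi identity.\<close>

lemma sp_gc: "x \<in> h \<Longrightarrow> sp x (gc s) = gc (sp x s)"
proof -
  assume x: "x \<in> h"
  have "(\<Sum>y\<in>Z. \<Sum>z\<in>Z. sp x (G (br y z) (G y (G z s)))) =
    (\<Sum>y\<in>Z. \<Sum>z\<in>Z. G (br x (br y z)) (G y (G z s)) + G (br y z) (G (br x y) (G z s))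
       + G (br y z) (G y (G (br x z) s)) + G (br y z) (G y (G z (sp x s))))"
    by (simp add: sp_G[OF x] G_bilinear add.assoc)
  also have "\<dots> = (\<Sum>y\<in>Z. \<Sum>z\<in>Z. G (br x (br y z)) (G y (G z s)))
      + (\<Sum>y\<in>Z. \<Sum>z\<in>Z. G (br y z) (G (br x y) (G z s)))
      + (\<Sum>y\<in>Z. \<Sum>z\<in>Z. G (br y z) (G y (G (br x z) s)))
      + (\<Sum>y\<in>Z. \<Sum>z\<in>Z. G (br y z) (G y (G z (sp x s))))"
    by (simp add: sum.distrib)
  also have "(\<Sum>y\<in>Z. \<Sum>z\<in>Z. G (br y z) (G y (G (br x z) s))) =
      - (\<Sum>y\<in>Z. \<Sum>z\<in>Z. G (br y (br x z)) (G y (G z s)))"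
  proof -
    have "(\<Sum>z\<in>Z. G (br y (br x z)) (G y (G z s))) = - (\<Sum>z\<in>Z. G (br y z) (G y (G (br x z) s)))" for y
      by (rule dual_inv[OF dual_q, of "\<lambda>u v. G (br y u) (G y (G v s))"])
         (auto simp: bilin_def clinear_iff G_bilinear br_simps q_br[OF x] K_skew)
    then show ?thesis by (simp add: sum_negf)
  qed
  also have "(\<Sum>y\<in>Z. \<Sum>z\<in>Z. G (br y z) (G (br x y) (G z s))) =
      - (\<Sum>y\<in>Z. \<Sum>z\<in>Z. G (br (br x y) z) (G y (G z s)))"
  proof -
    have "(\<Sum>y\<in>Z. G (br (br x y) z) (G y (G z s))) = - (\<Sum>y\<in>Z. G (br y z) (G (br x y) (G z s)))" for z
      by (rule dual_inv[OF dual_q, of "\<lambda>u v. G (br u z) (G v (G z s))"])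
         (auto simp: bilin_def clinear_iff G_bilinear br_simps q_br[OF x] K_skew)
    then show ?thesis by (subst (1 2) sum.swap) (simp add: sum_negf)
  qed
  also have "(\<Sum>y\<in>Z. \<Sum>z\<in>Z. G (br x (br y z)) (G y (G z s))) =
     (\<Sum>y\<in>Z. \<Sum>z\<in>Z. G (br (br x y) z) (G y (G z s))) + (\<Sum>y\<in>Z. \<Sum>z\<in>Z. G (br y (br x z)) (G y (G z s)))"
    unfolding sum.distrib[symmetric] br_br by (simp add: G_simps)
  finally show ?thesis by (simp add: gc_def sp_bilinear sp_simps)
qed

lemma sum_K_GG:
  "(\<Sum>y\<in>Z. \<Sum>z\<in>Z. K x (br y z) *\<^sub>C G y (G z s)) = (\<Sum>z\<in>Z. G (br z x) (G z s))"
proof -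
  have "(\<Sum>y\<in>Z. \<Sum>z\<in>Z. K x (br y z) *\<^sub>C G y (G z s)) = (\<Sum>z\<in>Z. \<Sum>y\<in>Z. K x (br y z) *\<^sub>C G y (G z s))"
    by (rule sum.swap)
  also have "\<dots> = (\<Sum>z\<in>Z. \<Sum>y\<in>Z. K (br z x) y *\<^sub>C G y (G z s))"
  proof (intro sum.cong refl)
    fix y z
    have "K x (br y z) = K (br z x) y"
      using K_inv[of y z x] K_sym[of "br y z" x] K_sym[of y "br z x"] by simp
    then show "K x (br y z) *\<^sub>C G y (G z s) = K (br z x) y *\<^sub>C G y (G z s)" by simp
  qed
  finally show ?thesis by (simp add: G_expand)
qed

text \<open>For \<open>x\<close> in \<open>h\<close>, this converts the \<open>h\<close>-components
  of the brackets occurring in the square of \<open>D\<close> into the spin action.\<close>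

lemma sum_K_GG_sp: "(\<Sum>y\<in>Z. \<Sum>z\<in>Z. K x (br y z) *\<^sub>C G y (G z s)) = - (2 *\<^sub>C sp x s)"
proof -
  have "(\<Sum>z\<in>Z. G (br z x) (G z s)) = - (\<Sum>z\<in>Z. G (br x z) (G z s))"
    unfolding sum_negf[symmetric] by (intro sum.cong refl) (metis G_simps(2) br_anti)
  then show ?thesis unfolding sum_K_GG by (simp add: sp_def scaleC_scaleC scaleC_one)
qed

text \<open>Moving \<open>l\<close> through three Clifford factors produces three contractions, each
  equal to the right side, and 3/6 is one half. The normalization 1/6 of the cubic element is thus
  the one that cancels the \<open>q\<close>-components of brackets in the square of
  \<open>D\<close>.\<close>

lemma gc_anticommute:
  assumes l: "l \<in> q"
  shows "2 *\<^sub>C (G l (gc s) + gc (G l s)) = (\<Sum>y\<in>Z. \<Sum>z\<in>Z. K l (br y z) *\<^sub>C G y (G z s))"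
proof -
  let ?W = "\<Sum>y\<in>Z. \<Sum>z\<in>Z. K l (br y z) *\<^sub>C G y (G z s)"
  have tm: "G l (G (br y z) (G y (G z s))) + G (br y z) (G y (G z (G l s))) =
     K l (br y z) *\<^sub>C G y (G z s) - K l y *\<^sub>C G (br y z) (G z s) + K l z *\<^sub>C G (br y z) (G y s)" for y z
    using G_swap[OF l, of z s] G_swap[OF l, of y "G z s"] G_swap[OF l, of "br y z" "G y (G z s)"]
    by (simp add: G_bilinear G_simps)
  have s1: "(\<Sum>y\<in>Z. \<Sum>z\<in>Z. K l y *\<^sub>C G (br y z) (G z s)) = - ?W"
  proof -
    have "(\<Sum>y\<in>Z. \<Sum>z\<in>Z. K l y *\<^sub>C G (br y z) (G z s)) = (\<Sum>z\<in>Z. \<Sum>y\<in>Z. K l y *\<^sub>C G (br y z) (G z s))"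
      by (rule sum.swap)
    also have "\<dots> = (\<Sum>z\<in>Z. G (br (\<Sum>y\<in>Z. K l y *\<^sub>C y) z) (G z s))"
      by (simp add: br_sum br_simps G_simps G_bilinear)
    also have "\<dots> = (\<Sum>z\<in>Z. G (br l z) (G z s))" by (simp only: q_expand[OF l])
    also have "\<dots> = - (\<Sum>z\<in>Z. G (br z l) (G z s))"
      unfolding sum_negf[symmetric] by (intro sum.cong refl) (metis G_simps(2) br_anti)
    finally show ?thesis unfolding sum_K_GG .
  qed
  have s2: "(\<Sum>y\<in>Z. \<Sum>z\<in>Z. K l z *\<^sub>C G (br y z) (G y s)) = ?W"
  proof -
    have "(\<Sum>y\<in>Z. \<Sum>z\<in>Z. K l z *\<^sub>C G (br y z) (G y s)) = (\<Sum>y\<in>Z. G (br y (\<Sum>z\<in>Z. K l z *\<^sub>C z)) (G y s))"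
      by (simp add: br_sum br_simps G_simps G_bilinear)
    also have "\<dots> = (\<Sum>y\<in>Z. G (br y l) (G y s))" by (simp only: q_expand[OF l])
    finally show ?thesis unfolding sum_K_GG .
  qed
  have "G l (gc s) + gc (G l s) = (1/6) *\<^sub>C (\<Sum>y\<in>Z. \<Sum>z\<in>Z.
      G l (G (br y z) (G y (G z s))) + G (br y z) (G y (G z (G l s))))"
    by (simp add: gc_def G_bilinear G_simps sum.distrib scaleC_add_right)
  also have "\<dots> = (1/6) *\<^sub>C (?W - (- ?W) + ?W)"
    unfolding tm sum.distrib sum_subtractf s1 s2 by (rule refl)
  also have "?W - (- ?W) + ?W = 3 *\<^sub>C ?W"
    by (simp add: scaleC_add_left[of 1 2 ?W, simplified] scaleC_add_left[of 1 1 ?W, simplified] scaleC_one)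
  finally show ?thesis by (simp add: scaleC_scaleC scaleC_one)
qed

end

section \<open>The Dirac operator, its equivariance and its square\<close>

locale dirac_module = dirac_setting br h t Z Dp
  for br :: "'g::complex_vec \<Rightarrow> 'g \<Rightarrow> 'g" and h t Z Dp +
  fixes \<rho> :: "'g \<Rightarrow> 'm::complex_vec \<Rightarrow> 'm"
  assumes \<rho>_clinear: "clinear (\<rho> x)"
    and \<rho>_add: "\<rho> (x + y) m = \<rho> x m + \<rho> y m" and \<rho>_scale: "\<rho> (c *\<^sub>C x) m = c *\<^sub>C \<rho> x m"
    and \<rho>_br: "\<rho> (br x y) m = \<rho> x (\<rho> y m) - \<rho> y (\<rho> x m)"
begin

lemma \<rho>_clinear1: "clinear (\<lambda>x. \<rho> x m)"
  by (simp add: clinear_iff \<rho>_add \<rho>_scale)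

lemmas \<rho>_simps = clinear_simps[OF \<rho>_clinear] clinear_simps[OF \<rho>_clinear1]

abbreviation "D \<equiv> dirac br h t Dp \<rho> Z"
abbreviation "diag \<equiv> diag_act br h t Dp \<rho>"

lemma id_clinear: "clinear id" by (simp add: clinear_iff)

lemma D_clinear: "clinear D"
proof -
  have "clinear (tensor_map (\<rho> z) (gam z))" for z by (rule tensor_map(1)[OF \<rho>_clinear gam_clinear])
  moreover have "clinear (tensor_map id (gamma_c br h t Dp Z) :: ('m, 'g ext) tensor \<Rightarrow> _)"
    unfolding gamma_c_eq by (rule tensor_map(1)[OF id_clinear gc_clinear])
  ultimately show ?thesis
    unfolding dirac_def clinear_iff
    by (simp add: sum.distrib cvec.scale_sum_right cvec.scale_right_diff_distrib)
qed

lemma D_tens: "D (tens m s) = (\<Sum>z\<in>Z. tens (\<rho> z m) (G z s)) - tens m (gc s)"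
proof -
  have "tensor_map (\<rho> z) (gam z) (tens m s) = tens (\<rho> z m) (gam z s)" for z
    by (rule tensor_map(2)[OF \<rho>_clinear gam_clinear])
  moreover have "tensor_map id gc (tens m s) = tens (id m) (gc s)"
    by (rule tensor_map(2)[OF id_clinear gc_clinear])
  ultimately show ?thesis by (simp add: dirac_def gamma_c_eq gam_eq_G Z_q)
qed

lemmas D_simps = clinear_simps[OF D_clinear]

lemma diag_clinear: "x \<in> h \<Longrightarrow> clinear (diag x)"
proof -
  assume x: "x \<in> h"
  have "clinear (tensor_map (\<rho> x) id :: ('m, 'g ext) tensor \<Rightarrow> _)" by (rule tensor_map(1)[OF \<rho>_clinear id_clinear])
  moreover have "clinear (tensor_map id (sp x) :: ('m, 'g ext) tensor \<Rightarrow> _)"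
    by (rule tensor_map(1)[OF id_clinear sp_clinear])
  ultimately show ?thesis
    unfolding diag_act_def clinear_iff spin_act_eq[OF x] by (simp add: scaleC_add_right)
qed

lemma diag_tens: "x \<in> h \<Longrightarrow> diag x (tens m s) = tens (\<rho> x m) s + tens m (sp x s)"
  using tensor_map(2)[OF \<rho>_clinear id_clinear, of x m s] tensor_map(2)[OF id_clinear sp_clinear, of x m s]
  by (simp add: diag_act_def spin_act_eq)

lemmas diag_simps = clinear_simps[OF diag_clinear]

lemma diag_linear_left:
  assumes "x \<in> h" "y \<in> h"
  shows "diag (x + y) u = diag x u + diag y u" "diag (c *\<^sub>C x) u = c *\<^sub>C diag x u"
    "diag (br x y) u = diag x (diag y u) - diag y (diag x u)"
proof -
  have xy: "x + y \<in> h" "c *\<^sub>C x \<in> h" "br x y \<in> h"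
    using assms h_subspace h_br by (simp_all add: cvec.subspace_add cvec.subspace_scale)
  show "diag (x + y) u = diag x u + diag y u"
    by (rule tensor_linear_eq[where G = "\<lambda>u. diag x u + diag y u"])
       (use assms xy in \<open>auto simp: clinear_iff diag_simps diag_tens sp_bilinear \<rho>_simps tens_bilinear scaleC_add_right\<close>)
  show "diag (c *\<^sub>C x) u = c *\<^sub>C diag x u"
    by (rule tensor_linear_eq[where G = "\<lambda>u. c *\<^sub>C diag x u"])
       (use assms xy in \<open>auto simp: clinear_iff diag_simps diag_tens sp_bilinear \<rho>_simps tens_bilinear scaleC_add_right
         scaleC_scaleC mult.commute\<close>)
  show "diag (br x y) u = diag x (diag y u) - diag y (diag x u)"
    by (rule tensor_linear_eq[where G = "\<lambda>u. diag x (diag y u) - diag y (diag x u)"])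
       (use assms xy in \<open>auto simp: clinear_iff diag_simps diag_tens sp_br \<rho>_br tens_bilinear tens_simps
         cvec.scale_right_diff_distrib\<close>)
qed

text \<open>The first sum in \<open>D\<close> is the canonical tensor of \<open>q\<close>, which is
  invariant under \<open>h\<close> by \<open>dual_inv\<close>; the cubic term is invariant by
  \<open>sp_gc\<close>.\<close>

lemma diag_D: "x \<in> h \<Longrightarrow> diag x (D u) = D (diag x u)"
proof (rule tensor_linear_eq[where F = "\<lambda>u. diag x (D u)" and G = "\<lambda>u. D (diag x u)"])
  assume x: "x \<in> h"
  show "clinear (\<lambda>u. diag x (D u))" "clinear (\<lambda>u. D (diag x u))"
    using x by (simp_all add: clinear_iff D_simps diag_simps)
  fix m s
  have inv: "(\<Sum>z\<in>Z. tens (\<rho> (br x z) m) (G z s)) = - (\<Sum>z\<in>Z. tens (\<rho> z m) (G (br x z) s))"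
    by (rule dual_inv[OF dual_q, of "\<lambda>u v. tens (\<rho> u m) (G v s)"])
       (auto simp: bilin_def clinear_iff \<rho>_add \<rho>_scale tens_bilinear G_bilinear q_br[OF x] K_skew)
  have "diag x (D (tens m s)) = (\<Sum>z\<in>Z. tens (\<rho> x (\<rho> z m)) (G z s) + tens (\<rho> z m) (sp x (G z s)))
      - (tens (\<rho> x m) (gc s) + tens m (sp x (gc s)))"
    using x by (simp add: D_tens diag_simps diag_tens)
  also have "\<dots> = (\<Sum>z\<in>Z. tens (\<rho> (br x z) m) (G z s)) + (\<Sum>z\<in>Z. tens (\<rho> z m) (G (br x z) s)) +
      (\<Sum>z\<in>Z. tens (\<rho> z (\<rho> x m)) (G z s)) + (\<Sum>z\<in>Z. tens (\<rho> z m) (G z (sp x s)))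
      - tens (\<rho> x m) (gc s) - tens m (gc (sp x s))"
    by (simp add: sp_G[OF x] sp_gc[OF x] \<rho>_br tens_simps tens_bilinear sum.distrib sum_subtractf)
  also have "\<dots> = D (diag x (tens m s))"
    unfolding inv using x by (simp add: D_tens diag_tens D_simps)
  finally show "diag x (D (tens m s)) = D (diag x (tens m s))" .
qed

text \<open>If \<open>B\<close> and \<open>d ` B\<close> are dual bases of \<open>h\<close>, then \<open>Cas B d\<close> is the Casimir element of the whole Lie
  algebra and \<open>Cdiag B d\<close> the one of \<open>h\<close> for the diagonal action.\<close>

definition Cas :: "'g set \<Rightarrow> ('g \<Rightarrow> 'g) \<Rightarrow> 'm \<Rightarrow> 'm" where
  "Cas B d m = (\<Sum>b\<in>B. \<rho> b (\<rho> (d b) m)) + (\<Sum>z\<in>Z. \<rho> z (\<rho> z m))"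

definition Tsp :: "'g set \<Rightarrow> ('g \<Rightarrow> 'g) \<Rightarrow> 'g ext \<Rightarrow> 'g ext" where
  "Tsp B d s = 2 *\<^sub>C gc (gc s) + (\<Sum>b\<in>B. sp b (sp (d b) s))"

lemma Cas_clinear: "clinear (Cas B d)"
  by (simp add: clinear_iff Cas_def \<rho>_simps sum.distrib scaleC_add_right cvec.scale_sum_right)

lemma Tsp_clinear: "clinear (Tsp B d)"
  by (simp add: clinear_iff Tsp_def gc_simps sp_bilinear sum.distrib scaleC_add_right cvec.scale_sum_right
      scaleC_scaleC mult.commute)

text \<open>In the combined dual bases of \<open>dual_g\<close> the operator comes from the
  canonical tensor of the whole Lie algebra, for which every \<open>br x\<close> is skew.\<close>

lemma Cas_central:
  assumes D: "dual_on h B d"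
  shows "\<rho> x (Cas B d m) = Cas B d (\<rho> x m)"
proof -
  note dg = dual_g[OF D]
  let ?d = "\<lambda>b. if b \<in> Z then b else d b"
  have Cas: "Cas B d m = (\<Sum>b\<in>B \<union> Z. \<rho> b (\<rho> (?d b) m))" for m
  proof -
    have "(\<Sum>b\<in>B. \<rho> b (\<rho> (?d b) m)) = (\<Sum>b\<in>B. \<rho> b (\<rho> (d b) m))"
      by (rule sum.cong) (use dg(1) in auto)
    moreover have "(\<Sum>b\<in>B \<union> Z. \<rho> b (\<rho> (?d b) m)) =
        (\<Sum>b\<in>B. \<rho> b (\<rho> (?d b) m)) + (\<Sum>b\<in>Z. \<rho> b (\<rho> (?d b) m))"
      by (rule sum.union_disjoint) (use dg(1) dual_onD(1)[OF D] Z(1) in auto)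
    ultimately show ?thesis by (simp add: Cas_def)
  qed
  have inv: "(\<Sum>b\<in>B \<union> Z. \<rho> (br x b) (\<rho> (?d b) m)) = - (\<Sum>b\<in>B \<union> Z. \<rho> b (\<rho> (br x (?d b)) m))"
    by (rule dual_inv[OF dg(2), of "\<lambda>u v. \<rho> u (\<rho> v m)"])
       (auto simp: bilin_def clinear_iff \<rho>_simps K_skew)
  have "\<rho> x (Cas B d m) = (\<Sum>b\<in>B \<union> Z. \<rho> x (\<rho> b (\<rho> (?d b) m)))" by (simp only: Cas \<rho>_simps)
  also have "\<dots> = (\<Sum>b\<in>B \<union> Z. \<rho> (br x b) (\<rho> (?d b) m)) + (\<Sum>b\<in>B \<union> Z. \<rho> b (\<rho> (br x (?d b)) m))
     + (\<Sum>b\<in>B \<union> Z. \<rho> b (\<rho> (?d b) (\<rho> x m)))"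
    unfolding sum.distrib[symmetric] by (intro sum.cong refl) (simp only: \<rho>_br \<rho>_simps, simp)
  also have "\<dots> = Cas B d (\<rho> x m)" unfolding inv Cas by simp
  finally show ?thesis .
qed

definition Rop :: "'g set \<Rightarrow> ('g \<Rightarrow> 'g) \<Rightarrow> ('m, 'g ext) tensor \<Rightarrow> ('m, 'g ext) tensor" where
  "Rop B d u = tensor_map (Cas B d) id u + tensor_map id (Tsp B d) u"

definition Cdiag :: "'g set \<Rightarrow> ('g \<Rightarrow> 'g) \<Rightarrow> ('m, 'g ext) tensor \<Rightarrow> ('m, 'g ext) tensor" where
  "Cdiag B d u = (\<Sum>b\<in>B. diag b (diag (d b) u))"

lemma Rop_tens: "Rop B d (tens m s) = tens (Cas B d m) s + tens m (Tsp B d s)"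
  unfolding Rop_def using tensor_map(2)[OF Cas_clinear id_clinear, of B d m s]
    tensor_map(2)[OF id_clinear Tsp_clinear, of B d m s] by simp

lemma Rop_clinear: "clinear (Rop B d)"
proof -
  have "clinear (tensor_map (Cas B d) id :: ('m, 'g ext) tensor \<Rightarrow> _)"
    by (rule tensor_map(1)[OF Cas_clinear id_clinear])
  moreover have "clinear (tensor_map id (Tsp B d) :: ('m, 'g ext) tensor \<Rightarrow> _)"
    by (rule tensor_map(1)[OF id_clinear Tsp_clinear])
  ultimately show ?thesis by (simp add: clinear_iff Rop_def scaleC_add_right)
qed

text \<open>The Parthasarathy--Kostant formula for the square of the Dirac operator, up to the
  evaluation of the remainder on the spin module, which is a scalar in fact.\<close>

lemma D_square:
  assumes dual: "dual_on h B d"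
  shows "2 *\<^sub>C D (D u) = Rop B d u - Cdiag B d u"
proof (rule tensor_linear_eq[where F = "\<lambda>u. 2 *\<^sub>C D (D u)" and G = "\<lambda>u. Rop B d u - Cdiag B d u"])
  note dh = dual_onD(2,3)[OF dual]
  have Cd: "clinear (Cdiag B d)"
    unfolding clinear_iff Cdiag_def using dh
    by (simp add: diag_simps sum.distrib scaleC_add_right cvec.scale_sum_right)
  show "clinear (\<lambda>u. 2 *\<^sub>C D (D u))"
    by (simp add: clinear_iff D_simps scaleC_add_right scaleC_scaleC mult.commute)
  show "clinear (\<lambda>u. Rop B d u - Cdiag B d u)"
    using clinear_simps[OF Cd] clinear_simps[OF Rop_clinear]
    by (simp add: clinear_iff cvec.scale_right_diff_distrib)
  fix m s
  have two: "2 *\<^sub>C x = x + x" for x :: "('m, 'g ext) tensor"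
    using scaleC_add_left[of 1 1 x] by (simp add: scaleC_one)
  let ?T1 = "\<Sum>y\<in>Z. \<Sum>z\<in>Z. tens (\<rho> y (\<rho> z m)) (G y (G z s))"
  let ?A = "\<Sum>z\<in>Z. tens (\<rho> z m) (G z (gc s) + gc (G z s))"
  let ?H = "\<Sum>b\<in>B. tens (\<rho> b m) (sp (d b) s)"
  have DD: "D (D (tens m s)) = ?T1 - ?A + tens m (gc (gc s))"
  proof -
    have "D (D (tens m s)) = (\<Sum>z\<in>Z. (\<Sum>y\<in>Z. tens (\<rho> y (\<rho> z m)) (G y (G z s))) - tens (\<rho> z m) (gc (G z s)))
       - ((\<Sum>z\<in>Z. tens (\<rho> z m) (G z (gc s))) - tens m (gc (gc s)))"
      by (simp only: D_tens D_simps)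
    also have "\<dots> = (\<Sum>z\<in>Z. \<Sum>y\<in>Z. tens (\<rho> y (\<rho> z m)) (G y (G z s))) - ?A + tens m (gc (gc s))"
      by (simp add: sum_subtractf tens_bilinear sum.distrib)
    also have "(\<Sum>z\<in>Z. \<Sum>y\<in>Z. tens (\<rho> y (\<rho> z m)) (G y (G z s))) = ?T1" by (rule sum.swap)
    finally show ?thesis .
  qed
  \<comment> \<open>In one of the two copies the summation indices are exchanged and the Clifford
    factors put back in order. The action on \<open>m\<close> becomes a commutator, and the diagonal
    terms yield the \<open>q\<close>-part of the Casimir element.\<close>
  have T1: "?T1 + ?T1 = (\<Sum>y\<in>Z. \<Sum>z\<in>Z. tens (\<rho> (br y z) m) (G y (G z s))) + (\<Sum>z\<in>Z. tens (\<rho> z (\<rho> z m)) s)"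
  proof -
    have "?T1 = (\<Sum>y\<in>Z. \<Sum>z\<in>Z. tens (\<rho> z (\<rho> y m)) (G z (G y s)))" by (rule sum.swap)
    also have "\<dots> = (\<Sum>y\<in>Z. \<Sum>z\<in>Z. (if z = y then tens (\<rho> y (\<rho> y m)) s else 0) - tens (\<rho> z (\<rho> y m)) (G y (G z s)))"
    proof (intro sum.cong refl)
      fix y z assume yz: "y \<in> Z" "z \<in> Z"
      have "G z (G y s) = (if z = y then s else 0) - G y (G z s)"
        using G_swap[OF Z_q[OF yz(1)], of z s] Z(4)[OF yz] by (simp add: scaleC_one)
      then show "tens (\<rho> z (\<rho> y m)) (G z (G y s)) =
          (if z = y then tens (\<rho> y (\<rho> y m)) s else 0) - tens (\<rho> z (\<rho> y m)) (G y (G z s))"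
        by (simp add: tens_simps)
    qed
    also have "\<dots> = (\<Sum>z\<in>Z. tens (\<rho> z (\<rho> z m)) s) - (\<Sum>y\<in>Z. \<Sum>z\<in>Z. tens (\<rho> z (\<rho> y m)) (G y (G z s)))"
      using Z(1) by (simp add: sum_subtractf)
    finally have "?T1 + ?T1 = ?T1 + ((\<Sum>z\<in>Z. tens (\<rho> z (\<rho> z m)) s) - (\<Sum>y\<in>Z. \<Sum>z\<in>Z. tens (\<rho> z (\<rho> y m)) (G y (G z s))))"
      by simp
    then show ?thesis by (simp add: \<rho>_br tens_simps sum_subtractf)
  qed
  \<comment> \<open>Each bracket is split into its components in \<open>h\<close> and
    \<open>q\<close>. The latter produce \<open>?A + ?A\<close>, which cancels the cross term of
    \<open>DD\<close>; the former produce the mixed terms of \<open>- Cdiag\<close>.\<close>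
  have T2: "(\<Sum>y\<in>Z. \<Sum>z\<in>Z. tens (\<rho> (br y z) m) (G y (G z s))) = (?A + ?A) - (?H + ?H)"
  proof -
    have exp: "br y z = (\<Sum>b\<in>B. K (d b) (br y z) *\<^sub>C b) + (\<Sum>l\<in>Z. K l (br y z) *\<^sub>C l)" for y z
    proof -
      have "br y z - (\<Sum>b\<in>B. K (br y z) (d b) *\<^sub>C b) = (\<Sum>l\<in>Z. K (br y z - (\<Sum>b\<in>B. K (br y z) (d b) *\<^sub>C b)) l *\<^sub>C l)"
        using q_expand[OF dual_h_decomp(2)[OF dual]] by simp
      also have "\<dots> = (\<Sum>l\<in>Z. K (br y z) l *\<^sub>C l)"
        by (rule sum.cong) (use q_h_orth(2)[OF dual_h_decomp(1)[OF dual] Z_q] in \<open>simp_all add: K_simps\<close>)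
      finally show ?thesis by (simp add: K_sym algebra_simps)
    qed
    have "(\<Sum>y\<in>Z. \<Sum>z\<in>Z. tens (\<rho> (br y z) m) (G y (G z s))) =
      (\<Sum>y\<in>Z. \<Sum>z\<in>Z. (\<Sum>b\<in>B. tens (\<rho> b m) (K (d b) (br y z) *\<^sub>C G y (G z s))) +
        (\<Sum>l\<in>Z. tens (\<rho> l m) (K l (br y z) *\<^sub>C G y (G z s))))"
      by (intro sum.cong refl, subst exp) (simp add: \<rho>_simps tens_simps tens_bilinear)
    also have "\<dots> = (\<Sum>b\<in>B. tens (\<rho> b m) (\<Sum>y\<in>Z. \<Sum>z\<in>Z. K (d b) (br y z) *\<^sub>C G y (G z s))) +
        (\<Sum>l\<in>Z. tens (\<rho> l m) (\<Sum>y\<in>Z. \<Sum>z\<in>Z. K l (br y z) *\<^sub>C G y (G z s)))"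
    proof -
      have sw: "(\<Sum>y\<in>Z. \<Sum>z\<in>Z. \<Sum>b\<in>C. f y z b) = (\<Sum>b\<in>C. \<Sum>y\<in>Z. \<Sum>z\<in>Z. f y z b)"
        for f :: "'g \<Rightarrow> 'g \<Rightarrow> 'g \<Rightarrow> ('m, 'g ext) tensor" and C
      proof -
        have "(\<Sum>y\<in>Z. \<Sum>z\<in>Z. \<Sum>b\<in>C. f y z b) = (\<Sum>y\<in>Z. \<Sum>b\<in>C. \<Sum>z\<in>Z. f y z b)"
          by (intro sum.cong refl sum.swap)
        also have "\<dots> = (\<Sum>b\<in>C. \<Sum>y\<in>Z. \<Sum>z\<in>Z. f y z b)" by (rule sum.swap)
        finally show ?thesis .
      qed
      show ?thesis unfolding sum.distrib tens_simps(8) by (rule arg_cong2[of _ _ _ _ "(+)"]; rule sw)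
    qed
    also have "(\<Sum>l\<in>Z. tens (\<rho> l m) (\<Sum>y\<in>Z. \<Sum>z\<in>Z. K l (br y z) *\<^sub>C G y (G z s))) = ?A + ?A"
    proof -
      have "tens (\<rho> l m) (\<Sum>y\<in>Z. \<Sum>z\<in>Z. K l (br y z) *\<^sub>C G y (G z s)) =
          tens (\<rho> l m) (G l (gc s) + gc (G l s)) + tens (\<rho> l m) (G l (gc s) + gc (G l s))" if "l \<in> Z" for l
        unfolding gc_anticommute[OF Z_q[OF that], symmetric] by (simp only: tens_bilinear(4) two)
      then show ?thesis by (simp add: sum.distrib)
    qed
    also have "(\<Sum>b\<in>B. tens (\<rho> b m) (\<Sum>y\<in>Z. \<Sum>z\<in>Z. K (d b) (br y z) *\<^sub>C G y (G z s))) = - (?H + ?H)"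
    proof -
      have "tens (\<rho> b m) (- (2 *\<^sub>C sp (d b) s)) = - (tens (\<rho> b m) (sp (d b) s) + tens (\<rho> b m) (sp (d b) s))" for b
        by (simp only: tens_simps(6) tens_bilinear(4) two)
      then show ?thesis unfolding sum_K_GG_sp by (simp add: sum.distrib sum_negf sum_subtractf)
    qed
    finally show ?thesis by simp
  qed
  have Cd: "Cdiag B d (tens m s) = (\<Sum>b\<in>B. tens (\<rho> b (\<rho> (d b) m)) s) + (?H + ?H) + (\<Sum>b\<in>B. tens m (sp b (sp (d b) s)))"
  proof -
    have "(\<Sum>b\<in>B. tens (\<rho> b m) (sp (d b) s)) = (\<Sum>b\<in>B. tens (\<rho> (d b) m) (sp b s))"
      by (rule dual_swap[OF dual, of "\<lambda>u v. tens (\<rho> u m) (sp v s)"])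
         (auto simp: bilin_def clinear_iff \<rho>_simps sp_bilinear tens_bilinear)
    moreover have "Cdiag B d (tens m s) = (\<Sum>b\<in>B. tens (\<rho> b (\<rho> (d b) m)) s) + (?H + (\<Sum>b\<in>B. tens (\<rho> (d b) m) (sp b s)))
       + (\<Sum>b\<in>B. tens m (sp b (sp (d b) s)))"
      unfolding Cdiag_def sum.distrib[symmetric]
      by (intro sum.cong refl) (simp add: diag_simps diag_tens dh)
    ultimately show ?thesis by simp
  qed
  have R: "Rop B d (tens m s) = (\<Sum>b\<in>B. tens (\<rho> b (\<rho> (d b) m)) s) + (\<Sum>z\<in>Z. tens (\<rho> z (\<rho> z m)) s)
      + (tens m (gc (gc s)) + tens m (gc (gc s))) + (\<Sum>b\<in>B. tens m (sp b (sp (d b) s)))"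
    unfolding Rop_tens Cas_def Tsp_def by (simp add: tens_bilinear tens_simps two)
  have "2 *\<^sub>C D (D (tens m s)) = (?T1 + ?T1) - (?A + ?A) + (tens m (gc (gc s)) + tens m (gc (gc s)))"
    unfolding DD two by simp
  also have "\<dots> = Rop B d (tens m s) - Cdiag B d (tens m s)"
    unfolding T1 T2 Cd R by (simp only: diff_conv_add_uminus minus_add_distrib minus_minus add_ac) simp
  finally show "2 *\<^sub>C D (D (tens m s)) = Rop B d (tens m s) - Cdiag B d (tens m s)" .
qed

end

section \<open>Quotient modules and the weights of the spin module\<close>

lemma cring_complex_ring: "cring complex_ring"
proof (rule cringI)
  show "abelian_group complex_ring"
    by (rule abelian_groupI) (auto simp: complex_ring_def intro: exI[of _ "- _"])
  show "comm_monoid complex_ring"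
    by (rule comm_monoidI) (auto simp: complex_ring_def)
qed (simp add: complex_ring_def algebra_simps)

lemma type_module_simps [simp]:
  "carrier (type_module \<rho>) = UNIV" "\<zero>\<^bsub>type_module \<rho>\<^esub> = 0" "x \<oplus>\<^bsub>type_module \<rho>\<^esub> y = x + y"
  "c \<odot>\<^bsub>type_module \<rho>\<^esub> x = c *\<^sub>C x" "lact (type_module \<rho>) = \<rho>"
  by (simp_all add: type_module_def)

lemma gen_submodule_type_module:
  "cvec.subspace (gen_submodule (type_module \<rho>) k F)"
  "v \<in> F \<Longrightarrow> v \<in> gen_submodule (type_module \<rho>) k F"
  "x \<in> k \<Longrightarrow> v \<in> gen_submodule (type_module \<rho>) k F \<Longrightarrow> \<rho> x v \<in> gen_submodule (type_module \<rho>) k F"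
  using gen_submodule.intros[where V = "type_module \<rho>" and k = k and F = F, simplified]
  by (auto simp: cvec.subspace_def)

lemma gen_submodule_type_module_least:
  assumes "cvec.subspace V" "F \<subseteq> V" "\<And>x v. x \<in> k \<Longrightarrow> v \<in> V \<Longrightarrow> \<rho> x v \<in> V"
  shows "gen_submodule (type_module \<rho>) k F \<subseteq> V"
proof
  fix v assume "v \<in> gen_submodule (type_module \<rho>) k F"
  then show "v \<in> V"
    by induction (use assms in \<open>auto simp: cvec.subspace_def\<close>)
qed

lemma gen_submodule_empty: "gen_submodule (type_module \<rho>) {} F = cvec.span F"
proof
  show "gen_submodule (type_module \<rho>) {} F \<subseteq> cvec.span F"
    by (rule gen_submodule_type_module_least) (auto simp: cvec.span_superset)
  show "cvec.span F \<subseteq> gen_submodule (type_module \<rho>) {} F"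
    by (rule cvec.span_minimal) (auto simp: gen_submodule_type_module)
qed

section \<open>Transfer of generators, weights and local finiteness to a quotient\<close>

locale quotient_setup =
  fixes br :: "'g::complex_vec \<Rightarrow> 'g \<Rightarrow> 'g" and k :: "'g set"
    and \<rho> :: "'g \<Rightarrow> 'v \<Rightarrow> 'v::complex_vec" and U W :: "'v set"
  assumes U: "cvec.subspace U" and W: "cvec.subspace W"
    and act_clinear: "x \<in> k \<Longrightarrow> clinear (\<rho> x)"
    and act_U: "x \<in> k \<Longrightarrow> v \<in> U \<Longrightarrow> \<rho> x v \<in> U"
    and act_W: "x \<in> k \<Longrightarrow> v \<in> W \<Longrightarrow> \<rho> x v \<in> W"
begin

abbreviation "Q \<equiv> quotient_module \<rho> U W"

definition cls :: "'v \<Rightarrow> 'v set" where "cls u = {u + w | w. w \<in> W}"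

lemma Q_carrier: "carrier Q = cls ` U"
  by (auto simp: quotient_module_def cls_def)

lemma Q_zero: "\<zero>\<^bsub>Q\<^esub> = cls 0"
  by (simp add: quotient_module_def cls_def)

lemma Q_add: "cls u \<oplus>\<^bsub>Q\<^esub> cls v = cls (u + v)"
proof -
  have "{a + b | a b. a \<in> cls u \<and> b \<in> cls v} = cls (u + v)"
  proof
    show "{a + b | a b. a \<in> cls u \<and> b \<in> cls v} \<subseteq> cls (u + v)"
    proof
      fix x assume "x \<in> {a + b | a b. a \<in> cls u \<and> b \<in> cls v}"
      then obtain w w' where w: "w \<in> W" "w' \<in> W" "x = (u + w) + (v + w')" by (auto simp: cls_def)
      then have "x = (u + v) + (w + w')" by simp
      then show "x \<in> cls (u + v)" using cvec.subspace_add[OF W w(1,2)] unfolding cls_def by blast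
    qed
    show "cls (u + v) \<subseteq> {a + b | a b. a \<in> cls u \<and> b \<in> cls v}"
    proof
      fix x assume "x \<in> cls (u + v)"
      then obtain w where w: "w \<in> W" "x = (u + v) + w" by (auto simp: cls_def)
      then have "x = (u + w) + (v + 0)" by simp
      then show "x \<in> {a + b | a b. a \<in> cls u \<and> b \<in> cls v}"
        using w cvec.subspace_0[OF W] unfolding cls_def by blast
    qed
  qed
  then show ?thesis by (simp add: quotient_module_def)
qed

lemma coset_image:
  assumes "clinear f" "\<And>w. w \<in> W \<Longrightarrow> f w \<in> W"
  shows "{f a + w | a w. a \<in> cls u \<and> w \<in> W} = cls (f u)"
proof
  show "{f a + w | a w. a \<in> cls u \<and> w \<in> W} \<subseteq> cls (f u)"
  proof
    fix x assume "x \<in> {f a + w | a w. a \<in> cls u \<and> w \<in> W}"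
    then obtain w w' where w: "w \<in> W" "w' \<in> W" "x = f (u + w) + w'" by (auto simp: cls_def)
    then have "x = f u + (f w + w')" by (simp add: clinear_simps[OF assms(1)])
    then show "x \<in> cls (f u)" using cvec.subspace_add[OF W assms(2)[OF w(1)] w(2)] unfolding cls_def by blast
  qed
  show "cls (f u) \<subseteq> {f a + w | a w. a \<in> cls u \<and> w \<in> W}"
    using cvec.subspace_0[OF W] by (force simp: cls_def)
qed

lemma Q_smult: "c \<odot>\<^bsub>Q\<^esub> cls u = cls (c *\<^sub>C u)"
proof -
  have "{c *\<^sub>C a + w | a w. a \<in> cls u \<and> w \<in> W} = cls (c *\<^sub>C u)"
    by (rule coset_image) (use W in \<open>auto simp: clinear_iff scaleC_add_right scaleC_scaleC mult.commute cvec.subspace_scale\<close>)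
  then show ?thesis by (simp add: quotient_module_def)
qed

lemma Q_lact: "x \<in> k \<Longrightarrow> lact Q x (cls u) = cls (\<rho> x u)"
  using coset_image[OF act_clinear act_W] by (simp add: quotient_module_def)

lemma Q_module: "Module.module complex_ring Q"
proof (rule moduleI)
  note U_simps = cvec.subspace_add[OF U] cvec.subspace_0[OF U] cvec.subspace_scale[OF U] cvec.subspace_neg[OF U]
  show "abelian_group Q"
  proof (rule abelian_groupI)
    fix x assume "x \<in> carrier Q"
    then obtain u where u: "u \<in> U" "x = cls u" by (auto simp: Q_carrier)
    have "cls (- u) \<oplus>\<^bsub>Q\<^esub> x = \<zero>\<^bsub>Q\<^esub>" by (simp add: u Q_add Q_zero)
    then show "\<exists>y\<in>carrier Q. y \<oplus>\<^bsub>Q\<^esub> x = \<zero>\<^bsub>Q\<^esub>"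
      using u by (intro bexI[of _ "cls (- u)"]) (auto simp: Q_carrier U_simps)
  qed (auto simp: Q_carrier Q_add Q_zero U_simps add_ac)
qed (auto simp: Q_carrier Q_add Q_smult complex_ring_def scaleC_add_left scaleC_add_right scaleC_scaleC
    scaleC_one cvec.subspace_scale[OF U] cring_complex_ring[unfolded complex_ring_def])

lemma Q_minus:
  assumes "u \<in> U" "v \<in> U"
  shows "cls u \<ominus>\<^bsub>Q\<^esub> cls v = cls (u - v)"
proof -
  interpret abelian_group Q by (rule module.axioms(2)[OF Q_module])
  have "\<ominus>\<^bsub>Q\<^esub> cls v = cls (- v)"
    by (rule minus_equality)
       (use assms in \<open>auto simp: Q_add Q_zero Q_carrier cvec.subspace_neg[OF U]\<close>)
  then show ?thesis by (simp add: a_minus_def Q_add)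
qed

lemma Q_is_lie_module:
  assumes "\<And>x y v. x \<in> k \<Longrightarrow> y \<in> k \<Longrightarrow> v \<in> U \<Longrightarrow> \<rho> (x + y) v = \<rho> x v + \<rho> y v"
    "\<And>c x v. x \<in> k \<Longrightarrow> v \<in> U \<Longrightarrow> \<rho> (c *\<^sub>C x) v = c *\<^sub>C \<rho> x v"
    "\<And>x y v. x \<in> k \<Longrightarrow> y \<in> k \<Longrightarrow> v \<in> U \<Longrightarrow> \<rho> (br x y) v = \<rho> x (\<rho> y v) - \<rho> y (\<rho> x v)"
    "cvec.subspace k" "\<And>x y. x \<in> k \<Longrightarrow> y \<in> k \<Longrightarrow> br x y \<in> k"
  shows "is_lie_module br k Q"
  unfolding is_lie_module_def
proof (intro conjI ballI allI)
  note s = Q_carrier Q_add Q_smult Q_lact act_U clinear_simps[OF act_clinear]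
  show "Module.module complex_ring Q" by (rule Q_module)
  fix x y V V' c assume x: "x \<in> k" and V: "V \<in> carrier Q" and V': "V' \<in> carrier Q"
  then obtain v w where v: "v \<in> U" "V = cls v" "w \<in> U" "V' = cls w" by (auto simp: Q_carrier)
  show "lact Q x V \<in> carrier Q" "lact Q x (V \<oplus>\<^bsub>Q\<^esub> V') = lact Q x V \<oplus>\<^bsub>Q\<^esub> lact Q x V'"
    "lact Q x (c \<odot>\<^bsub>Q\<^esub> V) = c \<odot>\<^bsub>Q\<^esub> lact Q x V"
    using v x by (simp_all add: s)
  show "lact Q (c *\<^sub>C x) V = c \<odot>\<^bsub>Q\<^esub> lact Q x V"
    using v x assms(2)[OF x v(1)] Q_lact[OF cvec.subspace_scale[OF assms(4) x]] by (simp add: s)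
  assume y: "y \<in> k"
  show "lact Q (x + y) V = lact Q x V \<oplus>\<^bsub>Q\<^esub> lact Q y V"
    using v x y assms(1)[OF x y v(1)] Q_lact[OF cvec.subspace_add[OF assms(4) x y]] by (simp add: s)
  show "lact Q (br x y) V = lact Q x (lact Q y V) \<ominus>\<^bsub>Q\<^esub> lact Q y (lact Q x V)"
    using v x y assms(3)[OF x y v(1)] Q_lact[OF assms(5)[OF x y]]
    by (simp add: Q_lact Q_minus act_U)
qed

lemma gen_Q_subset:
  assumes "k' \<subseteq> k" "F \<subseteq> carrier Q"
  shows "gen_submodule Q k' F \<subseteq> carrier Q"
proof
  note U_simps = cvec.subspace_add[OF U] cvec.subspace_0[OF U] cvec.subspace_scale[OF U]
  fix V assume "V \<in> gen_submodule Q k' F"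
  then show "V \<in> carrier Q"
  proof induction
    case (act x v)
    then show ?case using assms(1) act_U by (auto simp: Q_carrier Q_lact subset_iff)
  qed (use assms(2) in \<open>auto simp: Q_carrier Q_zero Q_add Q_smult U_simps\<close>)
qed

lemma gen_Q_image:
  assumes "k' \<subseteq> k" "F \<subseteq> U" "v \<in> gen_submodule (type_module \<rho>) k' F"
  shows "cls v \<in> gen_submodule Q k' (cls ` F)"
  using assms(3)
proof induction
  case zero
  show ?case using gen_submodule.zero[of Q k' "cls ` F"] by (simp add: Q_zero)
next
  case (base v)
  then show ?case by (intro gen_submodule.base) simp
next
  case (add v w)
  then show ?case using gen_submodule.add[of "cls v" Q k' "cls ` F" "cls w"] by (simp add: Q_add)
next
  case (smult v c)
  then show ?case using gen_submodule.smult[of "cls v" Q k' "cls ` F" c] by (simp add: Q_smult)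
next
  case (act x v)
  then show ?case
    using gen_submodule.act[of x k' "cls v" Q "cls ` F"] assms(1) Q_lact[of x v] by auto
qed

lemma gen_Q_image_conv:
  assumes "k' \<subseteq> k" "V \<in> gen_submodule Q k' (cls ` F)"
  shows "V \<in> cls ` gen_submodule (type_module \<rho>) k' F"
  using assms(2)
proof induction
  case zero
  show ?case using gen_submodule.zero[of "type_module \<rho>" k' F] by (auto simp: Q_zero)
next
  case (base v)
  then show ?case by (auto intro: gen_submodule.base)
next
  case (add v w)
  then obtain a b where "v = cls a" "w = cls b" "a \<in> gen_submodule (type_module \<rho>) k' F"
    "b \<in> gen_submodule (type_module \<rho>) k' F" by blast
  then show ?case using gen_submodule.add[of a "type_module \<rho>" k' F b] by (auto simp: Q_add)
next
  case (smult v c)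
  then obtain a where "v = cls a" "a \<in> gen_submodule (type_module \<rho>) k' F" by blast
  then show ?case using gen_submodule.smult[of a "type_module \<rho>" k' F c] by (auto simp: Q_smult)
next
  case (act x v)
  then obtain a where "v = cls a" "a \<in> gen_submodule (type_module \<rho>) k' F" by blast
  then show ?case
    using gen_submodule.act[of x k' a "type_module \<rho>" F] act(1) assms(1) Q_lact[of x a] by auto
qed

lemma Q_finitely_generated:
  assumes "finite F" "F \<subseteq> U" "U \<subseteq> gen_submodule (type_module \<rho>) k F"
  shows "finitely_generated k Q"
  unfolding finitely_generated_def
proof (intro exI conjI)
  show "finite (cls ` F)" and F: "cls ` F \<subseteq> carrier Q" using assms by (auto simp: Q_carrier)
  show "gen_submodule Q k (cls ` F) = carrier Q"
  proof (rule equalityI)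
    show "gen_submodule Q k (cls ` F) \<subseteq> carrier Q" by (rule gen_Q_subset[OF order_refl F])
    show "carrier Q \<subseteq> gen_submodule Q k (cls ` F)"
      using gen_Q_image[OF order_refl assms(2)] assms(3) by (auto simp: Q_carrier)
  qed
qed

lemma Q_weight_module:
  assumes "t \<subseteq> k" "U \<subseteq> cvec.span (\<Union>\<mu>\<in>dual_space t. {v \<in> U. \<forall>x\<in>t. \<rho> x v = \<mu> x *\<^sub>C v})"
  shows "weight_module t Q"
  unfolding weight_module_def
proof
  let ?X = "\<Union>\<mu>\<in>dual_space t. {v \<in> U. \<forall>x\<in>t. \<rho> x v = \<mu> x *\<^sub>C v}"
  let ?Y = "\<Union>\<mu>\<in>dual_space t. weight_space t Q \<mu>"
  show "gen_submodule Q {} ?Y \<subseteq> carrier Q"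
    by (rule gen_Q_subset) (auto simp: weight_space_def)
  have XY: "cls ` ?X \<subseteq> ?Y"
  proof
    fix V assume "V \<in> cls ` ?X"
    then obtain \<mu> v where v: "\<mu> \<in> dual_space t" "v \<in> U" "\<And>x. x \<in> t \<Longrightarrow> \<rho> x v = \<mu> x *\<^sub>C v" "V = cls v" by blast
    then have "V \<in> weight_space t Q \<mu>"
      using assms(1) by (auto simp: weight_space_def Q_carrier Q_lact Q_smult subset_iff)
    then show "V \<in> ?Y" using v(1) by blast
  qed
  have mono: "V \<in> gen_submodule Q {} ?Y" if "V \<in> gen_submodule Q {} (cls ` ?X)" for V
    using that by induction (use XY in \<open>blast intro: gen_submodule.intros\<close>)+
  show "carrier Q \<subseteq> gen_submodule Q {} ?Y"
  proof
    fix V assume "V \<in> carrier Q"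
    then obtain v where v: "v \<in> U" "V = cls v" by (auto simp: Q_carrier)
    have "cls v \<in> gen_submodule Q {} (cls ` ?X)"
      by (rule gen_Q_image) (use v assms(2) in \<open>auto simp: gen_submodule_empty\<close>)
    then show "V \<in> gen_submodule Q {} ?Y" using mono v by blast
  qed
qed

lemma Q_locally_finite:
  assumes "n \<subseteq> k"
    "\<And>v. v \<in> U \<Longrightarrow> \<exists>F. finite F \<and> gen_submodule (type_module \<rho>) n {v} \<subseteq> cvec.span F"
  shows "locally_finite n Q"
  unfolding locally_finite_def
proof
  fix V assume "V \<in> carrier Q"
  then obtain v where v: "v \<in> U" "V = cls v" by (auto simp: Q_carrier)
  let ?N = "gen_submodule (type_module \<rho>) n {v}"
  have NU: "?N \<subseteq> U"
    by (rule gen_submodule_type_module_least) (use v U assms(1) act_U in auto)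
  obtain F where F: "finite F" "?N \<subseteq> cvec.span F" using assms(2)[OF v(1)] by blast
  \<comment> \<open>The set \<open>F\<close> need not lie in \<open>U\<close>, but the bounding
    vectors in \<open>locally_finite\<close> must come from the carrier; so they are chosen inside
    the generated submodule.\<close>
  obtain B where B: "finite B" "B \<subseteq> ?N" "cvec.independent B" "cvec.span B = cvec.span ?N"
    by (rule finite_basis_subset[OF F])
  have "gen_submodule Q n {V} \<subseteq> gen_submodule Q {} (cls ` B)"
  proof
    fix X assume "X \<in> gen_submodule Q n {V}"
    then have "X \<in> cls ` ?N" using gen_Q_image_conv[OF assms(1), of X "{v}"] v by simp
    then obtain a where a: "a \<in> ?N" "X = cls a" by blast
    have "a \<in> gen_submodule (type_module \<rho>) {} B"
      using a B(4) cvec.span_base by (auto simp: gen_submodule_empty)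
    then show "X \<in> gen_submodule Q {} (cls ` B)"
      using gen_Q_image[of "{}" B a] B(2) NU a(2) by auto
  qed
  then show "\<exists>F. finite F \<and> F \<subseteq> carrier Q \<and> gen_submodule Q n {V} \<subseteq> gen_submodule Q {} F"
    using B NU by (intro exI[of _ "cls ` B"]) (auto simp: Q_carrier)
qed

end

section \<open>The spin module as a finite-dimensional weight module\<close>

context dirac_setting
begin

text \<open>By skewness of \<open>br x\<close> the vector
  \<open>br x (d b) + wt b x *\<^sub>C d b\<close> is orthogonal to the basis of \<open>V\<close>,
  so it vanishes. The lemma is applied to \<open>h\<close> and to \<open>q\<close>.\<close>

lemma dual_weight:
  assumes V: "cvec.subspace V" "nondegenerate_on br V" "\<And>x v. x \<in> t \<Longrightarrow> v \<in> V \<Longrightarrow> br x v \<in> V"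
    and sp: "cvec.span (RB \<inter> V) = V"
  shows "\<exists>d. dual_on V (RB \<inter> V) d \<and> (\<forall>b\<in>RB \<inter> V. K b (d b) = 1 \<and> d b \<in> ad.wspace (\<lambda>x. - wt b x))"
proof -
  have ind: "cvec.independent (RB \<inter> V)" by (rule cvec.independent_mono[OF RBD(2)]) simp
  obtain d where D: "dual_on V (RB \<inter> V) d"
    "\<And>b c. b \<in> RB \<inter> V \<Longrightarrow> c \<in> RB \<inter> V \<Longrightarrow> K (d b) c = (if b = c then 1 else 0)"
    using dual_basis_exists[OF V(2) ind sp] by blast
  have "K b (d b) = 1 \<and> d b \<in> ad.wspace (\<lambda>x. - wt b x)" if b: "b \<in> RB \<inter> V" for b
  proof
    show "K b (d b) = 1" using D(2)[OF b b] by (simp add: K_sym)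
    have dV: "d b \<in> V" by (rule dual_onD(3)[OF D(1) b])
    have "br x (d b) + wt b x *\<^sub>C d b = 0" if x: "x \<in> t" for x
    proof -
      let ?y = "br x (d b) + wt b x *\<^sub>C d b"
      have yV: "?y \<in> V" using V(3)[OF x dV] dV V(1) by (simp add: cvec.subspace_add cvec.subspace_scale)
      have "K ?y c = 0" if c: "c \<in> RB \<inter> V" for c
      proof -
        have "br x c = wt c x *\<^sub>C c" using RBD(5)[of c] c x by (simp add: ad.wspace_def)
        then show ?thesis using D(2)[OF b c] by (simp add: K_simps K_skew)
      qed
      then have "\<forall>z\<in>V. K ?y z = 0" using K_span_zero[of "RB \<inter> V" ?y] sp by auto
      then show ?thesis using V(2) yV unfolding nondegenerate_on_def by blast
    qed
    then show "d b \<in> ad.wspace (\<lambda>x. - wt b x)" by (simp add: ad.wspace_def eq_neg_iff_add_eq_0)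
  qed
  then show ?thesis using D(1) by blast
qed

lemma opposite_weight_space:
  assumes "b \<in> RB" "V = h \<or> V = q" "b \<in> V"
  shows "ad.wspace (\<lambda>x. - wt b x) = cvec.span {c \<in> RB \<inter> V. wt c = (\<lambda>x. - wt b x)}"
proof -
  have "c \<in> V" if c: "c \<in> RB" "wt c = (\<lambda>x. - wt b x)" for c
  proof (cases "V = q")
    case True
    then show ?thesis using K_pairs_q[of b c] assms c by blast
  next
    case False
    then have V: "V = h" using assms(2) by blast
    show ?thesis
    proof (rule ccontr)
      assume "c \<notin> V"
      then have "c \<in> q" using RB_h_or_q c V by blast
      moreover have "wt b = (\<lambda>x. - wt c x)" using c(2) by simp
      ultimately have "b \<in> q" using K_pairs_q[of c b] c assms by blast
      then show False using hq_zero[of b] RB_nonzero assms V by blast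
    qed
  qed
  then have "{c \<in> RB. wt c = (\<lambda>x. - wt b x)} = {c \<in> RB \<inter> V. wt c = (\<lambda>x. - wt b x)}" by auto
  then show ?thesis
    using wspace_eq_span[OF RB dual_space_ops(2)[OF RBD(4)[OF assms(1)]]] by simp
qed

lemma q_nondegenerate: "nondegenerate_on br q"
  using q_nondeg unfolding nondegenerate_on_def by blast

lemma G_nqp: "v \<in> nqp \<Longrightarrow> G v s = contract (K v) s"
proof -
  assume v: "v \<in> nqp"
  have "qp v = v" by (rule qp_eqI) (use v nq_sub cvec.subspace_0 in auto)
  then show ?thesis using gam_eq_G[of v s] v nq_sub by (auto simp: gamma_def ext_mult_zero_left)
qed

lemma G_nqm: "v \<in> nqm \<Longrightarrow> G v s = ext_mult v s"
proof -
  assume v: "v \<in> nqm"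
  have "qp v = 0" by (rule qp_eqI) (use v nq_sub cvec.subspace_0 in auto)
  moreover have "contract (K 0) s = 0"
    using contract_linear_left(2)[OF linform_K[of 0] linform_K[of 0], of 0 s]
    by (simp add: fun_eq_iff[of "K 0" "\<lambda>_. 0", THEN iffD2])
  ultimately show ?thesis using gam_eq_G[of v s] v nq_sub by (auto simp: gamma_def)
qed

text \<open>The weight of the vacuum vector \<open>wedge []\<close>, which is the highest weight of
  the spin module.\<close>

definition \<sigma> :: "'g \<Rightarrow> complex" where
  "\<sigma> x = (1/2) * (\<Sum>b\<in>Epos \<inter> q. wt b x)"

lemma \<sigma>_dual: "\<sigma> \<in> dual_space t"
  unfolding \<sigma>_def[abs_def] by (intro dual_space_ops dual_space_sum RBD(4)) (use E_subset in auto)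

text \<open>In dual bases of root vectors, \<open>d b\<close> is a contraction when \<open>b\<close>
  is negative and kills the vacuum. When \<open>b\<close> is positive, \<open>d b\<close> creates a
  vector that \<open>b\<close> contracts again with value \<open>K b (d b) = 1\<close>; only these
  terms remain.\<close>

lemma sp_vacuum: "x \<in> t \<Longrightarrow> sp x (wedge []) = \<sigma> x *\<^sub>C wedge []"
proof -
  assume x: "x \<in> t"
  obtain d where d: "dual_on q (RB \<inter> q) d"
    "\<And>b. b \<in> RB \<inter> q \<Longrightarrow> K b (d b) = 1 \<and> d b \<in> ad.wspace (\<lambda>x. - wt b x)"
    using dual_weight[OF q_subspace q_nondegenerate _ q_span] q_br t_h by blast
  let ?one = "wedge [] :: 'g ext"
  have c0: "contract (K v) ?one = 0" for v by (simp add: contract_wedge linform_K)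
  have tm: "G (br x b) (G (d b) ?one) = (if b \<in> Epos then wt b x *\<^sub>C ?one else 0)" if b: "b \<in> RB \<inter> q" for b
  proof -
    have bx: "br x b = wt b x *\<^sub>C b" using RBD(5)[of b] b x by (simp add: ad.wspace_def)
    have db: "d b \<in> cvec.span {c \<in> RB \<inter> q. wt c = (\<lambda>x. - wt b x)}"
      using d(2)[OF b] opposite_weight_space[of b q] b by blast
    show ?thesis
    proof (cases "b \<in> Epos")
      case True
      have "{c \<in> RB \<inter> q. wt c = (\<lambda>x. - wt b x)} \<subseteq> Eneg \<inter> q"
        using True by (auto simp: Epos_def Eneg_def)
      then have "d b \<in> nqm" using db cvec.span_mono unfolding n_q_minus_eq by blast
      then have "G (d b) ?one = wedge [d b]" by (simp add: G_nqm ext_mult(2))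
      moreover have "b \<in> nqp" using True b unfolding n_q_plus_eq by (simp add: cvec.span_base)
      then have "G b (wedge [d b]) = K b (d b) *\<^sub>C ?one"
        by (simp add: G_nqp contract_wedge linform_K ext_mult_simps)
      ultimately show ?thesis using True d(2)[OF b] by (simp add: bx G_bilinear scaleC_one)
    next
      case False
      then have bn: "b \<in> Eneg" using RB_q_cases b by blast
      have "{c \<in> RB \<inter> q. wt c = (\<lambda>x. - wt b x)} \<subseteq> Epos \<inter> q"
        using bn by (auto simp: Epos_def Eneg_def)
      then have "d b \<in> nqp" using db cvec.span_mono unfolding n_q_plus_eq by blast
      then show ?thesis using False by (simp add: G_nqp c0 G_simps)
    qed
  qed
  have "sp x ?one = (1/2) *\<^sub>C (\<Sum>b\<in>RB \<inter> q. G (br x b) (G (d b) ?one))"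
    unfolding sp_def
    by (rule arg_cong[where f = "\<lambda>v. (1/2) *\<^sub>C v"],
        rule dual_change[OF dual_q d(1), of "\<lambda>u v. G (br x u) (G v ?one)"])
       (auto simp: bilin_def clinear_iff G_bilinear br_simps)
  also have "(\<Sum>b\<in>RB \<inter> q. G (br x b) (G (d b) ?one)) = (\<Sum>b\<in>RB \<inter> q. if b \<in> Epos then wt b x *\<^sub>C ?one else 0)"
    by (rule sum.cong[OF refl tm])
  also have "\<dots> = (\<Sum>b\<in>Epos \<inter> q. wt b x *\<^sub>C ?one)"
    by (rule sum.mono_neutral_cong_right) (use RBD(1) E_subset in auto)
  finally show ?thesis by (simp add: \<sigma>_def cvec.scale_sum_left[symmetric] scaleC_scaleC)
qed

lemma sp_wedge:
  assumes "x \<in> t" "set vs \<subseteq> Eneg \<inter> q"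
  shows "sp x (wedge vs) = (\<sigma> x + wsum vs x) *\<^sub>C wedge vs"
  using assms(2)
proof (induction vs)
  case Nil
  then show ?case using sp_vacuum[OF assms(1)] by simp
next
  case (Cons v vs)
  have v: "v \<in> RB" "v \<in> nqm" using Cons.prems E_subset unfolding n_q_minus_eq by (auto intro: cvec.span_base)
  have w: "wedge (v # vs) = G v (wedge vs)" by (simp add: G_nqm[OF v(2)] ext_mult(2))
  have "br x v = wt v x *\<^sub>C v" using RBD(5)[OF v(1)] assms(1) by (simp add: ad.wspace_def)
  then have "sp x (G v (wedge vs)) = wt v x *\<^sub>C G v (wedge vs) + (\<sigma> x + wsum vs x) *\<^sub>C G v (wedge vs)"
    using Cons t_h assms(1) by (subst sp_G) (auto simp: G_bilinear)
  then show ?case unfolding w by (simp add: scaleC_add_left algebra_simps)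
qed

text \<open>All orderings of the same root vectors are kept: what is wanted is a finite spanning
  family of \<open>S\<close>, not a basis.\<close>

definition words :: "'g list set" where
  "words = {vs. set vs \<subseteq> Eneg \<inter> q \<and> distinct vs}"

lemma words_finite: "finite words"
proof (rule finite_subset)
  show "words \<subseteq> {vs. set vs \<subseteq> Eneg \<inter> q \<and> length vs \<le> card (Eneg \<inter> q)}"
    unfolding words_def using E_finite by (auto simp: distinct_card[symmetric] intro!: card_mono)
  show "finite {vs. set vs \<subseteq> Eneg \<inter> q \<and> length vs \<le> card (Eneg \<inter> q)}"
    by (rule finite_lists_length_le) (use E_finite in auto)
qed

lemma ext_mult_span_words:
  assumes "v \<in> Eneg \<inter> q" "s \<in> cvec.span (wedge ` words)"
  shows "ext_mult v s \<in> cvec.span (wedge ` words)"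
proof (rule clinear_span_subset[OF ext_mult(1) cvec.subspace_span _ assms(2)])
  fix s assume "s \<in> wedge ` words"
  then obtain vs where vs: "vs \<in> words" "s = wedge vs" by blast
  show "ext_mult v s \<in> cvec.span (wedge ` words)"
  proof (cases "distinct (v # vs)")
    case True
    then have "v # vs \<in> words" using vs assms(1) by (auto simp: words_def)
    then show ?thesis using vs by (auto simp: ext_mult(2) intro: cvec.span_base)
  next
    case False
    then show ?thesis using vs wedge_not_distinct[OF False] by (simp add: ext_mult(2) cvec.span_zero)
  qed
qed

lemma S_eq: "S = cvec.span (wedge ` words)"
proof
  have "wedge vs \<in> cvec.span (wedge ` words)" if "set vs \<subseteq> nqm" for vs
    using that
  proof (induction vs)
    case Nil
    have "[] \<in> words" by (simp add: words_def)
    then show ?case by (intro cvec.span_base imageI)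
  next
    case (Cons v vs)
    have lin: "clinear (\<lambda>v. ext_mult v (wedge vs))" by (simp add: clinear_iff ext_mult_linear_left)
    have "ext_mult v (wedge vs) \<in> cvec.span (wedge ` words)"
      by (rule clinear_span_subset[OF lin cvec.subspace_span, of "Eneg \<inter> q"])
         (use Cons ext_mult_span_words in \<open>auto simp: n_q_minus_eq\<close>)
    then show ?case by (simp add: ext_mult(2))
  qed
  then show "S \<subseteq> cvec.span (wedge ` words)"
    unfolding spin_module_def by (intro cvec.span_minimal) auto
  show "cvec.span (wedge ` words) \<subseteq> S"
    unfolding spin_module_def words_def n_q_minus_eq
    by (rule cvec.span_mono) (use cvec.span_superset in blast)
qed

lemma S_subspace: "cvec.subspace S" unfolding S_eq by (rule cvec.subspace_span)

lemma S_ext_mult: "v \<in> nqm \<Longrightarrow> s \<in> S \<Longrightarrow> ext_mult v s \<in> S"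
proof -
  assume v: "v \<in> nqm" and s: "s \<in> S"
  have lin: "clinear (\<lambda>v. ext_mult v s)" by (simp add: clinear_iff ext_mult_linear_left)
  show ?thesis
    by (rule clinear_span_subset[OF lin S_subspace, of "Eneg \<inter> q"])
       (use v s ext_mult_span_words in \<open>auto simp: n_q_minus_eq S_eq\<close>)
qed

lemma S_gam: "s \<in> S \<Longrightarrow> z \<in> q \<Longrightarrow> gam z s \<in> S"
proof -
  assume s: "s \<in> S" and z: "z \<in> q"
  have word: "contract_word \<xi> vs \<in> S" if "set vs \<subseteq> nqm" for vs \<xi>
    using that
  proof (induction vs)
    case (Cons v vs)
    have "wedge vs \<in> S" using Cons.prems unfolding spin_module_def by (intro cvec.span_base) auto
    then show ?case using Cons S_ext_mult S_subspace by (simp add: cvec.subspace_diff cvec.subspace_scale)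
  qed (simp add: cvec.subspace_0[OF S_subspace])
  have "contract (K (qp z)) s \<in> S"
    by (rule clinear_span_subset[OF contract_clinear[OF linform_K] S_subspace _ s[unfolded spin_module_def]])
       (auto simp: contract_wedge[OF linform_K] word)
  then show ?thesis
    unfolding gamma_def using S_ext_mult[OF _ s] qp[OF z] S_subspace by (simp add: cvec.subspace_add)
qed

lemma S_G: "s \<in> S \<Longrightarrow> G x s \<in> S"
  unfolding G_def by (intro cvec.subspace_sum[OF S_subspace] cvec.subspace_scale[OF S_subspace] S_gam Z_q)

lemma S_sp: "s \<in> S \<Longrightarrow> sp x s \<in> S"
  unfolding sp_def by (intro cvec.subspace_sum[OF S_subspace] cvec.subspace_scale[OF S_subspace] S_G)

lemma S_gc: "s \<in> S \<Longrightarrow> gc s \<in> S"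
  unfolding gc_def by (intro cvec.subspace_sum[OF S_subspace] cvec.subspace_scale[OF S_subspace] S_G)

end

section \<open>Finite generation\<close>

context dirac_module
begin

sublocale mw: weight_action t \<rho>
  by (rule weight_action.intro) (rule \<rho>_clinear)

sublocale dw: weight_action t diag
  by (rule weight_action.intro) (use t_h diag_clinear in blast)

lemma foldr_weight:
  assumes "w \<in> mw.wspace \<mu>" "set ys \<subseteq> RB"
  shows "foldr \<rho> ys w \<in> mw.wspace (\<lambda>x. \<mu> x + wsum ys x)"
  using assms(2)
proof (induction ys)
  case Nil
  then show ?case using assms(1) by simp
next
  case (Cons y ys)
  let ?v = "foldr \<rho> ys w"
  have v: "?v \<in> mw.wspace (\<lambda>x. \<mu> x + wsum ys x)" using Cons by simp
  have "\<rho> x (\<rho> y ?v) = (\<mu> x + (wt y x + wsum ys x)) *\<^sub>C \<rho> y ?v" if x: "x \<in> t" for x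
  proof -
    have "\<rho> x (\<rho> y ?v) = \<rho> (br x y) ?v + \<rho> y (\<rho> x ?v)" by (simp add: \<rho>_br)
    also have "br x y = wt y x *\<^sub>C y" using RBD(5)[of y] Cons.prems x by (simp add: ad.wspace_def)
    also have "\<rho> x ?v = (\<mu> x + wsum ys x) *\<^sub>C ?v" using v x by (simp add: mw.wspace_def)
    finally show ?thesis by (simp add: \<rho>_simps scaleC_add_left add_ac)
  qed
  then show ?case by (simp add: mw.wspace_def)
qed

text \<open>A weak form of the PBW theorem. Generators are replaced by weight vectors and closed up
  under words in positive root vectors, which stays finite-dimensional by local finiteness. Words in
  negative root vectors applied to the result then span a stable subspace.\<close>

lemma highest_weight_generators:
  assumes fg: "finite F" "gen_submodule (type_module \<rho>) UNIV F = UNIV"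
    and wm: "cvec.span (\<Union>\<mu>\<in>dual_space t. mw.wspace \<mu>) = UNIV"
    and lf: "\<And>v. \<exists>F. finite F \<and> gen_submodule (type_module \<rho>) (n_plus br t Dp) {v} \<subseteq> cvec.span F"
  shows "\<exists>Wb \<kappa>. finite Wb \<and> (\<forall>w\<in>Wb. \<kappa> w \<in> dual_space t \<and> w \<in> mw.wspace (\<kappa> w)) \<and>
    cvec.span {foldr \<rho> ys w | ys w. set ys \<subseteq> Eneg \<and> w \<in> Wb} = UNIV"
proof -
  let ?X = "\<Union>\<mu>\<in>dual_space t. mw.wspace \<mu>"
  have "\<exists>T. finite T \<and> T \<subseteq> ?X \<and> f \<in> cvec.span T" for f
  proof -
    have "f \<in> cvec.span ?X" unfolding wm by simp
    then obtain T r where T: "finite T" "T \<subseteq> ?X" "f = (\<Sum>a\<in>T. r a *\<^sub>C a)"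
      unfolding cvec.span_explicit by blast
    have "f \<in> cvec.span T" unfolding T(3) by (intro cvec.span_sum cvec.span_scale cvec.span_base)
    then show ?thesis using T by blast
  qed
  then obtain T where T: "\<And>f. finite (T f)" "\<And>f. T f \<subseteq> ?X" "\<And>f. f \<in> cvec.span (T f)" by metis
  define F1 where "F1 = (\<Union>f\<in>F. T f)"
  have F1: "finite F1" "F1 \<subseteq> ?X" unfolding F1_def using fg(1) T(1,2) by blast+
  have FF1: "F \<subseteq> cvec.span F1"
  proof
    fix f assume "f \<in> F"
    then have "cvec.span (T f) \<subseteq> cvec.span F1" by (intro cvec.span_mono) (auto simp: F1_def)
    then show "f \<in> cvec.span F1" using T(3) by blast
  qed
  obtain Y where Y: "\<And>v. finite (Y v)" "\<And>v. gen_submodule (type_module \<rho>) (n_plus br t Dp) {v} \<subseteq> cvec.span (Y v)"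
    using lf by metis
  define X where "X = {foldr \<rho> es w | es w. set es \<subseteq> Epos \<and> w \<in> F1}"
  have en: "e \<in> n_plus br t Dp" if "e \<in> Epos" for e
    using that unfolding n_plus_eq by (rule cvec.span_base)
  have Xfin: "X \<subseteq> cvec.span (\<Union>w\<in>F1. Y w)"
  proof
    fix x assume "x \<in> X"
    then obtain es w where x: "x = foldr \<rho> es w" "set es \<subseteq> Epos" "w \<in> F1" by (auto simp: X_def)
    have "foldr \<rho> es w \<in> gen_submodule (type_module \<rho>) (n_plus br t Dp) {w}"
      using x(2) by (induction es) (auto intro: gen_submodule_type_module en)
    then have "x \<in> cvec.span (Y w)" using Y(2) x by blast
    also have "\<dots> \<subseteq> cvec.span (\<Union>w\<in>F1. Y w)" by (rule cvec.span_mono) (use x in auto)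
    finally show "x \<in> cvec.span (\<Union>w\<in>F1. Y w)" .
  qed
  have "finite (\<Union>w\<in>F1. Y w)" using F1 Y by blast
  from finite_basis_subset[OF this Xfin]
  obtain Wb where Wb: "finite Wb" "Wb \<subseteq> X" "cvec.independent Wb" "cvec.span Wb = cvec.span X" .
  have Xw: "\<exists>\<mu>. \<mu> \<in> dual_space t \<and> x \<in> mw.wspace \<mu>" if xX: "x \<in> X" for x
  proof -
    obtain es w where x: "x = foldr \<rho> es w" "set es \<subseteq> Epos" "w \<in> F1" using xX by (auto simp: X_def)
    obtain \<mu> where \<mu>: "\<mu> \<in> dual_space t" "w \<in> mw.wspace \<mu>" using F1(2) x(3) by blast
    have es: "set es \<subseteq> RB" using x(2) E_subset by blast
    show ?thesis
      using foldr_weight[OF \<mu>(2) es] dual_space_ops(4)[OF \<mu>(1) wsum_dual[OF es]] x(1) by blast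
  qed
  then have "\<forall>x\<in>Wb. \<exists>\<mu>. \<mu> \<in> dual_space t \<and> x \<in> mw.wspace \<mu>" using Wb(2) by blast
  then obtain \<kappa> where \<kappa>: "\<forall>w\<in>Wb. \<kappa> w \<in> dual_space t \<and> w \<in> mw.wspace (\<kappa> w)" by (metis bchoice)
  let ?G = "{foldr \<rho> ys w | ys w. set ys \<subseteq> Eneg \<and> w \<in> Wb}"
  have WG: "cvec.span X \<subseteq> cvec.span ?G"
    unfolding Wb(4)[symmetric] by (rule cvec.span_mono) (auto intro!: exI[of _ "[]"])
  have neg: "\<rho> y v \<in> cvec.span ?G" if "y \<in> Eneg" "v \<in> cvec.span ?G" for y v
  proof (rule clinear_span_subset[OF \<rho>_clinear cvec.subspace_span _ that(2)])
    fix x assume "x \<in> ?G"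
    then obtain ys w where x: "x = foldr \<rho> ys w" "set ys \<subseteq> Eneg" "w \<in> Wb" by blast
    then have "\<rho> y x = foldr \<rho> (y # ys) w" "set (y # ys) \<subseteq> Eneg" using that(1) by auto
    then have "\<rho> y x \<in> ?G" using x(3) by blast
    then show "\<rho> y x \<in> cvec.span ?G" by (rule cvec.span_base)
  qed
  \<comment> \<open>An arbitrary \<open>x\<close> is moved past the first letter. Since the
    induction hypothesis holds for all \<open>x\<close>, it also covers the commutator
    \<open>br x y\<close>, so no ordering of the letters is necessary.\<close>
  have st: "\<rho> x (foldr \<rho> ys w) \<in> cvec.span ?G" if "set ys \<subseteq> Eneg" "w \<in> Wb" for x ys w
    using that(1)
  proof (induction ys arbitrary: x)
    case Nil
    have "\<rho> b w \<in> cvec.span ?G" if b: "b \<in> RB" for b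
      using b
    proof (cases rule: RB_cases)
      case 1
      have "\<rho> b w \<in> X"
      proof -
        obtain es w' where x: "w = foldr \<rho> es w'" "set es \<subseteq> Epos" "w' \<in> F1"
          using \<open>w \<in> Wb\<close> Wb(2) by (auto simp: X_def)
        then have "\<rho> b w = foldr \<rho> (b # es) w'" "set (b # es) \<subseteq> Epos" using 1 by auto
        then show ?thesis using x(3) unfolding X_def by blast
      qed
      then show ?thesis using WG cvec.span_base by blast
    next
      case 2
      have "w \<in> cvec.span ?G" using WG Wb(2) \<open>w \<in> Wb\<close> cvec.span_base by blast
      then show ?thesis by (rule neg[OF 2])
    next
      case 3
      have "\<rho> b w = \<kappa> w b *\<^sub>C w" using \<kappa> \<open>w \<in> Wb\<close> 3 E0_t by (auto simp: mw.wspace_def)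
      moreover have "w \<in> cvec.span ?G" using WG Wb(2) \<open>w \<in> Wb\<close> cvec.span_base by blast
      ultimately show ?thesis by (simp add: cvec.span_scale)
    qed
    then show ?case
      using clinear_span_subset[OF \<rho>_clinear1 cvec.subspace_span, of RB w ?G x] RBD(3) by simp
  next
    case (Cons y ys)
    let ?v = "foldr \<rho> ys w"
    have "\<rho> x (\<rho> y ?v) = \<rho> y (\<rho> x ?v) + \<rho> (br x y) ?v" by (simp add: \<rho>_br)
    moreover have "\<rho> y (\<rho> x ?v) \<in> cvec.span ?G" by (rule neg) (use Cons in auto)
    moreover have "\<rho> (br x y) ?v \<in> cvec.span ?G" using Cons by simp
    ultimately show ?case by (simp add: cvec.span_add)
  qed
  have "gen_submodule (type_module \<rho>) UNIV F \<subseteq> cvec.span ?G"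
  proof (rule gen_submodule_type_module_least[OF cvec.subspace_span])
    have "F1 \<subseteq> X" unfolding X_def by (auto intro!: exI[of _ "[]"])
    then have "cvec.span F1 \<subseteq> cvec.span X" by (rule cvec.span_mono)
    then show "F \<subseteq> cvec.span ?G" using FF1 WG by blast
    show "\<rho> x v \<in> cvec.span ?G" if "v \<in> cvec.span ?G" for x v
      by (rule clinear_span_subset[OF \<rho>_clinear cvec.subspace_span _ that]) (use st in blast)
  qed
  then have "cvec.span ?G = UNIV" using fg(2) by blast
  then show ?thesis using Wb(1) \<kappa> by blast
qed

end

section \<open>Weights of \<open>M \<otimes> S\<close> and generators of the kernel of
  \<open>D\<close>\<close>

locale dirac_O = dirac_module br h t Z Dp \<rho>
  for br :: "'g::complex_vec \<Rightarrow> 'g \<Rightarrow> 'g" and h t Z Dp and \<rho> :: "'g \<Rightarrow> 'm::complex_vec \<Rightarrow> 'm" +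
  fixes Wb :: "'m set" and \<kappa> :: "'m \<Rightarrow> 'g \<Rightarrow> complex"
  assumes Wb_finite: "finite Wb"
    and \<kappa>: "w \<in> Wb \<Longrightarrow> \<kappa> w \<in> dual_space t" "w \<in> Wb \<Longrightarrow> w \<in> mw.wspace (\<kappa> w)"
    and M_span: "cvec.span {foldr \<rho> ys w | ys w. set ys \<subseteq> Eneg \<and> w \<in> Wb} = UNIV"
    and lf: "\<exists>F. finite F \<and> gen_submodule (type_module \<rho>) (n_plus br t Dp) {v} \<subseteq> cvec.span F"
begin

abbreviation MS :: "('m, 'g ext) tensor set" where "MS \<equiv> M_tensor_S br h t Dp"
abbreviation "kerD \<equiv> dirac_ker br h t Dp \<rho> Z"

lemma MS_subspace: "cvec.subspace MS" unfolding M_tensor_S_def by (rule cvec.subspace_span)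

lemma MS_diag: "x \<in> h \<Longrightarrow> u \<in> MS \<Longrightarrow> diag x u \<in> MS"
proof -
  assume x: "x \<in> h" and u: "u \<in> MS"
  show ?thesis
  proof (rule clinear_span_subset[OF diag_clinear[OF x] MS_subspace _ u[unfolded M_tensor_S_def]])
    fix v :: "('m, 'g ext) tensor" assume "v \<in> {tens m s | m s. s \<in> S}"
    then obtain m s where v: "v = tens m s" "s \<in> S" by blast
    have "tens (\<rho> x m) s \<in> MS" "tens m (sp x s) \<in> MS"
      unfolding M_tensor_S_def using v S_sp by (auto intro!: cvec.span_base)
    then show "diag x v \<in> MS" using x v MS_subspace by (simp add: diag_tens cvec.subspace_add)
  qed
qed

lemma kerD_subspace: "cvec.subspace kerD"
  unfolding dirac_ker_def using MS_subspace by (auto simp: cvec.subspace_def D_simps)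

lemma kerD_diag: "x \<in> h \<Longrightarrow> u \<in> kerD \<Longrightarrow> diag x u \<in> kerD"
  unfolding dirac_ker_def using MS_diag by (auto simp: diag_D[symmetric] diag_simps)

text \<open>Indices of a spanning family of weight vectors of \<open>M \<otimes> S\<close>. The
  vectors may be dependent; the finiteness arguments count indices.\<close>

definition J :: "('g list \<times> 'm \<times> 'g list) set" where
  "J = {(ys, w, vs). set ys \<subseteq> Eneg \<and> w \<in> Wb \<and> vs \<in> words}"

text \<open>The apices of the cones that contain the weights of \<open>M \<otimes> S\<close>. They
  are finitely many, as \<open>Wb\<close> and \<open>words\<close> are finite.\<close>

definition \<kappa>' :: "'m \<Rightarrow> 'g list \<Rightarrow> 'g \<Rightarrow> complex" where
  "\<kappa>' w vs = (\<lambda>x. \<kappa> w x + (\<sigma> x + wsum vs x))"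

definition vec :: "'g list \<times> 'm \<times> 'g list \<Rightarrow> ('m, 'g ext) tensor" where
  "vec = (\<lambda>(ys, w, vs). tens (foldr \<rho> ys w) (wedge vs))"

definition wtv :: "'g list \<times> 'm \<times> 'g list \<Rightarrow> 'g \<Rightarrow> complex" where
  "wtv = (\<lambda>(ys, w, vs) x. \<kappa>' w vs x + wsum ys x)"

lemma words_RB: "vs \<in> words \<Longrightarrow> set vs \<subseteq> RB"
  using E_subset by (auto simp: words_def)

lemma \<kappa>'_dual: "w \<in> Wb \<Longrightarrow> vs \<in> words \<Longrightarrow> \<kappa>' w vs \<in> dual_space t"
  unfolding \<kappa>'_def by (intro dual_space_ops \<kappa> \<sigma>_dual wsum_dual words_RB)

lemma wtv_dual: "j \<in> J \<Longrightarrow> wtv j \<in> dual_space t"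
  using E_subset by (auto simp: J_def wtv_def intro!: dual_space_ops \<kappa>'_dual wsum_dual)

lemma vec_weight: "j \<in> J \<Longrightarrow> vec j \<in> dw.wspace (wtv j)"
proof -
  assume j: "j \<in> J"
  then obtain ys w vs where jj: "j = (ys, w, vs)" "set ys \<subseteq> Eneg" "w \<in> Wb" "vs \<in> words"
    by (auto simp: J_def)
  let ?m = "foldr \<rho> ys w"
  have m: "?m \<in> mw.wspace (\<lambda>x. \<kappa> w x + wsum ys x)"
    by (rule foldr_weight[OF \<kappa>(2)]) (use jj E_subset in auto)
  have "diag x (vec j) = wtv j x *\<^sub>C vec j" if x: "x \<in> t" for x
  proof -
    have "diag x (vec j) = tens (\<rho> x ?m) (wedge vs) + tens ?m (sp x (wedge vs))"
      using x t_h diag_tens jj by (auto simp: vec_def)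
    also have "\<rho> x ?m = (\<kappa> w x + wsum ys x) *\<^sub>C ?m" using m x by (simp add: mw.wspace_def)
    also have "sp x (wedge vs) = (\<sigma> x + wsum vs x) *\<^sub>C wedge vs"
      by (rule sp_wedge[OF x]) (use jj in \<open>auto simp: words_def\<close>)
    finally show ?thesis
      by (simp add: jj vec_def wtv_def \<kappa>'_def tens_bilinear scaleC_add_left algebra_simps)
  qed
  then show ?thesis by (simp add: dw.wspace_def)
qed

lemma MS_eq: "MS = cvec.span (vec ` J)"
proof
  have "tens m s \<in> cvec.span (vec ` J)" if s: "s \<in> S" for m s
  proof -
    have lin1: "clinear (tens m)" for m :: 'm by (simp add: clinear_iff tens_bilinear)
    have lin2: "clinear (\<lambda>m :: 'm. tens m s)" for s :: "'g ext" by (simp add: clinear_iff tens_bilinear)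
    have gen: "tens (foldr \<rho> ys w) (wedge vs) \<in> vec ` J" if "set ys \<subseteq> Eneg" "w \<in> Wb" "vs \<in> words" for ys w vs
      by (rule image_eqI[of _ _ "(ys, w, vs)"]) (use that in \<open>simp_all add: vec_def J_def\<close>)
    have "tens m (wedge vs) \<in> cvec.span (vec ` J)" if vs: "vs \<in> words" for vs
    proof (rule clinear_span_subset[OF lin2 cvec.subspace_span])
      show "m \<in> cvec.span {foldr \<rho> ys w | ys w. set ys \<subseteq> Eneg \<and> w \<in> Wb}" by (simp add: M_span)
      fix x assume "x \<in> {foldr \<rho> ys w | ys w. set ys \<subseteq> Eneg \<and> w \<in> Wb}"
      then obtain ys w where "x = foldr \<rho> ys w" "set ys \<subseteq> Eneg" "w \<in> Wb" by blast
      then show "tens x (wedge vs) \<in> cvec.span (vec ` J)" using gen[OF _ _ vs] cvec.span_base by metis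
    qed
    then show ?thesis
      by (intro clinear_span_subset[OF lin1 cvec.subspace_span _ s[unfolded S_eq]]) auto
  qed
  then show "MS \<subseteq> cvec.span (vec ` J)"
    unfolding M_tensor_S_def by (intro cvec.span_minimal) auto
  have "wedge vs \<in> S" if "vs \<in> words" for vs using that unfolding S_eq by (intro cvec.span_base) auto
  then show "cvec.span (vec ` J) \<subseteq> MS"
    unfolding M_tensor_S_def by (intro cvec.span_mono) (auto simp: vec_def J_def)
qed

text \<open>There are finitely many apices, and over each of them finitely many words of bounded
  length in the finite alphabet \<open>Eneg\<close>.\<close>

lemma finite_fibre:
  assumes "\<And>w vs. w \<in> Wb \<Longrightarrow> vs \<in> words \<Longrightarrow> \<exists>n. \<forall>ys. set ys \<subseteq> Eneg \<longrightarrow> P (ys, w, vs) \<longrightarrow> length ys \<le> n"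
  shows "finite {j \<in> J. P j}"
proof -
  obtain n where n: "\<And>w vs ys. w \<in> Wb \<Longrightarrow> vs \<in> words \<Longrightarrow> set ys \<subseteq> Eneg \<Longrightarrow> P (ys, w, vs) \<Longrightarrow> length ys \<le> n w vs"
    using assms by metis
  have "{j \<in> J. P j} \<subseteq> (\<Union>w\<in>Wb. \<Union>vs\<in>words. (\<lambda>ys. (ys, w, vs)) ` {ys. set ys \<subseteq> Eneg \<and> length ys \<le> n w vs})"
  proof
    fix j assume j: "j \<in> {j \<in> J. P j}"
    obtain ys w vs where jj: "j = (ys, w, vs)" by (rule prod_cases3)
    then have ws: "w \<in> Wb" "vs \<in> words" "set ys \<subseteq> Eneg" "P (ys, w, vs)" using j by (auto simp: J_def)
    show "j \<in> (\<Union>w\<in>Wb. \<Union>vs\<in>words. (\<lambda>ys. (ys, w, vs)) ` {ys. set ys \<subseteq> Eneg \<and> length ys \<le> n w vs})"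
      unfolding jj by (intro UN_I[OF ws(1)] UN_I[OF ws(2)] imageI) (use ws n in simp)
  qed
  moreover have "finite \<dots>"
    using Wb_finite words_finite E_finite(2) by (intro finite_UN_I finite_imageI finite_lists_length_le)
  ultimately show ?thesis by (rule finite_subset)
qed

lemma length_bound: "\<exists>n. \<forall>ys. set ys \<subseteq> Eneg \<longrightarrow> r \<le> a + Re (wsum ys x0) \<longrightarrow> length ys \<le> n"
proof -
  obtain \<epsilon> where \<epsilon>: "\<epsilon> > 0" "\<forall>\<alpha>\<in>Dp. \<epsilon> \<le> Re (\<alpha> x0)" using eps_exists by blast
  have "length ys \<le> nat \<lceil>(a - r) / \<epsilon>\<rceil>" if "set ys \<subseteq> Eneg" "r \<le> a + Re (wsum ys x0)" for ys
  proof -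
    have "\<epsilon> * real (length ys) \<le> a - r" using wsum_Eneg_bound[OF \<epsilon>(2) that(1)] that(2) by simp
    then have "real (length ys) \<le> (a - r) / \<epsilon>" using \<epsilon>(1) by (simp add: field_simps)
    then show ?thesis by linarith
  qed
  then show ?thesis by blast
qed

lemma finite_weight_fibre: "finite {j \<in> J. wtv j = \<mu>}"
proof (rule finite_fibre)
  fix w vs
  obtain n where n: "\<And>ys. set ys \<subseteq> Eneg \<Longrightarrow> Re (\<mu> x0) \<le> Re (\<kappa>' w vs x0) + Re (wsum ys x0) \<Longrightarrow> length ys \<le> n"
    using length_bound by blast
  have "length ys \<le> n" if "set ys \<subseteq> Eneg" "wtv (ys, w, vs) = \<mu>" for ys
    by (rule n) (use that in \<open>auto simp: wtv_def\<close>)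
  then show "\<exists>n. \<forall>ys. set ys \<subseteq> Eneg \<longrightarrow> wtv (ys, w, vs) = \<mu> \<longrightarrow> length ys \<le> n" by blast
qed

text \<open>The count of \<open>finite_weight_fibre\<close> for \<open>M\<close> without the spin
  factor. It provides the finite-dimensional space on which \<open>Rop_kill_roots\<close>
  starts.\<close>

lemma M_weight_finite:
  assumes \<mu>: "\<mu> \<in> dual_space t"
  shows "\<exists>F. finite F \<and> mw.wspace \<mu> \<subseteq> cvec.span F"
proof -
  define J0 where "J0 = {(ys, w). set ys \<subseteq> Eneg \<and> w \<in> Wb}"
  define v0 where "v0 = (\<lambda>(ys, w). foldr \<rho> ys w)"
  define w0 where "w0 = (\<lambda>(ys, w) x. \<kappa> w x + wsum ys x)"
  have "\<forall>w. \<exists>n. \<forall>ys. set ys \<subseteq> Eneg \<longrightarrow> Re (\<mu> x0) \<le> Re (\<kappa> w x0) + Re (wsum ys x0) \<longrightarrow> length ys \<le> n"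
    using length_bound by blast
  then obtain n where n: "\<And>w ys. set ys \<subseteq> Eneg \<Longrightarrow> Re (\<mu> x0) \<le> Re (\<kappa> w x0) + Re (wsum ys x0) \<Longrightarrow> length ys \<le> n w"
    by metis
  have "{j \<in> J0. w0 j = \<mu>} \<subseteq> (\<Union>w\<in>Wb. (\<lambda>ys. (ys, w)) ` {ys. set ys \<subseteq> Eneg \<and> length ys \<le> n w})"
  proof
    fix j assume j: "j \<in> {j \<in> J0. w0 j = \<mu>}"
    obtain ys w where jj: "j = (ys, w)" by (rule prod.exhaust)
    then have ws: "w \<in> Wb" "set ys \<subseteq> Eneg" and "\<mu> = (\<lambda>x. \<kappa> w x + wsum ys x)"
      using j by (auto simp: J0_def w0_def)
    then have "length ys \<le> n w" by (intro n) simp_all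
    then show "j \<in> (\<Union>w\<in>Wb. (\<lambda>ys. (ys, w)) ` {ys. set ys \<subseteq> Eneg \<and> length ys \<le> n w})"
      unfolding jj by (intro UN_I[OF ws(1)] imageI) (use ws in simp)
  qed
  moreover have "finite \<dots>"
    using Wb_finite E_finite(2) by (intro finite_UN_I finite_imageI finite_lists_length_le)
  ultimately have fin: "finite {j \<in> J0. w0 j = \<mu>}" by (rule finite_subset)
  have "{foldr \<rho> ys w | ys w. set ys \<subseteq> Eneg \<and> w \<in> Wb} = v0 ` J0"
  proof (intro equalityI subsetI)
    fix x assume "x \<in> {foldr \<rho> ys w | ys w. set ys \<subseteq> Eneg \<and> w \<in> Wb}"
    then obtain ys w where x: "x = foldr \<rho> ys w" "(ys, w) \<in> J0" by (auto simp: J0_def)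
    show "x \<in> v0 ` J0" by (rule image_eqI[OF _ x(2)]) (simp add: v0_def x(1))
  next
    fix x assume "x \<in> v0 ` J0"
    then show "x \<in> {foldr \<rho> ys w | ys w. set ys \<subseteq> Eneg \<and> w \<in> Wb}"
      by (auto simp: J0_def v0_def)
  qed
  then have sp: "cvec.span (v0 ` J0) = UNIV" using M_span by simp
  have "mw.wspace \<mu> \<subseteq> cvec.span (v0 ` {j \<in> J0. w0 j = \<mu>})"
  proof
    fix v assume v: "v \<in> mw.wspace \<mu>"
    show "v \<in> cvec.span (v0 ` {j \<in> J0. w0 j = \<mu>})"
    proof (rule mw.weight_span_eq[OF _ _ v])
      fix j assume "j \<in> J0"
      then obtain ys w where j: "j = (ys, w)" "set ys \<subseteq> Eneg" "w \<in> Wb" by (auto simp: J0_def)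
      have RB: "set ys \<subseteq> RB" using j(2) E_subset by blast
      have "w0 j \<in> dual_space t"
        unfolding j(1) w0_def using dual_space_ops(4)[OF \<kappa>(1)[OF j(3)] wsum_dual[OF RB]] by simp
      then show "w0 j \<in> mw.functionals \<and> v0 j \<in> mw.wspace (w0 j)"
        using foldr_weight[OF \<kappa>(2)[OF j(3)] RB] dual_space_functionals[of "w0 j"]
        by (simp add: j(1) v0_def w0_def)
    qed (use sp \<mu> dual_space_functionals in auto)
  qed
  then show ?thesis using fin by blast
qed

lemma MS_weight_span:
  assumes \<mu>: "\<mu> \<in> dual_space t" and v: "v \<in> MS" "v \<in> dw.wspace \<mu>"
  shows "v \<in> cvec.span (vec ` {j \<in> J. wtv j = \<mu>})"
  by (rule dw.weight_span_eq)
     (use vec_weight wtv_dual dual_space_functionals \<mu> v MS_eq in auto)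

lemma Rop_kill_roots:
  assumes D: "dual_on h B d"
  shows "\<exists>cs. \<forall>u\<in>MS. kill_roots (Rop B d) cs u = 0"
proof -
  \<comment> \<open>Full weight spaces are taken: the Casimir element commutes with \<open>t\<close>
    and preserves them, but it need not preserve the span of \<open>Wb\<close>.\<close>
  define A where "A = (\<Union>w\<in>Wb. mw.wspace (\<kappa> w))"
  define V where "V = cvec.span {tens m s | m s. m \<in> A \<and> s \<in> S}"
  have "\<forall>w\<in>Wb. \<exists>F. finite F \<and> mw.wspace (\<kappa> w) \<subseteq> cvec.span F" using M_weight_finite \<kappa>(1) by blast
  then obtain Y where Y: "\<And>w. w \<in> Wb \<Longrightarrow> finite (Y w)" "\<And>w. w \<in> Wb \<Longrightarrow> mw.wspace (\<kappa> w) \<subseteq> cvec.span (Y w)"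
    by (metis bchoice)
  define FA where "FA = (\<Union>w\<in>Wb. Y w)"
  have AF: "A \<subseteq> cvec.span FA"
  proof
    fix m assume "m \<in> A"
    then obtain w where w: "w \<in> Wb" "m \<in> cvec.span (Y w)" using Y(2) by (auto simp: A_def)
    have "cvec.span (Y w) \<subseteq> cvec.span FA" by (rule cvec.span_mono) (use w in \<open>auto simp: FA_def\<close>)
    then show "m \<in> cvec.span FA" using w by blast
  qed
  define FT where "FT = (\<lambda>(m, vs). tens m (wedge vs)) ` (FA \<times> words)"
  have finT: "finite FT" unfolding FT_def FA_def using Wb_finite Y(1) words_finite by blast
  have VF: "V \<subseteq> cvec.span FT"
    unfolding V_def
  proof (rule cvec.span_minimal[OF _ cvec.subspace_span], clarify)
    fix m s assume ms: "m \<in> A" "s \<in> S"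
    have lin1: "clinear (tens m)" for m :: 'm by (simp add: clinear_iff tens_bilinear)
    have lin2: "clinear (\<lambda>m :: 'm. tens m s)" for s :: "'g ext" by (simp add: clinear_iff tens_bilinear)
    have "tens m (wedge vs) \<in> cvec.span FT" if "vs \<in> words" for vs
    proof (rule clinear_span_subset[OF lin2 cvec.subspace_span])
      show "m \<in> cvec.span FA" using AF ms(1) by blast
      show "tens x (wedge vs) \<in> cvec.span FT" if "x \<in> FA" for x
        by (rule cvec.span_base) (use that \<open>vs \<in> words\<close> in \<open>force simp: FT_def\<close>)
    qed
    then show "tens m s \<in> cvec.span FT"
      by (intro clinear_span_subset[OF lin1 cvec.subspace_span _ ms(2)[unfolded S_eq]]) auto
  qed
  have CasA: "Cas B d m \<in> A" if mA: "m \<in> A" for m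
  proof -
    obtain w where w: "w \<in> Wb" "m \<in> mw.wspace (\<kappa> w)" using mA by (auto simp: A_def)
    then have "Cas B d m \<in> mw.wspace (\<kappa> w)"
      by (auto simp: mw.wspace_def Cas_central[OF D] clinear_simps[OF Cas_clinear])
    then show ?thesis using w by (auto simp: A_def)
  qed
  have TspS: "Tsp B d s \<in> S" if "s \<in> S" for s
    unfolding Tsp_def using that S_gc S_sp
    by (intro cvec.subspace_add[OF S_subspace] cvec.subspace_scale[OF S_subspace] cvec.subspace_sum[OF S_subspace]) auto
  have RV: "Rop B d v \<in> V" if "v \<in> V" for v
  proof (rule clinear_span_subset[OF Rop_clinear _ _ that[unfolded V_def]])
    show "cvec.subspace V" unfolding V_def by (rule cvec.subspace_span)
    fix x assume "x \<in> {tens m s | m s. m \<in> A \<and> s \<in> S}"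
    then obtain m s where x: "x = tens m s" "m \<in> A" "s \<in> S" by blast
    show "Rop B d x \<in> V"
      unfolding x(1) Rop_tens V_def using CasA TspS x by (intro cvec.span_add cvec.span_base) blast+
  qed
  obtain cs where cs: "\<And>v. v \<in> V \<Longrightarrow> kill_roots (Rop B d) cs v = 0"
    using finite_dim_kill_roots[OF Rop_clinear finT VF RV] by blast
  have "kill_roots (Rop B d) cs (tens (foldr \<rho> ys w) (wedge vs)) = 0" if w: "w \<in> Wb" and vs: "vs \<in> words" for ys w vs
  proof (induction ys)
    case Nil
    have "wedge vs \<in> S" using vs unfolding S_eq by (intro cvec.span_base) auto
    then have "tens w (wedge vs) \<in> V"
      unfolding V_def A_def using w \<kappa>(2) by (intro cvec.span_base) blast
    then show ?case using cs by simp
  next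
    case (Cons y ys)
    let ?T = "tensor_map (\<rho> y) id :: ('m, 'g ext) tensor \<Rightarrow> _"
    have Tl: "clinear ?T" by (rule tensor_map(1)[OF \<rho>_clinear id_clinear])
    have Tt: "?T (tens m s) = tens (\<rho> y m) s" for m s
      using tensor_map(2)[OF \<rho>_clinear id_clinear, of y m s] by simp
    have "Rop B d (?T u) = ?T (Rop B d u)" for u
      by (rule tensor_linear_eq[where F = "\<lambda>u. Rop B d (?T u)" and G = "\<lambda>u. ?T (Rop B d u)"])
         (simp_all add: clinear_iff clinear_simps[OF Tl] clinear_simps[OF Rop_clinear] Tt Rop_tens Cas_central[OF D])
    from kill_roots_intertwine[where T = "Rop B d" and A = ?T, OF this Tl, of cs "tens (foldr \<rho> ys w) (wedge vs)"]
    have "kill_roots (Rop B d) cs (?T (tens (foldr \<rho> ys w) (wedge vs))) = ?T 0" unfolding Cons.IH .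
    then show ?case by (simp only: Tt clinear_simps(3)[OF Tl] foldr.simps o_apply)
  qed
  then have "kill_roots (Rop B d) cs x = 0" if "x \<in> vec ` J" for x
    using that by (auto simp: vec_def J_def)
  note zero = this
  have "kill_roots (Rop B d) cs u = 0" if "u \<in> MS" for u
  proof (rule clinear_eq_on_span[OF kill_roots_clinear[OF Rop_clinear]])
    show "clinear (\<lambda>_. 0 :: ('m, 'g ext) tensor)" by (simp add: clinear_iff)
    show "u \<in> cvec.span (vec ` J)" using that by (simp add: MS_eq)
    show "kill_roots (Rop B d) cs x = 0" if "x \<in> vec ` J" for x using that by (rule zero)
  qed
  then show ?thesis by blast
qed

text \<open>The sum is split by the sign of the weight of \<open>b\<close>. Weight 0 contributes
  \<open>(\<mu>, \<mu>)\<close>. For negative \<open>b\<close> the positive vector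
  \<open>d b\<close> acts first and leads into \<open>N\<close>. For positive \<open>b\<close> the
  two factors are exchanged, which leaves the commutator \<open>br b (d b)\<close> in
  \<open>t\<close>.\<close>

lemma Cdiag_highest_weight:
  assumes D: "dual_on h (RB \<inter> h) d" "\<And>b. b \<in> RB \<inter> h \<Longrightarrow> d b \<in> ad.wspace (\<lambda>x. - wt b x)"
    and N: "cvec.subspace N" "\<And>x u. x \<in> h \<Longrightarrow> u \<in> N \<Longrightarrow> diag x u \<in> N"
    and \<mu>: "\<mu> \<in> dual_space t" and v: "v \<in> dw.wspace \<mu>"
    and ev: "\<And>e. e \<in> Epos \<inter> h \<Longrightarrow> diag e v \<in> N"
  shows "Cdiag (RB \<inter> h) d v - (\<mu> (tdual \<mu>) + \<mu> (\<Sum>b\<in>Epos \<inter> h. br b (d b))) *\<^sub>C v \<in> N"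
proof -
  note dh = dual_onD(3)[OF D(1)]
  have E: "RB \<inter> h = (E0 \<union> (Epos \<inter> h)) \<union> (Eneg \<inter> h)"
    using E_subset E0_t t_h by (auto elim: RB_cases)
  have disj: "E0 \<inter> Epos = {}" "E0 \<inter> Eneg = {}" "Epos \<inter> Eneg = {}"
    using Dp_nz Dp_sign Dp_roots by (auto simp: E0_def Epos_def Eneg_def)
  have E0h: "b \<in> RB \<inter> h" if "b \<in> E0" for b using that E by blast
  have vx: "diag x v = \<mu> x *\<^sub>C v" if "x \<in> t" for x using v that by (simp add: dw.wspace_def)
  have d0: "d b \<in> t" if "b \<in> E0" for b
    using D(2)[OF E0h[OF that]] that by (simp add: E0_def wspace_zero)
  have bd: "br b (d b) \<in> t" if "b \<in> RB \<inter> h" for b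
    using wspace_br[OF RBD(5) D(2)[OF that], of b] that by (simp add: wspace_zero)
  have split: "Cdiag (RB \<inter> h) d v = (\<Sum>b\<in>E0. diag b (diag (d b) v)) + (\<Sum>b\<in>Epos \<inter> h. diag b (diag (d b) v))
      + (\<Sum>b\<in>Eneg \<inter> h. diag b (diag (d b) v))"
  proof -
    have f: "finite E0" "finite (Epos \<inter> h)" "finite (Eneg \<inter> h)" using E_finite by auto
    show ?thesis
      unfolding Cdiag_def E using f disj
      by (subst sum.union_disjoint, simp, simp, blast, subst sum.union_disjoint) auto
  qed
  have s0: "(\<Sum>b\<in>E0. diag b (diag (d b) v)) = \<mu> (tdual \<mu>) *\<^sub>C v"
  proof -
    have "tdual \<mu> = (\<Sum>b\<in>RB \<inter> h. K (tdual \<mu>) b *\<^sub>C d b)"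
      using dual_onD(5)[OF D(1)] tdual(1)[OF \<mu>] t_h by force
    also have "\<dots> = (\<Sum>b\<in>E0. \<mu> b *\<^sub>C d b)"
    proof (rule sum.mono_neutral_cong_right)
      show "finite (RB \<inter> h)" using RBD(1) by simp
      show "E0 \<subseteq> RB \<inter> h" using E0h by blast
      show "K (tdual \<mu>) b *\<^sub>C d b = \<mu> b *\<^sub>C d b" if "b \<in> E0" for b
        using tdual(2)[OF \<mu>] that E0_t by force
      show "\<forall>b\<in>RB \<inter> h - E0. K (tdual \<mu>) b *\<^sub>C d b = 0"
      proof
        fix b assume b: "b \<in> RB \<inter> h - E0"
        then have "wt b \<noteq> (\<lambda>_. 0)" by (simp add: E0_def)
        then obtain z where z: "wt b z \<noteq> 0" by blast
        then have "z \<in> t" using dual_spaceD(3)[OF RBD(4)] b by blast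
        then have "K (tdual \<mu>) b = 0"
          using wspace_orth[of "tdual \<mu>" "\<lambda>_. 0" b "wt b" z] tdual(1)[OF \<mu>] RBD(5)[of b] b z
          by (simp add: wspace_zero)
        then show "K (tdual \<mu>) b *\<^sub>C d b = 0" by simp
      qed
    qed
    finally have "\<mu> (tdual \<mu>) = \<mu> (\<Sum>b\<in>E0. \<mu> b *\<^sub>C d b)" by simp
    also have "\<dots> = (\<Sum>b\<in>E0. \<mu> b * \<mu> (d b))" by (rule dual_space_lin[OF \<mu> d0])
    finally have eq: "\<mu> (tdual \<mu>) = (\<Sum>b\<in>E0. \<mu> b * \<mu> (d b))" .
    have "diag b (diag (d b) v) = (\<mu> b * \<mu> (d b)) *\<^sub>C v" if b: "b \<in> E0" for b
    proof -
      have "b \<in> t" "b \<in> h" using b E0_t t_h by blast+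
      then show ?thesis using vx[OF d0[OF b]] vx[of b] by (simp add: diag_simps scaleC_scaleC mult.commute)
    qed
    then show ?thesis unfolding eq by (simp add: cvec.scale_sum_left)
  qed
  have sneg: "(\<Sum>b\<in>Eneg \<inter> h. diag b (diag (d b) v)) \<in> N"
  proof (rule cvec.subspace_sum[OF N(1)])
    fix b assume b: "b \<in> Eneg \<inter> h"
    then have bR: "b \<in> RB \<inter> h" using E_subset by blast
    have "d b \<in> cvec.span {c \<in> RB \<inter> h. wt c = (\<lambda>x. - wt b x)}"
      using D(2)[OF bR] opposite_weight_space[of b h] bR by blast
    also have "\<dots> \<subseteq> cvec.span (Epos \<inter> h)"
      by (rule cvec.span_mono) (use b in \<open>auto simp: Epos_def Eneg_def\<close>)
    finally have db: "d b \<in> cvec.span (Epos \<inter> h)" .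
    have "x \<in> h \<and> diag x v \<in> N" if "x \<in> cvec.span (Epos \<inter> h)" for x
      using that
    proof (induction rule: cvec.span_induct_alt)
      case base
      have "diag (0 *\<^sub>C 0) v = 0 *\<^sub>C diag 0 v"
        by (rule diag_linear_left(2)) (rule cvec.subspace_0[OF h_subspace])+
      then show ?case using cvec.subspace_0[OF h_subspace] cvec.subspace_0[OF N(1)] by simp
    next
      case (step c x y)
      then have x: "x \<in> h" by blast
      then have cx: "c *\<^sub>C x \<in> h" using h_subspace cvec.subspace_scale by blast
      have "diag (c *\<^sub>C x + y) v = c *\<^sub>C diag x v + diag y v"
        using diag_linear_left(1)[OF cx, of y v] diag_linear_left(2)[OF x x, of c v] step by simp
      then show ?case
        using step ev[of x] cx h_subspace N(1) by (simp add: cvec.subspace_add cvec.subspace_scale)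
    qed
    then have "diag (d b) v \<in> N" using db by blast
    then show "diag b (diag (d b) v) \<in> N" using N(2) b by blast
  qed
  have spos: "(\<Sum>b\<in>Epos \<inter> h. diag b (diag (d b) v)) - \<mu> (\<Sum>b\<in>Epos \<inter> h. br b (d b)) *\<^sub>C v \<in> N"
  proof -
    have bR: "b \<in> RB \<inter> h" if "b \<in> Epos \<inter> h" for b using that E_subset by blast
    have "\<mu> (\<Sum>b\<in>Epos \<inter> h. 1 *\<^sub>C br b (d b)) = (\<Sum>b\<in>Epos \<inter> h. 1 * \<mu> (br b (d b)))"
      by (rule dual_space_lin[OF \<mu>]) (use bd bR in blast)
    then have eq: "\<mu> (\<Sum>b\<in>Epos \<inter> h. br b (d b)) *\<^sub>C v = (\<Sum>b\<in>Epos \<inter> h. \<mu> (br b (d b)) *\<^sub>C v)"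
      by (simp add: scaleC_one cvec.scale_sum_left)
    show ?thesis
      unfolding eq sum_subtractf[symmetric]
    proof (rule cvec.subspace_sum[OF N(1)])
      fix b assume b: "b \<in> Epos \<inter> h"
      have bh: "b \<in> h" "d b \<in> h" using b dh bR by blast+
      have "diag (br b (d b)) v = \<mu> (br b (d b)) *\<^sub>C v" by (rule vx[OF bd[OF bR[OF b]]])
      then have "diag b (diag (d b) v) - \<mu> (br b (d b)) *\<^sub>C v = diag (d b) (diag b v)"
        using diag_linear_left(3)[OF bh, of v] by (simp add: diff_eq_eq eq_diff_eq add.commute)
      then show "diag b (diag (d b) v) - \<mu> (br b (d b)) *\<^sub>C v \<in> N" using N(2)[OF bh(2)] ev[OF b] by simp
    qed
  qed
  have "Cdiag (RB \<inter> h) d v - (\<mu> (tdual \<mu>) + \<mu> (\<Sum>b\<in>Epos \<inter> h. br b (d b))) *\<^sub>C v =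
     ((\<Sum>b\<in>Epos \<inter> h. diag b (diag (d b) v)) - \<mu> (\<Sum>b\<in>Epos \<inter> h. br b (d b)) *\<^sub>C v)
     + (\<Sum>b\<in>Eneg \<inter> h. diag b (diag (d b) v))"
    unfolding split s0 scaleC_add_left by simp
  then show ?thesis using cvec.subspace_add[OF N(1) spos sneg] by simp
qed

text \<open>Modulo \<open>N\<close> the vector \<open>v\<close> is an eigenvector with eigenvalue
  \<open>a\<close>, on which the product acts by the value of the polynomial at \<open>a\<close>.
  Membership in \<open>N\<close> expresses this without forming a quotient.\<close>

lemma kill_roots_mod:
  assumes T: "clinear T" and N: "cvec.subspace N" "\<And>u. u \<in> N \<Longrightarrow> T u \<in> N" and v: "T v - a *\<^sub>C v \<in> N"
  shows "kill_roots T cs v - (\<Prod>c\<leftarrow>cs. a - c) *\<^sub>C v \<in> N"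
  using v
proof (induction cs arbitrary: v)
  case Nil
  then show ?case using cvec.subspace_0[OF N(1)] by (simp add: scaleC_one)
next
  case (Cons c cs)
  let ?w = "T v - c *\<^sub>C v" and ?p = "\<Prod>c\<leftarrow>cs. a - c"
  have "T ?w - a *\<^sub>C ?w = T (T v - a *\<^sub>C v) - c *\<^sub>C (T v - a *\<^sub>C v)"
    by (simp add: clinear_simps[OF T] cvec.scale_right_diff_distrib scaleC_scaleC mult.commute)
  also have "\<dots> \<in> N" using Cons.prems N by (simp add: cvec.subspace_diff cvec.subspace_scale)
  finally have "kill_roots T cs ?w - ?p *\<^sub>C ?w \<in> N" by (rule Cons.IH)
  moreover have "?p *\<^sub>C ?w - (?p * (a - c)) *\<^sub>C v = ?p *\<^sub>C (T v - a *\<^sub>C v)"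
    by (simp add: cvec.scale_right_diff_distrib scaleC_scaleC algebra_simps)
  then have "?p *\<^sub>C ?w - (?p * (a - c)) *\<^sub>C v \<in> N" using Cons.prems N(1) by (simp add: cvec.subspace_scale)
  ultimately have "(kill_roots T cs ?w - ?p *\<^sub>C ?w) + (?p *\<^sub>C ?w - (?p * (a - c)) *\<^sub>C v) \<in> N"
    by (rule cvec.subspace_add[OF N(1)])
  then show ?case by (simp add: mult.commute)
qed

lemma kerD_finitely_generated:
  "\<exists>F. finite F \<and> F \<subseteq> kerD \<and> kerD \<subseteq> gen_submodule (type_module diag) h F"
proof -
  obtain d where d: "dual_on h (RB \<inter> h) d" "\<And>b. b \<in> RB \<inter> h \<Longrightarrow> d b \<in> ad.wspace (\<lambda>x. - wt b x)"
    using dual_weight[OF h_subspace h_nondeg _ h_span] h_br t_h by blast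
  let ?B = "RB \<inter> h"
  define y0 where "y0 = (\<Sum>b\<in>Epos \<inter> h. br b (d b))"
  have y0: "y0 \<in> t"
    unfolding y0_def
  proof (rule cvec.subspace_sum[OF t_subspace])
    fix b assume "b \<in> Epos \<inter> h"
    then have "b \<in> ?B" using E_subset by blast
    then show "br b (d b) \<in> t" using wspace_br[OF RBD(5) d(2), of b b] by (simp add: wspace_zero)
  qed
  define c where "c \<mu> = \<mu> (tdual \<mu>) + \<mu> y0" for \<mu>
  obtain cs where cs: "\<And>u. u \<in> MS \<Longrightarrow> kill_roots (Rop ?B d) cs u = 0"
    using Rop_kill_roots[OF d(1)] by blast
  \<comment> \<open>The weights at which new generators may be required: those whose Casimir value
    is among the roots of the annihilating polynomial.\<close>
  define Adm where "Adm = wtv ` {j \<in> J. c (wtv j) \<in> set cs}"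
  have "finite {j \<in> J. c (wtv j) \<in> set cs}"
  proof (rule finite_fibre)
    fix w vs assume wv: "w \<in> Wb" "vs \<in> words"
    have "\<forall>a. \<exists>n. \<forall>ys. set ys \<subseteq> Eneg \<longrightarrow> c (wtv (ys, w, vs)) = a \<longrightarrow> length ys \<le> n"
      using quadric_length_bound[OF \<kappa>'_dual[OF wv] y0] unfolding c_def wtv_def by auto
    then obtain n where n: "\<And>a ys. set ys \<subseteq> Eneg \<Longrightarrow> c (wtv (ys, w, vs)) = a \<Longrightarrow> length ys \<le> n a" by metis
    \<comment> \<open>The sum of the bounds for the finitely many values in \<open>cs\<close> is a
      common bound.\<close>
    have "length ys \<le> (\<Sum>a\<in>set cs. n a)" if "set ys \<subseteq> Eneg" "c (wtv (ys, w, vs)) \<in> set cs" for ys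
      using n[OF that(1) refl] member_le_sum[OF that(2), of n] by simp
    then show "\<exists>n. \<forall>ys. set ys \<subseteq> Eneg \<longrightarrow> c (wtv (ys, w, vs)) \<in> set cs \<longrightarrow> length ys \<le> n" by blast
  qed
  then have Adm: "finite Adm" unfolding Adm_def by simp
  have "\<exists>F. finite F \<and> F \<subseteq> kerD \<inter> dw.wspace \<mu> \<and> kerD \<inter> dw.wspace \<mu> \<subseteq> cvec.span F" if "\<mu> \<in> dual_space t" for \<mu>
  proof -
    have sub: "kerD \<inter> dw.wspace \<mu> \<subseteq> cvec.span (vec ` {j \<in> J. wtv j = \<mu>})"
      using MS_weight_span[OF that] by (auto simp: dirac_ker_def)
    have fin: "finite (vec ` {j \<in> J. wtv j = \<mu>})" by (rule finite_imageI[OF finite_weight_fibre])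
    obtain F where "finite F" "F \<subseteq> kerD \<inter> dw.wspace \<mu>" "cvec.independent F"
      "cvec.span F = cvec.span (kerD \<inter> dw.wspace \<mu>)"
      by (rule finite_basis_subset[OF fin sub])
    then show ?thesis using cvec.span_superset[of "kerD \<inter> dw.wspace \<mu>"] by (intro exI[of _ F]) simp
  qed
  then obtain Fs where Fs: "\<And>\<mu>. \<mu> \<in> dual_space t \<Longrightarrow> finite (Fs \<mu>)" "\<And>\<mu>. \<mu> \<in> dual_space t \<Longrightarrow> Fs \<mu> \<subseteq> kerD \<inter> dw.wspace \<mu>"
    "\<And>\<mu>. \<mu> \<in> dual_space t \<Longrightarrow> kerD \<inter> dw.wspace \<mu> \<subseteq> cvec.span (Fs \<mu>)"
    by metis
  have AdmD: "\<mu> \<in> dual_space t" if "\<mu> \<in> Adm" for \<mu> using that wtv_dual by (auto simp: Adm_def)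
  define F where "F = (\<Union>\<mu>\<in>Adm. Fs \<mu>)"
  have F: "finite F" "F \<subseteq> kerD" unfolding F_def using Adm AdmD Fs by blast+
  define N where "N = gen_submodule (type_module diag) h F"
  note N = gen_submodule_type_module[where \<rho> = diag and k = h and F = F, folded N_def]
  have NU: "N \<subseteq> kerD"
    unfolding N_def by (rule gen_submodule_type_module_least) (use kerD_subspace F kerD_diag in auto)
  have RC: "Rop ?B d u = Cdiag ?B d u" if "u \<in> kerD" for u
    using D_square[OF d(1), of u] that by (simp add: dirac_ker_def D_simps)
  \<comment> \<open>\<open>Rop\<close> involves the action of the whole Lie algebra on
    \<open>M\<close>. It preserves \<open>N\<close> because it coincides on \<open>ker D\<close>
    with \<open>Cdiag\<close>, which is built from the action of \<open>h\<close>.\<close>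
  have RN: "Rop ?B d u \<in> N" if "u \<in> N" for u
  proof -
    have "Cdiag ?B d u \<in> N"
      unfolding Cdiag_def using that dual_onD(3)[OF d(1)] by (intro cvec.subspace_sum[OF N(1)] N(3)) auto
    then show ?thesis using RC NU that by auto
  qed
  obtain \<epsilon> where \<epsilon>: "\<epsilon> > 0" "\<forall>\<alpha>\<in>Dp. \<epsilon> \<le> Re (\<alpha> x0)" using eps_exists by blast
  \<comment> \<open>A height above all weights of \<open>M \<otimes> S\<close>: the sum dominates
    every apex, and the summand 1 makes the inequality strict.\<close>
  define C where "C = 1 + (\<Sum>w\<in>Wb. \<Sum>vs\<in>words. \<bar>Re (\<kappa>' w vs x0)\<bar>)"
  have C: "Re (wtv j x0) < C" if jJ: "j \<in> J" for j
  proof -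
    obtain ys w vs where j: "j = (ys, w, vs)" "set ys \<subseteq> Eneg" "w \<in> Wb" "vs \<in> words"
      using jJ by (auto simp: J_def)
    have "Re (wsum ys x0) \<le> - \<epsilon> * real (length ys)" by (rule wsum_Eneg_bound[OF \<epsilon>(2) j(2)])
    also have "\<dots> \<le> 0" using \<epsilon>(1) by simp
    finally have "Re (wtv j x0) \<le> \<bar>Re (\<kappa>' w vs x0)\<bar>" by (simp add: j(1) wtv_def)
    also have "\<dots> \<le> (\<Sum>vs\<in>words. \<bar>Re (\<kappa>' w vs x0)\<bar>)"
      by (rule member_le_sum[OF j(4)]) (use words_finite in auto)
    also have "\<dots> \<le> (\<Sum>w\<in>Wb. \<Sum>vs\<in>words. \<bar>Re (\<kappa>' w vs x0)\<bar>)"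
      by (rule member_le_sum[OF j(3)]) (use Wb_finite in \<open>auto intro: sum_nonneg\<close>)
    finally show ?thesis by (simp add: C_def)
  qed
  \<comment> \<open>Descending induction on the weight: \<open>n\<close> bounds its depth below
    \<open>C\<close> in steps of size \<epsilon>, and a positive root vector uses up at least one
    step. For \<open>n = 0\<close> the height is at least \<open>C\<close> and the weight space is
    0.\<close>
  have main: "kerD \<inter> dw.wspace \<mu> \<subseteq> N" if "C - Re (\<mu> x0) \<le> \<epsilon> * real n" "\<mu> \<in> dual_space t" for n \<mu>
    using that
  proof (induction n arbitrary: \<mu>)
    case 0
    show ?case
    proof
      fix v assume v: "v \<in> kerD \<inter> dw.wspace \<mu>"
      have emp: "{j \<in> J. wtv j = \<mu>} = {}" using C 0 by force
      have "v = 0" using MS_weight_span[OF 0(2), of v] v unfolding emp by (simp add: dirac_ker_def)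
      then show "v \<in> N" using cvec.subspace_0[OF N(1)] by simp
    qed
  next
    case (Suc n)
    show ?case
    proof
      fix v assume v: "v \<in> kerD \<inter> dw.wspace \<mu>"
      show "v \<in> N"
      proof (cases "\<mu> \<in> Adm")
        case True
        have "cvec.span (Fs \<mu>) \<subseteq> N"
          by (rule cvec.span_minimal) (use N(1,2) True in \<open>auto simp: F_def\<close>)
        then show ?thesis using Fs(3)[OF Suc.prems(2)] v by blast
      next
        case notAdm: False
        show ?thesis
        proof (cases "\<mu> \<in> wtv ` J")
          case False
          then have emp: "{j \<in> J. wtv j = \<mu>} = {}" by auto
          have "v = 0" using MS_weight_span[OF Suc.prems(2), of v] v unfolding emp by (simp add: dirac_ker_def)
          then show "v \<in> N" using cvec.subspace_0[OF N(1)] by simp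
        next
          case True
          then have ncs: "c \<mu> \<notin> set cs" using notAdm by (auto simp: Adm_def)
          have ev: "diag e v \<in> N" if e: "e \<in> Epos \<inter> h" for e
          proof -
            have eR: "e \<in> RB" and eh: "e \<in> h" and eD: "wt e \<in> Dp" using e by (auto simp: Epos_def)
            let ?\<nu> = "\<lambda>x. \<mu> x + wt e x"
            have "diag e v \<in> dw.wspace ?\<nu>"
            proof -
              have "diag x (diag e v) = ?\<nu> x *\<^sub>C diag e v" if x: "x \<in> t" for x
              proof -
                have xh: "x \<in> h" using x t_h by blast
                have "br x e = wt e x *\<^sub>C e" using RBD(5)[OF eR] x by (simp add: ad.wspace_def)
                moreover have "diag x v = \<mu> x *\<^sub>C v" using v x by (simp add: dw.wspace_def)
                ultimately have "diag x (diag e v) = wt e x *\<^sub>C diag e v + \<mu> x *\<^sub>C diag e v"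
                  using diag_linear_left(3)[OF xh eh, of v] diag_linear_left(2)[OF eh eh, of "wt e x" v]
                  by (simp add: diag_simps eh algebra_simps)
                then show ?thesis by (simp add: scaleC_add_left)
              qed
              then show ?thesis by (simp add: dw.wspace_def)
            qed
            moreover have "diag e v \<in> kerD" using kerD_diag eh v by blast
            moreover have "kerD \<inter> dw.wspace ?\<nu> \<subseteq> N"
            proof (rule Suc.IH)
              have "\<epsilon> \<le> Re (wt e x0)" using \<epsilon>(2) eD by blast
              then show "C - Re (?\<nu> x0) \<le> \<epsilon> * real n" using Suc.prems(1) by (simp add: algebra_simps)
              show "?\<nu> \<in> dual_space t" by (rule dual_space_ops(4)[OF Suc.prems(2) RBD(4)[OF eR]])
            qed
            ultimately show ?thesis by blast
          qed
          have "Cdiag ?B d v - c \<mu> *\<^sub>C v \<in> N"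
            unfolding c_def y0_def
            by (rule Cdiag_highest_weight[OF d N(1,3) Suc.prems(2) _ ev]) (use v in auto)
          then have "Rop ?B d v - c \<mu> *\<^sub>C v \<in> N" using RC v by auto
          \<comment> \<open>The product annihilates all of \<open>M \<otimes> S\<close>, so the
            congruence modulo \<open>N\<close> retains only a multiple of \<open>v\<close>, with a
            nonzero factor because \<open>c \<mu>\<close> is not in \<open>cs\<close>.\<close>
          from kill_roots_mod[OF Rop_clinear N(1) RN this, of cs]
          have "- ((\<Prod>a\<leftarrow>cs. c \<mu> - a) *\<^sub>C v) \<in> N" using cs v by (simp add: dirac_ker_def)
          then have pv: "(\<Prod>a\<leftarrow>cs. c \<mu> - a) *\<^sub>C v \<in> N" using cvec.subspace_neg[OF N(1)] by fastforce
          have "(\<Prod>a\<leftarrow>cs. c \<mu> - a) \<noteq> 0" using ncs by (auto simp: prod_list_zero_iff)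
          then have "v = (1 / (\<Prod>a\<leftarrow>cs. c \<mu> - a)) *\<^sub>C ((\<Prod>a\<leftarrow>cs. c \<mu> - a) *\<^sub>C v)"
            by (simp add: scaleC_scaleC scaleC_one)
          then show ?thesis using cvec.subspace_scale[OF N(1) pv] by metis
        qed
      qed
    qed
  qed
  have "kerD \<subseteq> N"
  proof
    fix v assume v: "v \<in> kerD"
    have "\<exists>\<Lambda> f. finite \<Lambda> \<and> \<Lambda> \<subseteq> wtv ` J \<and> (\<forall>\<mu>\<in>\<Lambda>. f \<mu> \<in> kerD \<inter> dw.wspace \<mu>) \<and> v = (\<Sum>\<mu>\<in>\<Lambda>. f \<mu>)"
      by (rule dw.stable_weight_decomp[where vec = vec])
         (use v kerD_subspace kerD_diag t_h vec_weight wtv_dual dual_space_functionals MS_eq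
           in \<open>auto simp: dirac_ker_def\<close>)
    then obtain \<Lambda> f where f: "\<Lambda> \<subseteq> wtv ` J" "\<And>\<mu>. \<mu> \<in> \<Lambda> \<Longrightarrow> f \<mu> \<in> kerD \<inter> dw.wspace \<mu>" "v = (\<Sum>\<mu>\<in>\<Lambda>. f \<mu>)" by blast
    have "f \<mu> \<in> N" if \<mu>: "\<mu> \<in> \<Lambda>" for \<mu>
    proof -
      have "\<mu> \<in> dual_space t" using \<mu> f(1) wtv_dual by blast
      moreover obtain n where "(C - Re (\<mu> x0)) / \<epsilon> \<le> real n" using real_arch_simple by blast
      then have "C - Re (\<mu> x0) \<le> \<epsilon> * real n" using \<epsilon>(1) by (simp add: field_simps)
      ultimately show ?thesis using main f(2)[OF \<mu>] by blast
    qed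
    then show "v \<in> N" unfolding f(3) by (rule cvec.subspace_sum[OF N(1)])
  qed
  then show ?thesis using F unfolding N_def by blast
qed

lemma kerD_weights:
  "kerD \<subseteq> cvec.span (\<Union>\<mu>\<in>dual_space t. {v \<in> kerD. \<forall>x\<in>t. diag x v = \<mu> x *\<^sub>C v})"
proof
  fix v assume v: "v \<in> kerD"
  have "\<exists>\<Lambda> f. finite \<Lambda> \<and> \<Lambda> \<subseteq> wtv ` J \<and> (\<forall>\<mu>\<in>\<Lambda>. f \<mu> \<in> kerD \<inter> dw.wspace \<mu>) \<and> v = (\<Sum>\<mu>\<in>\<Lambda>. f \<mu>)"
    by (rule dw.stable_weight_decomp[where vec = vec])
       (use v kerD_subspace kerD_diag t_h vec_weight wtv_dual dual_space_functionals MS_eq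
         in \<open>auto simp: dirac_ker_def\<close>)
  then obtain \<Lambda> f where f: "\<Lambda> \<subseteq> wtv ` J" "\<And>\<mu>. \<mu> \<in> \<Lambda> \<Longrightarrow> f \<mu> \<in> kerD \<inter> dw.wspace \<mu>" "v = (\<Sum>\<mu>\<in>\<Lambda>. f \<mu>)" by blast
  have "f \<mu> \<in> (\<Union>\<mu>\<in>dual_space t. {v \<in> kerD. \<forall>x\<in>t. diag x v = \<mu> x *\<^sub>C v})" if "\<mu> \<in> \<Lambda>" for \<mu>
    using f(1,2) that wtv_dual by (fastforce simp: dw.wspace_def)
  then show "v \<in> cvec.span (\<Union>\<mu>\<in>dual_space t. {v \<in> kerD. \<forall>x\<in>t. diag x v = \<mu> x *\<^sub>C v})"
    unfolding f(3) by (intro cvec.span_sum cvec.span_base)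
qed

lemma n_h_h: "n_h br h t Dp \<subseteq> h"
  unfolding n_h_eq by (rule cvec.span_minimal[OF Int_lower2 h_subspace])

lemma n_h_n_plus: "n_h br h t Dp \<subseteq> n_plus br t Dp"
  unfolding n_h_eq n_plus_eq by (rule cvec.span_mono) simp

text \<open>\<open>n_h\<close> lies in \<open>n_plus\<close>, which acts locally finitely on
  \<open>M\<close>, and the spin factor has finite dimension: the submodule generated by
  \<open>m\<close>, tensored with all of \<open>S\<close>, is stable.\<close>

lemma MS_locally_finite:
  assumes v: "v \<in> MS"
  shows "\<exists>F. finite F \<and> gen_submodule (type_module diag) (n_h br h t Dp) {v} \<subseteq> cvec.span F"
proof -
  let ?n = "n_h br h t Dp"
  \<comment> \<open>A stable subspace of finite dimension is demanded, and not just a bound on the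
    generated submodule, so that the property passes to linear combinations: the sum of two such
    subspaces is another one.\<close>
  let ?LF = "\<lambda>v. \<exists>F V. finite F \<and> cvec.subspace V \<and> V \<subseteq> cvec.span F \<and> v \<in> V \<and> (\<forall>x\<in>?n. \<forall>u\<in>V. diag x u \<in> V)"
  have tens: "?LF (tens m s)" if s: "s \<in> S" for m s
  proof -
    let ?Q = "gen_submodule (type_module \<rho>) (n_plus br t Dp) {m}"
    obtain Y where Y: "finite Y" "?Q \<subseteq> cvec.span Y" using lf by blast
    define V where "V = cvec.span {tens a s | a s. a \<in> ?Q \<and> s \<in> S}"
    let ?F = "(\<lambda>(a, vs). tens a (wedge vs)) ` (Y \<times> words)"
    have VF: "V \<subseteq> cvec.span ?F"
      unfolding V_def
    proof (rule cvec.span_minimal[OF _ cvec.subspace_span], clarify)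
      fix a s assume as: "a \<in> ?Q" "s \<in> S"
      have lin1: "clinear (tens m)" for m :: 'm by (simp add: clinear_iff tens_bilinear)
      have lin2: "clinear (\<lambda>m :: 'm. tens m s)" for s :: "'g ext" by (simp add: clinear_iff tens_bilinear)
      have "tens a (wedge vs) \<in> cvec.span ?F" if "vs \<in> words" for vs
      proof (rule clinear_span_subset[OF lin2 cvec.subspace_span])
        show "a \<in> cvec.span Y" using Y(2) as(1) by blast
        show "tens x (wedge vs) \<in> cvec.span ?F" if "x \<in> Y" for x
          by (rule cvec.span_base) (use that \<open>vs \<in> words\<close> in force)
      qed
      then show "tens a s \<in> cvec.span ?F"
        by (intro clinear_span_subset[OF lin1 cvec.subspace_span _ as(2)[unfolded S_eq]]) auto
    qed
    have sub: "cvec.subspace V" unfolding V_def by (rule cvec.subspace_span)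
    have st: "diag x u \<in> V" if x: "x \<in> ?n" and u: "u \<in> V" for x u
    proof -
      have xh: "x \<in> h" and xn: "x \<in> n_plus br t Dp" using x n_h_h n_h_n_plus by blast+
      show ?thesis
      proof (rule clinear_span_subset[OF diag_clinear[OF xh] sub _ u[unfolded V_def]])
        fix v assume "v \<in> {tens a s | a s. a \<in> ?Q \<and> s \<in> S}"
        then obtain a s where v: "v = tens a s" "a \<in> ?Q" "s \<in> S" by blast
        have "\<rho> x a \<in> ?Q" by (rule gen_submodule_type_module(3)[OF xn v(2)])
        then show "diag x v \<in> V"
          unfolding v(1) diag_tens[OF xh] V_def using v S_sp by (intro cvec.span_add cvec.span_base) blast+
      qed
    qed
    have "tens m s \<in> V"
      unfolding V_def using s gen_submodule_type_module(2)[of m "{m}" \<rho> "n_plus br t Dp"]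
      by (intro cvec.span_base) blast
    moreover have "finite ?F" using Y(1) words_finite by simp
    ultimately show ?thesis using VF sub st by blast
  qed
  have "?LF v" using v unfolding M_tensor_S_def
  proof (induction rule: cvec.span_induct_alt)
    case base
    have "diag x 0 = 0" if "x \<in> ?n" for x using that n_h_h by (auto simp: diag_simps)
    then show ?case by (intro exI[of _ "{}"] exI[of _ "{0}"]) auto
  next
    case (step c x y)
    then obtain m s where x: "x = tens m s" "s \<in> S" by blast
    obtain F V where F: "finite F" "cvec.subspace V" "V \<subseteq> cvec.span F" "x \<in> V" "\<And>z u. z \<in> ?n \<Longrightarrow> u \<in> V \<Longrightarrow> diag z u \<in> V"
      using tens[OF x(2), of m] x(1) by blast
    obtain F' V' where F': "finite F'" "cvec.subspace V'" "V' \<subseteq> cvec.span F'" "y \<in> V'" "\<And>z u. z \<in> ?n \<Longrightarrow> u \<in> V' \<Longrightarrow> diag z u \<in> V'"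
      using step.IH by blast
    let ?V = "{a + b | a b. a \<in> V \<and> b \<in> V'}"
    have "cvec.subspace ?V" by (rule cvec.subspace_sums[OF F(2) F'(2)])
    moreover have "?V \<subseteq> cvec.span (F \<union> F')"
      using F(3) F'(3) unfolding cvec.span_Un by blast
    moreover have "c *\<^sub>C x + y \<in> ?V" using F(2,4) F'(4) cvec.subspace_scale by blast
    moreover have "diag z u \<in> ?V" if z: "z \<in> ?n" and u: "u \<in> ?V" for z u
    proof -
      obtain a b where "u = a + b" "a \<in> V" "b \<in> V'" using u by blast
      moreover have "z \<in> h" using z n_h_h by blast
      ultimately show ?thesis using F(5)[OF z] F'(5)[OF z] by (auto simp: diag_simps)
    qed
    moreover have "finite (F \<union> F')" using F(1) F'(1) by simp
    ultimately show ?case by (intro exI[of _ "F \<union> F'"] exI[of _ ?V] conjI ballI)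
  qed
  then obtain F V where F: "finite F" "cvec.subspace V" "V \<subseteq> cvec.span F" "v \<in> V" "\<forall>z\<in>?n. \<forall>u\<in>V. diag z u \<in> V"
    by (elim exE conjE)
  have "gen_submodule (type_module diag) ?n {v} \<subseteq> V"
    by (rule gen_submodule_type_module_least[OF F(2)]) (use F(4,5) in auto)
  then show ?thesis using F(1,3) by (intro exI[of _ F]) simp
qed

lemma cohomology_in_O:
  "finitely_generated h (dirac_cohomology br h t Dp \<rho> Z) \<and>
   category_O br h t (n_h br h t Dp) (dirac_cohomology br h t Dp \<rho> Z)"
proof -
  let ?W = "dirac_im br h t Dp \<rho> Z \<inter> kerD"
  have W: "cvec.subspace ?W"
  proof -
    have "cvec.subspace (D ` MS)"
      unfolding cvec.subspace_def
    proof (intro conjI ballI allI)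
      show "0 \<in> D ` MS" using D_simps(3) cvec.subspace_0[OF MS_subspace] by (metis image_eqI)
      fix x y c assume "x \<in> D ` MS" "y \<in> D ` MS"
      then obtain a b where ab: "a \<in> MS" "b \<in> MS" "x = D a" "y = D b" by blast
      show "x + y \<in> D ` MS" using ab cvec.subspace_add[OF MS_subspace ab(1,2)] D_simps(1)[of a b] by (metis image_eqI)
      show "c *\<^sub>C x \<in> D ` MS" using ab cvec.subspace_scale[OF MS_subspace ab(1)] D_simps(2)[of c a] by (metis image_eqI)
    qed
    then show ?thesis unfolding dirac_im_def by (rule cvec.subspace_inter) (rule kerD_subspace)
  qed
  interpret quo: quotient_setup br h diag kerD ?W
  proof
    fix x v assume x: "x \<in> h"
    show "diag x v \<in> ?W" if vW: "v \<in> ?W"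
    proof -
      obtain a where a: "a \<in> MS" "v = D a" using vW by (auto simp: dirac_im_def)
      then have "diag x v = D (diag x a)" using diag_D[OF x] by simp
      then have "diag x v \<in> dirac_im br h t Dp \<rho> Z"
        unfolding dirac_im_def using MS_diag[OF x a(1)] by (rule image_eqI)
      then show ?thesis using kerD_diag[OF x] vW by blast
    qed
  qed (use kerD_subspace W kerD_diag in \<open>auto simp: diag_simps\<close>)
  obtain F where F: "finite F" "F \<subseteq> kerD" "kerD \<subseteq> gen_submodule (type_module diag) h F"
    using kerD_finitely_generated by blast
  have "finitely_generated h (quotient_module diag kerD ?W)"
    by (rule quo.Q_finitely_generated[OF F])
  moreover have "is_lie_module br h (quotient_module diag kerD ?W)"
    by (rule quo.Q_is_lie_module) (auto simp: diag_linear_left h_subspace h_br)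
  moreover have "weight_module t (quotient_module diag kerD ?W)"
    by (rule quo.Q_weight_module[OF t_h kerD_weights])
  moreover have "locally_finite (n_h br h t Dp) (quotient_module diag kerD ?W)"
    by (rule quo.Q_locally_finite[OF n_h_h]) (use MS_locally_finite in \<open>auto simp: dirac_ker_def\<close>)
  ultimately show ?thesis unfolding dirac_cohomology_def category_O_def by blast
qed

end

lemma is_lie_module_type_moduleD:
  fixes \<rho> :: "'g::complex_vec \<Rightarrow> 'm::complex_vec \<Rightarrow> 'm"
  assumes "is_lie_module br UNIV (type_module \<rho>)"
  shows "\<rho> x (m + m') = \<rho> x m + \<rho> x m'" "\<rho> x (c *\<^sub>C m) = c *\<^sub>C \<rho> x m"
    "\<rho> (x + y) m = \<rho> x m + \<rho> y m" "\<rho> (c *\<^sub>C x) m = c *\<^sub>C \<rho> x m"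
    "\<rho> (br x y) m = \<rho> x (\<rho> y m) - \<rho> y (\<rho> x m)"
proof -
  note a = assms[unfolded is_lie_module_def, simplified]
  interpret abelian_group "type_module \<rho>"
    using a by (blast intro: module.axioms(2))
  have "\<ominus>\<^bsub>type_module \<rho>\<^esub> v = - v" for v
    by (rule minus_equality) simp_all
  then have "u \<ominus>\<^bsub>type_module \<rho>\<^esub> v = u - v" for u v
    by (simp add: a_minus_def)
  then show "\<rho> x (m + m') = \<rho> x m + \<rho> x m'" "\<rho> x (c *\<^sub>C m) = c *\<^sub>C \<rho> x m"
    "\<rho> (x + y) m = \<rho> x m + \<rho> y m" "\<rho> (c *\<^sub>C x) m = c *\<^sub>C \<rho> x m"
    "\<rho> (br x y) m = \<rho> x (\<rho> y m) - \<rho> y (\<rho> x m)"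
    using a by simp_all
qed

theorem theorem3p4:
  fixes br :: "'g::complex_vec \<Rightarrow> 'g \<Rightarrow> 'g"
    and \<theta> :: "'g \<Rightarrow> 'g"
    and h t Z :: "'g set"
    and Dp :: "('g \<Rightarrow> complex) set"
    and \<rho> :: "'g \<Rightarrow> 'm::complex_vec \<Rightarrow> 'm"
  assumes "lie_algebra br" and "finite_dim_type TYPE('g)" and "semisimple br"
    and "cartan_involution br \<theta>"
    and "lie_subalgebra br h" and "reductive br h" and "\<theta> ` h \<subseteq> h" and "nondegenerate_on br h"
    and "cartan_subalgebra br t" and "t \<subseteq> h"
    and "positive_system br t Dp"
    and "orthonormal_basis_q br h Z"
    and "category_O br UNIV t (n_plus br t Dp) (type_module \<rho>)"
  shows "finitely_generated h (dirac_cohomology br h t Dp \<rho> Z) \<and>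
    category_O br h t (n_h br h t Dp) (dirac_cohomology br h t Dp \<rho> Z)"
proof -
  note O = assms(13)[unfolded category_O_def]
  note lie = is_lie_module_type_moduleD[OF O[THEN conjunct1]]
  interpret lie_algebra br by (rule assms(1))
  interpret dirac_module br h t Z Dp \<rho>
    by unfold_locales (use assms lie in \<open>auto simp: lie_algebra_def\<close>)
  obtain F where F: "finite F" "gen_submodule (type_module \<rho>) UNIV F = UNIV"
    using O by (auto simp: finitely_generated_def)
  have "weight_space t (type_module \<rho>) \<mu> = mw.wspace \<mu>" for \<mu>
    by (simp add: weight_space_def mw.wspace_def)
  then have wm: "cvec.span (\<Union>\<mu>\<in>dual_space t. mw.wspace \<mu>) = UNIV"
    using O by (simp add: weight_module_def gen_submodule_empty)
  have lf: "\<exists>F. finite F \<and> gen_submodule (type_module \<rho>) (n_plus br t Dp) {v} \<subseteq> cvec.span F" for v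
    using O by (auto simp: locally_finite_def gen_submodule_empty)
  obtain Wb \<kappa> where "finite Wb" "\<forall>w\<in>Wb. \<kappa> w \<in> dual_space t \<and> w \<in> mw.wspace (\<kappa> w)"
    "cvec.span {foldr \<rho> ys w | ys w. set ys \<subseteq> Eneg \<and> w \<in> Wb} = UNIV"
    using highest_weight_generators[OF F wm lf] by blast
  then interpret dirac_O br h t Z Dp \<rho> Wb \<kappa>
    by unfold_locales (use lf in auto)
  show ?thesis by (rule cohomology_in_O)
qed

end
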